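(* Let $a,b\in\mathbb R$ and $T>0$, and suppose that $\sigma(t)\ne0$ for all $t\ge0$. The process $(U_t)_{t\in[0,T)}$ defined by $$U_t:=n_{a,b}(0,t)+\int_0^t\frac{\gamma(t,T)}{\gamma(s,T)}\,e^{\bar q(t)-\bar q(s)}\sigma(s)\,\mathrm dB_s,\qquad t\in[0,T),$$ is a unique strong solution of the linear stochastic differential equation $$\mathrm dU_t=\left(q(t)-\frac{e^{2(\bar q(T)-\bar q(t))}}{\gamma(t,T)}\sigma^2(t)\right)U_t\,\mathrm dt+\left(r(t)+\frac{e^{\bar q(T)-\bar q(t)}}{\gamma(t,T)}\left(b-\int_t^Te^{\bar q(T)-\bar q(u)}r(u)\,\mathrm du\right)\sigma^2(t)\right)\mathrm dt+\sigma(t)\,\mathrm dB_t$$ for $t\in[0,T)$ with initial condition $U_0=a$, and strong uniqueness holds for this stochastic differential equation.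
   Context: $q,\sigma,r:\mathbb R_+\to\mathbb R$ are continuous functions, $(B_t)_{t\ge0}$ is a standard Wiener process on a filtered probability space satisfying the usual conditions (the filtration being constructed by the help of $B$), and $\bar q(t):=\int_0^tq(u)\,\mathrm du$. For $0\le s\le t$ and $x\in\mathbb R$, $$m_x(s,t):=e^{\bar q(t)-\bar q(s)}x+\int_s^te^{\bar q(t)-\bar q(u)}r(u)\,\mathrm du,\qquad \gamma(s,t):=\int_s^te^{2(\bar q(t)-\bar q(u))}\sigma^2(u)\,\mathrm du.$$ For $0\le s\le t<T$, $$n_{a,b}(s,t):=\frac{\gamma(s,t)}{\gamma(s,T)}\,e^{\bar q(T)-\bar q(t)}\left(b-\int_t^Te^{\bar q(T)-\bar q(u)}r(u)\,\mathrm du\right)+\frac{\gamma(t,T)}{\gamma(s,T)}\,m_a(s,t).$$ *)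

theory Defs
  imports "HOL-Probability.Probability"
begin

definition qbar :: "(real \<Rightarrow> real) \<Rightarrow> real \<Rightarrow> real" where
  "qbar q t = integral {0..t} q"

definition flow_mean :: "(real \<Rightarrow> real) \<Rightarrow> (real \<Rightarrow> real) \<Rightarrow> real \<Rightarrow> real \<Rightarrow> real \<Rightarrow> real" where
  "flow_mean q r x s t =
     exp (qbar q t - qbar q s) * x + integral {s..t} (\<lambda>u. exp (qbar q t - qbar q u) * r u)"

definition gam :: "(real \<Rightarrow> real) \<Rightarrow> (real \<Rightarrow> real) \<Rightarrow> real \<Rightarrow> real \<Rightarrow> real" where
  "gam q \<sigma> s t = integral {s..t} (\<lambda>u. exp (2 * (qbar q t - qbar q u)) * (\<sigma> u)\<^sup>2)"

definition bridge_mean ::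
  "(real \<Rightarrow> real) \<Rightarrow> (real \<Rightarrow> real) \<Rightarrow> (real \<Rightarrow> real) \<Rightarrow> real \<Rightarrow> real \<Rightarrow> real \<Rightarrow> real \<Rightarrow> real \<Rightarrow> real" where
  "bridge_mean q \<sigma> r T a b s t =
     gam q \<sigma> s t / gam q \<sigma> s T * exp (qbar q T - qbar q t)
       * (b - integral {t..T} (\<lambda>u. exp (qbar q T - qbar q u) * r u))
     + gam q \<sigma> t T / gam q \<sigma> s T * flow_mean q r a s t"

definition bridge_drift ::
  "(real \<Rightarrow> real) \<Rightarrow> (real \<Rightarrow> real) \<Rightarrow> (real \<Rightarrow> real) \<Rightarrow> real \<Rightarrow> real \<Rightarrow> real \<Rightarrow> real \<Rightarrow> real" where
  "bridge_drift q \<sigma> r T b t x =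
     (q t - exp (2 * (qbar q T - qbar q t)) / gam q \<sigma> t T * (\<sigma> t)\<^sup>2) * x
     + (r t + exp (qbar q T - qbar q t) / gam q \<sigma> t T
              * (b - integral {t..T} (\<lambda>u. exp (qbar q T - qbar q u) * r u)) * (\<sigma> t)\<^sup>2)"

definition preimages :: "'w measure \<Rightarrow> ('w \<Rightarrow> real) \<Rightarrow> 'w set set" where
  "preimages M X = {X -` A \<inter> space M | A. A \<in> sets borel}"

definition history :: "'w measure \<Rightarrow> (real \<Rightarrow> 'w \<Rightarrow> real) \<Rightarrow> real \<Rightarrow> 'w set set" where
  "history M B t = (\<Union>s\<in>{0..t}. preimages M (B s))"

definition augmentation :: "'w measure \<Rightarrow> 'w set set \<Rightarrow> 'w measure" where
  "augmentation M G = sigma (space M) (G \<union> null_sets M)"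

text \<open>Filtrations and processes are indexed by all of \<^typ>\<open>real\<close>, but only times
  \<open>t \<ge> 0\<close> matter.\<close>

definition usual_conditions :: "'w measure \<Rightarrow> (real \<Rightarrow> 'w measure) \<Rightarrow> bool" where
  "usual_conditions M F \<longleftrightarrow>
     prob_space M \<and> complete_measure M \<and>
     (\<forall>t\<ge>0. subalgebra M (F t)) \<and>
     (\<forall>s t. 0 \<le> s \<and> s \<le> t \<longrightarrow> sets (F s) \<subseteq> sets (F t)) \<and>
     null_sets M \<subseteq> sets (F 0) \<and>
     (\<forall>t\<ge>0. (\<Inter>u\<in>{t<..}. sets (F u)) = sets (F t))"

definition wiener_process ::
  "'w measure \<Rightarrow> (real \<Rightarrow> 'w measure) \<Rightarrow> (real \<Rightarrow> 'w \<Rightarrow> real) \<Rightarrow> bool" where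
  "wiener_process M F B \<longleftrightarrow>
     (\<forall>t\<ge>0. B t \<in> borel_measurable (F t)) \<and>
     (AE \<omega> in M. B 0 \<omega> = 0) \<and>
     (AE \<omega> in M. continuous_on {0..} (\<lambda>t. B t \<omega>)) \<and>
     (\<forall>s t. 0 \<le> s \<and> s < t \<longrightarrow>
        distributed M lborel (\<lambda>\<omega>. B t \<omega> - B s \<omega>) (normal_density 0 (sqrt (t - s))) \<and>
        prob_space.indep_set M (sets (F s)) (preimages M (\<lambda>\<omega>. B t \<omega> - B s \<omega>)))"

text \<open>The simple integrand \<open>\<Sum>i<n. h i \<cdot> 1(p i, p (i+1)]\<close> with partition points \<open>p\<close> and
  bounded coefficients \<open>h i\<close> that are measurable at the left end point.\<close>

definition simple_integrand ::
  "'w measure \<Rightarrow> (real \<Rightarrow> 'w measure) \<Rightarrow> nat \<Rightarrow> (nat \<Rightarrow> real) \<Rightarrow> (nat \<Rightarrow> 'w \<Rightarrow> real) \<Rightarrow> bool" where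
  "simple_integrand M F n p h \<longleftrightarrow>
     0 \<le> p 0 \<and> (\<forall>i<n. p i \<le> p (Suc i)) \<and>
     (\<forall>i<n. h i \<in> borel_measurable (F (p i)) \<and> (\<exists>C. \<forall>\<omega>\<in>space M. \<bar>h i \<omega>\<bar> \<le> C))"

definition simple_process ::
  "nat \<Rightarrow> (nat \<Rightarrow> real) \<Rightarrow> (nat \<Rightarrow> 'w \<Rightarrow> real) \<Rightarrow> real \<Rightarrow> 'w \<Rightarrow> real" where
  "simple_process n p h s \<omega> = (\<Sum>i<n. h i \<omega> * indicator {p i<..p (Suc i)} s)"

definition simple_integral ::
  "(real \<Rightarrow> 'w \<Rightarrow> real) \<Rightarrow> real \<Rightarrow> nat \<Rightarrow> (nat \<Rightarrow> real) \<Rightarrow> (nat \<Rightarrow> 'w \<Rightarrow> real) \<Rightarrow> 'w \<Rightarrow> real" where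
  "simple_integral B t n p h \<omega> =
     (\<Sum>i<n. h i \<omega> * (B (min (p (Suc i)) t) \<omega> - B (min (p i) t) \<omega>))"

definition progressive_upto :: "(real \<Rightarrow> 'w measure) \<Rightarrow> real \<Rightarrow> (real \<Rightarrow> 'w \<Rightarrow> real) \<Rightarrow> bool" where
  "progressive_upto F t H \<longleftrightarrow>
     (\<forall>u\<in>{0..t}. (\<lambda>(s, \<omega>). H s \<omega>) \<in> borel_measurable (restrict_space borel {0..u} \<Otimes>\<^sub>M F u))"

text \<open>The random variable \<open>Y\<close> is a version of the Ito integral of \<open>H\<close> over \<open>[0, t]\<close>: the
  \<open>L\<^sup>2\<close> limit of the integrals of simple integrands that converge to \<open>H\<close> in
  \<open>L\<^sup>2(P \<otimes> ds)\<close>.\<close>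

definition has_ito_integral ::
  "'w measure \<Rightarrow> (real \<Rightarrow> 'w measure) \<Rightarrow> (real \<Rightarrow> 'w \<Rightarrow> real) \<Rightarrow> real \<Rightarrow>
   (real \<Rightarrow> 'w \<Rightarrow> real) \<Rightarrow> ('w \<Rightarrow> real) \<Rightarrow> bool" where
  "has_ito_integral M F B t H Y \<longleftrightarrow>
     progressive_upto F t H \<and> Y \<in> borel_measurable M \<and>
     (\<exists>n p h. (\<forall>k. simple_integrand M F (n k) (p k) (h k)) \<and>
        (\<lambda>k. \<integral>\<^sup>+\<omega>. (\<integral>\<^sup>+s\<in>{0..t}. ennreal ((simple_process (n k) (p k) (h k) s \<omega> - H s \<omega>)\<^sup>2) \<partial>lborel) \<partial>M)
          \<longlonglongrightarrow> 0 \<and>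
        (\<lambda>k. \<integral>\<^sup>+\<omega>. ennreal ((simple_integral B t (n k) (p k) (h k) \<omega> - Y \<omega>)\<^sup>2) \<partial>M) \<longlonglongrightarrow> 0)"

definition ito_integral_process ::
  "'w measure \<Rightarrow> (real \<Rightarrow> 'w measure) \<Rightarrow> (real \<Rightarrow> 'w \<Rightarrow> real) \<Rightarrow> real \<Rightarrow>
   (real \<Rightarrow> 'w \<Rightarrow> real) \<Rightarrow> (real \<Rightarrow> 'w \<Rightarrow> real) \<Rightarrow> bool" where
  "ito_integral_process M F B T H J \<longleftrightarrow>
     (\<forall>\<omega>\<in>space M. continuous_on {0..<T} (\<lambda>t. J t \<omega>)) \<and>
     (\<forall>t\<in>{0..<T}. has_ito_integral M F B t H (J t))"

definition indistinguishable ::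
  "'w measure \<Rightarrow> real \<Rightarrow> (real \<Rightarrow> 'w \<Rightarrow> real) \<Rightarrow> (real \<Rightarrow> 'w \<Rightarrow> real) \<Rightarrow> bool" where
  "indistinguishable M T X Y \<longleftrightarrow> (AE \<omega> in M. \<forall>t\<in>{0..<T}. X t \<omega> = Y t \<omega>)"

text \<open>Strong solutions on \<open>[0, T)\<close> of \<open>dX = f(t, X) dt + \<sigma>(t) dB\<close> with initial value \<open>\<xi>\<close>.
  That \<open>F\<close> is the augmentation of the filtration generated by \<open>\<xi>\<close> and \<open>B\<close> is required
  where the definition is used.\<close>

definition strong_solution ::
  "'w measure \<Rightarrow> (real \<Rightarrow> 'w measure) \<Rightarrow> (real \<Rightarrow> 'w \<Rightarrow> real) \<Rightarrow> real \<Rightarrow>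
   (real \<Rightarrow> real \<Rightarrow> real) \<Rightarrow> (real \<Rightarrow> real) \<Rightarrow> ('w \<Rightarrow> real) \<Rightarrow> (real \<Rightarrow> 'w \<Rightarrow> real) \<Rightarrow> bool" where
  "strong_solution M F B T f \<sigma> \<xi> X \<longleftrightarrow>
     (\<forall>t\<in>{0..<T}. X t \<in> borel_measurable (F t)) \<and>
     (\<forall>\<omega>\<in>space M. continuous_on {0..<T} (\<lambda>t. X t \<omega>)) \<and>
     (AE \<omega> in M. X 0 \<omega> = \<xi> \<omega>) \<and>
     (AE \<omega> in M. \<forall>t\<in>{0..<T}. (\<lambda>s. f s (X s \<omega>)) absolutely_integrable_on {0..t} \<and>
                               (\<lambda>s. (\<sigma> s)\<^sup>2) integrable_on {0..t}) \<and>
     (\<exists>J. ito_integral_process M F B T (\<lambda>s _. \<sigma> s) J \<and>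
          (AE \<omega> in M. \<forall>t\<in>{0..<T}.
             X t \<omega> = X 0 \<omega> + integral {0..t} (\<lambda>s. f s (X s \<omega>)) + J t \<omega>))"

text \<open>Strong uniqueness in the sense of Karatzas and Shreve, for all set-ups whose sample space
  has type \<^typ>\<open>'w\<close>. The initial value \<open>\<xi>\<close> is independent of \<open>B\<close>: it is measurable with
  respect to \<open>F 0\<close>, of which \<^const>\<open>wiener_process\<close> makes the increments independent.\<close>

definition strong_uniqueness ::
  "'w itself \<Rightarrow> real \<Rightarrow> (real \<Rightarrow> real \<Rightarrow> real) \<Rightarrow> (real \<Rightarrow> real) \<Rightarrow> bool" where
  "strong_uniqueness TYPE('w) T f \<sigma> \<longleftrightarrow>
     (\<forall>(M :: 'w measure) F B \<xi> X Y.
        \<xi> \<in> borel_measurable M \<longrightarrow>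
        F = (\<lambda>t. augmentation M (preimages M \<xi> \<union> history M B t)) \<longrightarrow>
        usual_conditions M F \<longrightarrow>
        wiener_process M F B \<longrightarrow>
        strong_solution M F B T f \<sigma> \<xi> X \<longrightarrow>
        strong_solution M F B T f \<sigma> \<xi> Y \<longrightarrow>
        indistinguishable M T X Y)"

text \<open>A stochastic integral is determined only almost surely for each \<open>t\<close>, so the formula for
  \<open>U t\<close> is a condition on \<open>U\<close>; as usual the modification with continuous paths is meant.
  The integrand itself depends on the upper limit \<open>t\<close>.\<close>

definition bridge_process ::
  "'w measure \<Rightarrow> (real \<Rightarrow> 'w measure) \<Rightarrow> (real \<Rightarrow> 'w \<Rightarrow> real) \<Rightarrow>
   (real \<Rightarrow> real) \<Rightarrow> (real \<Rightarrow> real) \<Rightarrow> (real \<Rightarrow> real) \<Rightarrow> real \<Rightarrow> real \<Rightarrow> real \<Rightarrow>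
   (real \<Rightarrow> 'w \<Rightarrow> real) \<Rightarrow> bool" where
  "bridge_process M F B q \<sigma> r T a b U \<longleftrightarrow>
     (\<forall>\<omega>\<in>space M. continuous_on {0..<T} (\<lambda>t. U t \<omega>)) \<and>
     (\<forall>t\<in>{0..<T}. has_ito_integral M F B t
        (\<lambda>s _. gam q \<sigma> t T / gam q \<sigma> s T * exp (qbar q t - qbar q s) * \<sigma> s)
        (\<lambda>\<omega>. U t \<omega> - bridge_mean q \<sigma> r T a b 0 t))"

end

(*
  The bridge equation is linear with deterministic coefficients and additive noise, so the only
  stochastic ingredient is a continuous version J of the Wiener integral of sigma: once it is there,
  a solution is a pathwise solution of a linear ODE driven by J.

  For the homogeneous equation the solution is g(t) = e^qbar(t) (A(T) - A(t)) with
  A(t) = int_0^t e^(-2 qbar) sigma^2, and up to a constant factor the kernel of the stochastic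
  integral in U_t is g(t) / g(s). Integration by parts moves J out of the stochastic integral,
    int_0^t sigma / g dB = J_t / g(t) - int_0^t (1/g)' J ds,
  so that U is given pathwise by the variation of constants formula.

  Both J and the integration by parts formula come from one closure principle: if phi_k -> phi in
  L^2(ds) and the integrals of phi_k converge almost surely, then the limit is the integral of phi,
  by the isometry and Fatou's lemma. For J the almost sure uniform convergence of the integrals of
  step functions follows from Kolmogorov's maximal inequality and Borel-Cantelli.

  Uniqueness: two solutions have indistinguishable driving integrals by the isometry, and their
  difference D satisfies (D / g)' = 0.
*)

theory Submission
  imports Defs
begin


section \<open>Increments of the Wiener process\<close>

text \<open>The integral is defined through arbitrary simple integrands with random coefficients,
  whereas the construction works with deterministic step functions on uniform grids. Both are placed
  in one linear graph of elementary processes; its isometry is proved for products of two arbitrary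
  random steps, so that partitions never have to be refined.

  The integrand of U depends on the upper limit t, so U is not an integral process at face value. It
  becomes one up to a factor because gamma(s,t) = e^(2 qbar(t)) (A(t) - A(s)) splits the kernel into
  a function of t times a function of s.

  Ito's formula is replaced by a cancellation: J is only continuous in time, but U - J is
  continuously differentiable, and its derivative is the drift at U.

  Since g(T) = 0, the coefficients blow up at T. Pathwise arguments therefore run on [0,t] with t <
  T, although J itself lives on [0,T].

  The formula for U fixes each U_t only almost surely. The pathwise U serves as a reference process:
  the equation is proved for it and then carried over to every continuous process that satisfies the
  formula.\<close>

locale brownian_setup =
  fixes M :: "'w measure" and F :: "real \<Rightarrow> 'w measure" and B :: "real \<Rightarrow> 'w \<Rightarrow> real"
  assumes usual: "usual_conditions M F" and wiener: "wiener_process M F B"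

sublocale brownian_setup \<subseteq> prob_space M
  using usual by (simp add: usual_conditions_def)

sublocale brownian_setup \<subseteq> complete_measure M
  using usual by (simp add: usual_conditions_def)

context brownian_setup
begin

lemma subalg: "0 \<le> t \<Longrightarrow> subalgebra M (F t)"
  using usual by (simp add: usual_conditions_def)

lemma space_F: "0 \<le> t \<Longrightarrow> space (F t) = space M"
  using subalg unfolding subalgebra_def by blast

lemma filtration_mono: "0 \<le> s \<Longrightarrow> s \<le> t \<Longrightarrow> subalgebra (F t) (F s)"
  using usual space_F[of s] space_F[of t] unfolding usual_conditions_def subalgebra_def by auto

lemma measurable_F_M: "f \<in> borel_measurable (F t) \<Longrightarrow> 0 \<le> t \<Longrightarrow> f \<in> borel_measurable M"
  using measurable_from_subalg[OF subalg] by blast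

lemma measurable_F_mono:
  "f \<in> borel_measurable (F s) \<Longrightarrow> 0 \<le> s \<Longrightarrow> s \<le> t \<Longrightarrow> f \<in> borel_measurable (F t)"
  using measurable_from_subalg[OF filtration_mono] by blast

lemma null_sets_F: "0 \<le> t \<Longrightarrow> null_sets M \<subseteq> sets (F t)"
  using usual unfolding usual_conditions_def by (metis order_refl order_trans)

lemma B_adapted: "0 \<le> t \<Longrightarrow> B t \<in> borel_measurable (F t)"
  using wiener by (simp add: wiener_process_def)

lemma B_adapted': "0 \<le> s \<Longrightarrow> s \<le> t \<Longrightarrow> B s \<in> borel_measurable (F t)"
  using B_adapted measurable_F_mono by blast

lemma B_measurable: "0 \<le> t \<Longrightarrow> B t \<in> borel_measurable M"
  using B_adapted measurable_F_M by blast

lemma B_continuous: "AE \<omega> in M. continuous_on {0..} (\<lambda>t. B t \<omega>)"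
  using wiener by (simp add: wiener_process_def)

lemma B_zero: "AE \<omega> in M. B 0 \<omega> = 0"
  using wiener by (simp add: wiener_process_def)

section \<open>Moments, independence and products of increments\<close>

lemma increment_moments:
  assumes "0 \<le> s" "s \<le> t"
  shows "integrable M (\<lambda>\<omega>. B t \<omega> - B s \<omega>)" "expectation (\<lambda>\<omega>. B t \<omega> - B s \<omega>) = 0"
    "integrable M (\<lambda>\<omega>. (B t \<omega> - B s \<omega>)\<^sup>2)" "expectation (\<lambda>\<omega>. (B t \<omega> - B s \<omega>)\<^sup>2) = t - s"
proof -
  have "integrable M (\<lambda>\<omega>. B t \<omega> - B s \<omega>) \<and> expectation (\<lambda>\<omega>. B t \<omega> - B s \<omega>) = 0 \<and>
    integrable M (\<lambda>\<omega>. (B t \<omega> - B s \<omega>)\<^sup>2) \<and> expectation (\<lambda>\<omega>. (B t \<omega> - B s \<omega>)\<^sup>2) = t - s"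
  proof (cases "s = t")
    \<comment> \<open>The law of the increment is given only for \<open>s < t\<close>; for
      \<open>s = t\<close> all claims concern the zero function.\<close>
    case False
    with assms have st: "s < t" by simp
    let ?X = "\<lambda>\<omega>. B t \<omega> - B s \<omega>"
    have D: "distributed M lborel ?X (normal_density 0 (sqrt (t - s)))"
      using wiener st assms by (simp add: wiener_process_def)
    have pos: "0 < sqrt (t - s)" using st by simp
    have E: "expectation ?X = 0" by (rule normal_distributed_expectation[OF pos D])
    have V: "variance ?X = (sqrt (t - s))\<^sup>2" by (rule normal_distributed_variance[OF pos D])
    have 1: "integrable M ?X"
      using distributed_integrable[OF D, of "\<lambda>x. x"] integrable_normal_moment[OF pos, of 0 1] by simp
    have 2: "integrable M (\<lambda>\<omega>. (?X \<omega>)\<^sup>2)"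
      using distributed_integrable[OF D, of "\<lambda>x. x\<^sup>2"] integrable_normal_moment[OF pos, of 0 2] by simp
    show ?thesis using 1 2 E V st by simp
  qed simp
  then show "integrable M (\<lambda>\<omega>. B t \<omega> - B s \<omega>)" "expectation (\<lambda>\<omega>. B t \<omega> - B s \<omega>) = 0"
    "integrable M (\<lambda>\<omega>. (B t \<omega> - B s \<omega>)\<^sup>2)" "expectation (\<lambda>\<omega>. (B t \<omega> - B s \<omega>)\<^sup>2) = t - s"
    by auto
qed

text \<open>Independence is given for families of sets, while \<open>indep_var\<close> speaks of
  generated sigma-algebras; preimages of Borel sets are closed under intersection, which permits the
  passage. The function \<open>f\<close> makes the squared increment available too.\<close>

lemma indep_increment:
  fixes f :: "real \<Rightarrow> real"
  assumes "0 \<le> s" "s < t" and Z: "Z \<in> borel_measurable (F s)" and f: "f \<in> borel_measurable borel"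
  shows "indep_var borel Z borel (\<lambda>\<omega>. f (B t \<omega> - B s \<omega>))"
proof -
  let ?X = "\<lambda>\<omega>. B t \<omega> - B s \<omega>"
  have ZM: "random_variable borel Z" by (rule measurable_F_M[OF Z assms(1)])
  have XM: "random_variable borel ?X"
    using assms by (intro borel_measurable_diff B_measurable) auto
  have I: "indep_set (sets (F s)) (preimages M ?X)"
    using wiener assms by (simp add: wiener_process_def)
  have "indep_set (sigma_sets (space M) {Z -` A \<inter> space M |A. A \<in> sets borel})
     (sigma_sets (space M) {?X -` A \<inter> space M |A. A \<in> sets borel})"
  proof (rule indep_set_sigma_sets)
    have sub: "{Z -` A \<inter> space M |A. A \<in> sets borel} \<subseteq> sets (F s)"
      using measurable_sets[OF Z] space_F[OF assms(1)] by auto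
    show "indep_set {Z -` A \<inter> space M |A. A \<in> sets borel} {?X -` A \<inter> space M |A. A \<in> sets borel}"
      using I sub unfolding indep_sets2_eq preimages_def by blast
    have "Int_stable {f -` A \<inter> space M |A. A \<in> sets borel}" for f :: "'w \<Rightarrow> real"
    proof (rule Int_stableI, clarify)
      fix A A' :: "real set" assume "A \<in> sets borel" "A' \<in> sets borel"
      then show "\<exists>C. f -` A \<inter> space M \<inter> (f -` A' \<inter> space M) = f -` C \<inter> space M \<and> C \<in> sets borel"
        by (intro exI[of _ "A \<inter> A'"]) auto
    qed
    from this[of Z] this[of ?X] show "Int_stable {Z -` A \<inter> space M |A. A \<in> sets borel}"
      "Int_stable {?X -` A \<inter> space M |A. A \<in> sets borel}" .
  qed
  then have "indep_var borel Z borel ?X"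
    unfolding indep_var_eq by (intro conjI ZM XM)
  from indep_var_compose[OF this measurable_ident_sets[OF refl] f] show ?thesis
    unfolding comp_def id_def .
qed

text \<open>By independence the expectations factorise, and a product of independent integrable
  variables is integrable.\<close>

lemma increment_orthogonal:
  assumes "0 \<le> s" "s \<le> t" and Z: "Z \<in> borel_measurable (F s)" and Zi: "integrable M Z"
  shows "integrable M (\<lambda>\<omega>. Z \<omega> * (B t \<omega> - B s \<omega>))"
    "expectation (\<lambda>\<omega>. Z \<omega> * (B t \<omega> - B s \<omega>)) = 0"
    "integrable M (\<lambda>\<omega>. Z \<omega> * (B t \<omega> - B s \<omega>)\<^sup>2)"
    "expectation (\<lambda>\<omega>. Z \<omega> * (B t \<omega> - B s \<omega>)\<^sup>2) = expectation Z * (t - s)"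
proof -
  note m = increment_moments[OF assms(1,2)]
  have "integrable M (\<lambda>\<omega>. Z \<omega> * (B t \<omega> - B s \<omega>)) \<and>
    expectation (\<lambda>\<omega>. Z \<omega> * (B t \<omega> - B s \<omega>)) = 0 \<and>
    integrable M (\<lambda>\<omega>. Z \<omega> * (B t \<omega> - B s \<omega>)\<^sup>2) \<and>
    expectation (\<lambda>\<omega>. Z \<omega> * (B t \<omega> - B s \<omega>)\<^sup>2) = expectation Z * (t - s)"
  proof (cases "s = t")
    case False
    then have st: "s < t" using assms by simp
    note i1 = indep_increment[OF assms(1) st Z, of "\<lambda>x. x", simplified]
    note i2 = indep_increment[OF assms(1) st Z, of "\<lambda>x. x\<^sup>2", simplified]
    show ?thesis
      using indep_var_integrable[OF i1 Zi m(1)] indep_var_lebesgue_integral[OF i1 Zi m(1)]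
        indep_var_integrable[OF i2 Zi m(3)] indep_var_lebesgue_integral[OF i2 Zi m(3)] m
      by simp
  qed simp
  then show "integrable M (\<lambda>\<omega>. Z \<omega> * (B t \<omega> - B s \<omega>))"
    "expectation (\<lambda>\<omega>. Z \<omega> * (B t \<omega> - B s \<omega>)) = 0"
    "integrable M (\<lambda>\<omega>. Z \<omega> * (B t \<omega> - B s \<omega>)\<^sup>2)"
    "expectation (\<lambda>\<omega>. Z \<omega> * (B t \<omega> - B s \<omega>)\<^sup>2) = expectation Z * (t - s)" by auto
qed

text \<open>The core of the isometry. Cutting at \<open>c\<close> and at \<open>e = min b d\<close>
  leaves only the squared increment over the overlap from \<open>c\<close> to \<open>e\<close>: in
  every other term an increment is multiplied by factors known at its left end, so its expectation
  vanishes.\<close>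

lemma increment_product_le:
  assumes ab: "0 \<le> a" "a \<le> b" and cd: "c \<le> d" and ac: "a \<le> c"
    and h: "h \<in> borel_measurable (F a)" "\<And>\<omega>. \<omega> \<in> space M \<Longrightarrow> \<bar>h \<omega>\<bar> \<le> C"
    and k: "k \<in> borel_measurable (F c)" "\<And>\<omega>. \<omega> \<in> space M \<Longrightarrow> \<bar>k \<omega>\<bar> \<le> D"
  shows "has_bochner_integral M (\<lambda>\<omega>. (h \<omega> * (B b \<omega> - B a \<omega>)) * (k \<omega> * (B d \<omega> - B c \<omega>)))
    (expectation (\<lambda>\<omega>. h \<omega> * k \<omega>) * measure lborel ({a<..b} \<inter> {c<..d}))"
proof -
  have c0: "0 \<le> c" using ab ac by simp
  have hc: "h \<in> borel_measurable (F c)" using measurable_F_mono[OF h(1)] ab ac by simp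
  have hkc: "(\<lambda>\<omega>. h \<omega> * k \<omega>) \<in> borel_measurable (F c)"
    by (rule borel_measurable_times[OF hc k(1)])
  have hkM: "(\<lambda>\<omega>. h \<omega> * k \<omega>) \<in> borel_measurable M"
    by (rule measurable_F_M[OF hkc c0])
  have bnd: "\<bar>h \<omega> * k \<omega>\<bar> \<le> C * D" if "\<omega> \<in> space M" for \<omega>
    using h(2)[OF that] k(2)[OF that] by (auto simp: abs_mult intro!: mult_mono)
  have hk: "integrable M (\<lambda>\<omega>. h \<omega> * k \<omega>)"
    by (rule integrable_const_bound[of _ "C * D"]) (use bnd hkM in auto)
  have hkB: "integrable M (\<lambda>\<omega>. h \<omega> * k \<omega> * (B v \<omega> - B u \<omega>))" if "0 \<le> u" "u \<le> v" for u v
  proof (rule Bochner_Integration.integrable_bound[OF integrable_mult_right[OF increment_moments(1)[OF that], of "C*D"]])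
    show "AE \<omega> in M. norm (h \<omega> * k \<omega> * (B v \<omega> - B u \<omega>)) \<le> norm (C * D * (B v \<omega> - B u \<omega>))"
    proof (rule AE_I2)
      fix \<omega> assume "\<omega> \<in> space M"
      then have "\<bar>h \<omega> * k \<omega>\<bar> \<le> \<bar>C * D\<bar>" using bnd by fastforce
      then show "norm (h \<omega> * k \<omega> * (B v \<omega> - B u \<omega>)) \<le> norm (C * D * (B v \<omega> - B u \<omega>))"
        unfolding real_norm_def abs_mult[of _ "B v \<omega> - B u \<omega>"] by (rule mult_right_mono) simp
    qed
    show "(\<lambda>\<omega>. h \<omega> * k \<omega> * (B v \<omega> - B u \<omega>)) \<in> borel_measurable M"
      using that by (intro borel_measurable_times[OF hkM] borel_measurable_diff B_measurable) auto
  qed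
  show ?thesis
  proof (cases "b \<le> c")
    case True
    have "(\<lambda>\<omega>. h \<omega> * k \<omega> * (B b \<omega> - B a \<omega>)) \<in> borel_measurable (F c)"
      using ab ac True by (intro borel_measurable_times[OF hkc] borel_measurable_diff B_adapted') auto
    note orth = increment_orthogonal[OF c0 cd this hkB[OF ab]]
    have "has_bochner_integral M (\<lambda>\<omega>. (h \<omega> * k \<omega> * (B b \<omega> - B a \<omega>)) * (B d \<omega> - B c \<omega>)) 0"
      using orth(1,2) by (auto simp: has_bochner_integral_iff)
    moreover have "{a<..b} \<inter> {c<..d} = {}" using True by auto
    ultimately show ?thesis by (simp only: mult_ac measure_empty mult_zero_left)
  next
    case False
    define e where "e = min b d"
    have e: "c \<le> e" "e \<le> b" "e \<le> d" "b = e \<or> d = e" "0 \<le> e" using False cd c0 by (auto simp: e_def)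
    have m1: "(\<lambda>\<omega>. h \<omega> * k \<omega> * (B c \<omega> - B a \<omega>)) \<in> borel_measurable (F c)"
      using ab ac c0 by (intro borel_measurable_times[OF hkc] borel_measurable_diff B_adapted') auto
    have m2: "(\<lambda>\<omega>. h \<omega> * k \<omega> * (B e \<omega> - B c \<omega>)) \<in> borel_measurable (F e)"
      using e c0 by (intro borel_measurable_times[OF measurable_F_mono[OF hkc]]
        borel_measurable_diff B_adapted') auto
    have t1: "has_bochner_integral M (\<lambda>\<omega>. (h \<omega> * k \<omega> * (B c \<omega> - B a \<omega>)) * (B d \<omega> - B c \<omega>)) 0"
      using increment_orthogonal(1,2)[OF c0 cd m1 hkB[OF ab(1) ac]] by (auto simp: has_bochner_integral_iff)
    have t2: "has_bochner_integral M (\<lambda>\<omega>. (h \<omega> * k \<omega>) * (B e \<omega> - B c \<omega>)\<^sup>2)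
        (expectation (\<lambda>\<omega>. h \<omega> * k \<omega>) * (e - c))"
      using increment_orthogonal(3,4)[OF c0 e(1) hkc hk] by (auto simp: has_bochner_integral_iff)
    have t3: "has_bochner_integral M (\<lambda>\<omega>. (h \<omega> * k \<omega> * (B e \<omega> - B c \<omega>)) * (B d \<omega> - B e \<omega>)) 0"
      using increment_orthogonal(1,2)[OF e(5,3) m2 hkB[OF c0 e(1)]] by (auto simp: has_bochner_integral_iff)
    have t4: "has_bochner_integral M (\<lambda>\<omega>. (h \<omega> * k \<omega> * (B e \<omega> - B c \<omega>)) * (B b \<omega> - B e \<omega>)) 0"
      using increment_orthogonal(1,2)[OF e(5,2) m2 hkB[OF c0 e(1)]] by (auto simp: has_bochner_integral_iff)
    have "{a<..b} \<inter> {c<..d} = {c<..e}" using ac by (auto simp: e_def)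
    then have "measure lborel ({a<..b} \<inter> {c<..d}) = e - c" using e by simp
    \<comment> \<open>One of the increments from \<open>e\<close> to \<open>b\<close> and from
      \<open>e\<close> to \<open>d\<close> is zero, so their product does not appear among the four
      terms.\<close>
    moreover have "(\<lambda>\<omega>. (h \<omega> * (B b \<omega> - B a \<omega>)) * (k \<omega> * (B d \<omega> - B c \<omega>))) =
      (\<lambda>\<omega>. (h \<omega> * k \<omega> * (B c \<omega> - B a \<omega>)) * (B d \<omega> - B c \<omega>) + (h \<omega> * k \<omega>) * (B e \<omega> - B c \<omega>)\<^sup>2
        + (h \<omega> * k \<omega> * (B e \<omega> - B c \<omega>)) * (B d \<omega> - B e \<omega>)
        + (h \<omega> * k \<omega> * (B e \<omega> - B c \<omega>)) * (B b \<omega> - B e \<omega>))"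
      using e(4) by (elim disjE) (simp_all add: fun_eq_iff algebra_simps power2_eq_square)
    ultimately show ?thesis
      using has_bochner_integral_add[OF has_bochner_integral_add[OF
          has_bochner_integral_add[OF t1 t2] t3] t4] by simp
  qed
qed

lemma increment_product:
  assumes ab: "0 \<le> a" "a \<le> b" and cd: "0 \<le> c" "c \<le> d"
    and h: "h \<in> borel_measurable (F a)" "\<And>\<omega>. \<omega> \<in> space M \<Longrightarrow> \<bar>h \<omega>\<bar> \<le> C"
    and k: "k \<in> borel_measurable (F c)" "\<And>\<omega>. \<omega> \<in> space M \<Longrightarrow> \<bar>k \<omega>\<bar> \<le> D"
  shows "has_bochner_integral M (\<lambda>\<omega>. (h \<omega> * (B b \<omega> - B a \<omega>)) * (k \<omega> * (B d \<omega> - B c \<omega>)))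
    (expectation (\<lambda>\<omega>. h \<omega> * k \<omega>) * measure lborel ({a<..b} \<inter> {c<..d}))"
proof (cases "a \<le> c")
  case True
  then show ?thesis using increment_product_le[OF ab cd(2) True h k] by simp
next
  case False
  then have "c \<le> a" by simp
  from increment_product_le[OF cd ab(2) this k h] show ?thesis
    by (simp add: mult.commute Int_commute)
qed

end


section \<open>The Ito isometry and the closed graph of the integral\<close>

text \<open>The squared norm, with values in \<open>ennreal\<close>, so that estimates need
  measurability but no integrability. The price is a triangle inequality with factor 2, harmless
  when only convergence to 0 matters.\<close>

definition sq_norm :: "'x measure \<Rightarrow> ('x \<Rightarrow> real) \<Rightarrow> ennreal" where
  "sq_norm P f = (\<integral>\<^sup>+x. ennreal ((f x)\<^sup>2) \<partial>P)"

lemma sq_norm_diff_commute: "sq_norm P (\<lambda>x. f x - g x) = sq_norm P (\<lambda>x. g x - f x)"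
  unfolding sq_norm_def by (simp add: power2_commute)

lemma sq_norm_add_le:
  assumes [measurable]: "f \<in> borel_measurable P" "g \<in> borel_measurable P"
  shows "sq_norm P (\<lambda>x. f x + g x) \<le> 2 * sq_norm P f + 2 * sq_norm P g"
proof -
  have "ennreal ((f x + g x)\<^sup>2) \<le> 2 * ennreal ((f x)\<^sup>2) + 2 * ennreal ((g x)\<^sup>2)" for x
  proof -
    have "(f x + g x)\<^sup>2 \<le> 2 * (f x)\<^sup>2 + 2 * (g x)\<^sup>2"
      using sum_squares_bound[of "f x" "g x"] by (simp add: power2_sum)
    then have "ennreal ((f x + g x)\<^sup>2) \<le> ennreal (2 * (f x)\<^sup>2 + 2 * (g x)\<^sup>2)"
      by (rule ennreal_leI)
    then show ?thesis by (simp add: ennreal_plus ennreal_mult')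
  qed
  then have "sq_norm P (\<lambda>x. f x + g x) \<le> (\<integral>\<^sup>+x. 2 * ennreal ((f x)\<^sup>2) + 2 * ennreal ((g x)\<^sup>2) \<partial>P)"
    unfolding sq_norm_def by (intro nn_integral_mono) auto
  also have "\<dots> = 2 * sq_norm P f + 2 * sq_norm P g"
    unfolding sq_norm_def by (simp add: nn_integral_add nn_integral_cmult)
  finally show ?thesis .
qed

lemma sq_norm_triangle:
  assumes [measurable]: "f \<in> borel_measurable P" "g \<in> borel_measurable P" "h \<in> borel_measurable P"
  shows "sq_norm P (\<lambda>x. f x - h x) \<le> 2 * sq_norm P (\<lambda>x. f x - g x) + 2 * sq_norm P (\<lambda>x. g x - h x)"
  using sq_norm_add_le[of "\<lambda>x. f x - g x" P "\<lambda>x. g x - h x"] by simp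

lemma sq_norm_triangle3:
  assumes [measurable]: "f \<in> borel_measurable P" "g \<in> borel_measurable P"
    "h \<in> borel_measurable P" "k \<in> borel_measurable P"
  shows "sq_norm P (\<lambda>x. f x - k x) \<le>
    2 * sq_norm P (\<lambda>x. f x - g x) + (4 * sq_norm P (\<lambda>x. g x - h x) + 4 * sq_norm P (\<lambda>x. h x - k x))"
proof -
  have "sq_norm P (\<lambda>x. f x - k x) \<le> 2 * sq_norm P (\<lambda>x. f x - g x) + 2 * sq_norm P (\<lambda>x. g x - k x)"
    by (rule sq_norm_triangle) auto
  also have "sq_norm P (\<lambda>x. g x - k x) \<le> 2 * sq_norm P (\<lambda>x. g x - h x) + 2 * sq_norm P (\<lambda>x. h x - k x)"
    by (rule sq_norm_triangle) auto
  finally show ?thesis by (simp add: distrib_left mult.assoc[symmetric] mult_left_mono add_left_mono)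
qed

lemma sq_norm_cmult:
  assumes [measurable]: "f \<in> borel_measurable P"
  shows "sq_norm P (\<lambda>x. c * f x) = ennreal (c\<^sup>2) * sq_norm P f"
  unfolding sq_norm_def by (simp add: power_mult_distrib ennreal_mult' nn_integral_cmult)

lemma sq_norm_cong: "(\<And>x. x \<in> space P \<Longrightarrow> f x = g x) \<Longrightarrow> sq_norm P f = sq_norm P g"
  unfolding sq_norm_def by (intro nn_integral_cong) auto

lemma sq_norm_eq_0D:
  assumes "f \<in> borel_measurable P" "sq_norm P f = 0"
  shows "AE x in P. f x = 0"
  using assms unfolding sq_norm_def by (simp add: nn_integral_0_iff_AE)

lemma ennreal_tendsto_0_le:
  fixes f g :: "nat \<Rightarrow> ennreal"
  assumes "\<And>k. f k \<le> g k" "g \<longlonglongrightarrow> 0"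
  shows "f \<longlonglongrightarrow> 0"
  by (rule tendsto_sandwich[OF _ _ tendsto_const assms(2)]) (use assms(1) in auto)

section \<open>Elementary processes and the isometry\<close>

context brownian_setup
begin

sublocale time_product: pair_sigma_finite M "lborel :: real measure" ..

abbreviation "MT \<equiv> M \<Otimes>\<^sub>M (lborel :: real measure)"

text \<open>Integrand on the product space and integral are carried as a pair, so the integral never
  has to be shown independent of a representation. The intervals may overlap, unlike the partitions
  in \<open>simple_integrand\<close>; this makes the pairs closed under addition.\<close>

inductive elementary :: "('w \<times> real \<Rightarrow> real) \<Rightarrow> ('w \<Rightarrow> real) \<Rightarrow> bool" where
  elementary_zero: "elementary (\<lambda>_. 0) (\<lambda>_. 0)"
| elementary_step: "elementary S I \<Longrightarrow> 0 \<le> a \<Longrightarrow> a \<le> b \<Longrightarrow> h \<in> borel_measurable (F a) \<Longrightarrow>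
    (\<And>\<omega>. \<omega> \<in> space M \<Longrightarrow> \<bar>h \<omega>\<bar> \<le> C) \<Longrightarrow>
    elementary (\<lambda>x. S x + h (fst x) * indicator {a<..b} (snd x)) (\<lambda>\<omega>. I \<omega> + h \<omega> * (B b \<omega> - B a \<omega>))"

lemma elementary_measurable:
  assumes "elementary S I"
  shows "S \<in> borel_measurable MT" "I \<in> borel_measurable M"
proof -
  have "S \<in> borel_measurable MT \<and> I \<in> borel_measurable M"
    using assms
  proof induction
    case (elementary_step S I a b h C)
    note [measurable] = measurable_F_M[OF elementary_step(4,2)] B_measurable[OF elementary_step(2)]
      B_measurable[OF order_trans[OF elementary_step(2,3)]]
    show ?case using elementary_step.IH by auto
  qed auto
  then show "S \<in> borel_measurable MT" "I \<in> borel_measurable M" by auto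
qed

lemma elementary_add:
  assumes "elementary S I" "elementary S' I'"
  shows "elementary (\<lambda>x. S x + S' x) (\<lambda>\<omega>. I \<omega> + I' \<omega>)"
  using assms(2)
proof induction
  case (elementary_step S' I' a b h C)
  from elementary.elementary_step[OF elementary_step.IH elementary_step.hyps(2-5)]
  show ?case by (simp add: add.assoc)
qed (use assms in simp)

lemma elementary_cmult:
  assumes "elementary S I"
  shows "elementary (\<lambda>x. c * S x) (\<lambda>\<omega>. c * I \<omega>)"
  using assms
proof induction
  case (elementary_step S I a b h C)
  have "(\<lambda>\<omega>. c * h \<omega>) \<in> borel_measurable (F a)" using elementary_step by simp
  moreover have "\<bar>c * h \<omega>\<bar> \<le> \<bar>c\<bar> * C" if "\<omega> \<in> space M" for \<omega>
    using elementary_step(5)[OF that] by (simp add: abs_mult mult_left_mono)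
  ultimately show ?case
    using elementary.elementary_step[OF elementary_step.IH elementary_step.hyps(2,3),
        of "\<lambda>\<omega>. c * h \<omega>" "\<bar>c\<bar> * C"]
    by (simp add: algebra_simps)
qed (simp add: elementary_zero)

lemma elementary_diff:
  assumes "elementary S I" "elementary S' I'"
  shows "elementary (\<lambda>x. S x - S' x) (\<lambda>\<omega>. I \<omega> - I' \<omega>)"
  using elementary_add[OF assms(1) elementary_cmult[OF assms(2), of "-1"]] by simp

lemma has_bochner_integral_product_indicator:
  fixes h :: "'w \<Rightarrow> real"
  assumes h: "h \<in> borel_measurable M" and bnd: "\<And>\<omega>. \<omega> \<in> space M \<Longrightarrow> \<bar>h \<omega>\<bar> \<le> C"
    and A: "A \<in> sets borel" "emeasure lborel A < \<infinity>"
  shows "has_bochner_integral MT (\<lambda>x. h (fst x) * indicator A (snd x)) (expectation h * measure lborel A)"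
proof -
  note [measurable] = h A(1)
  have hi: "integrable M h" by (rule integrable_const_bound[of _ C]) (use bnd in auto)
  have Ai: "integrable lborel (indicator A :: real \<Rightarrow> real)" using A by simp
  have *: "integrable MT (\<lambda>x. h (fst x) * indicator A (snd x))"
  proof (rule time_product.Fubini_integrable)
    show "integrable M (\<lambda>x. LBINT y. norm (h (fst (x, y)) * indicator A (snd (x, y))))"
      using integrable_mult_left[OF integrable_abs[OF hi], of "measure lborel A"] Ai
      by (simp add: abs_mult)
    show "AE x in M. integrable lborel (\<lambda>y. h (fst (x, y)) * indicator A (snd (x, y)))"
      using Ai by simp
  qed simp
  have "integral\<^sup>L MT (\<lambda>x. h (fst x) * indicator A (snd x)) = expectation h * measure lborel A"
    using time_product.integral_fst'[OF *, symmetric] by simp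
  with * show ?thesis by (simp add: has_bochner_integral_iff)
qed

text \<open>Both inner products are reduced to pairs of single steps by a double induction. The
  common value \<open>c\<close> expresses their equality, and \<open>has_bochner_integral\<close>
  carries integrability through the sums.\<close>

lemma elementary_bilinear:
  assumes "elementary S I" "elementary S' I'"
  shows "\<exists>c. has_bochner_integral M (\<lambda>\<omega>. I \<omega> * I' \<omega>) c \<and>
    has_bochner_integral MT (\<lambda>x. S x * S' x) c"
  using assms
proof induction
  case (elementary_step S I a b h C)
  \<comment> \<open>Inner induction: one fixed step against all of the second process, where
    \<open>increment_product\<close> gives the probabilistic side and Fubini the other.\<close>
  have "\<exists>c. has_bochner_integral M (\<lambda>\<omega>. (h \<omega> * (B b \<omega> - B a \<omega>)) * I' \<omega>) c \<and>
    has_bochner_integral MT (\<lambda>x. (h (fst x) * indicator {a<..b} (snd x)) * S' x) c"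
    using elementary_step(7)
  proof induction
    case (elementary_step S' I' a' b' h' C')
    then obtain c where c: "has_bochner_integral M (\<lambda>\<omega>. h \<omega> * (B b \<omega> - B a \<omega>) * I' \<omega>) c"
      "has_bochner_integral MT (\<lambda>x. h (fst x) * indicator {a<..b} (snd x) * S' x) c" by blast
    let ?d = "expectation (\<lambda>\<omega>. h \<omega> * h' \<omega>) * measure lborel ({a<..b} \<inter> {a'<..b'})"
    have 1: "has_bochner_integral M
      (\<lambda>\<omega>. (h \<omega> * (B b \<omega> - B a \<omega>)) * (h' \<omega> * (B b' \<omega> - B a' \<omega>))) ?d"
      by (rule increment_product) fact+
    have "\<bar>h \<omega> * h' \<omega>\<bar> \<le> C * C'" if "\<omega> \<in> space M" for \<omega>
      using \<open>\<And>\<omega>. \<omega> \<in> space M \<Longrightarrow> \<bar>h \<omega>\<bar> \<le> C\<close>[OF that]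
        \<open>\<And>\<omega>. \<omega> \<in> space M \<Longrightarrow> \<bar>h' \<omega>\<bar> \<le> C'\<close>[OF that] by (auto simp: abs_mult intro!: mult_mono)
    moreover have "(\<lambda>\<omega>. h \<omega> * h' \<omega>) \<in> borel_measurable M"
      using measurable_F_M[OF \<open>h \<in> borel_measurable (F a)\<close> \<open>0 \<le> a\<close>]
        measurable_F_M[OF \<open>h' \<in> borel_measurable (F a')\<close> \<open>0 \<le> a'\<close>] by simp
    moreover have "emeasure lborel ({a<..b} \<inter> {a'<..b'}) < \<infinity>"
      by (rule le_less_trans[OF emeasure_mono[of _ "{a<..b}"]]) (use \<open>a \<le> b\<close> in auto)
    ultimately have 2: "has_bochner_integral MT
      (\<lambda>x. (h (fst x) * h' (fst x)) * indicator ({a<..b} \<inter> {a'<..b'}) (snd x)) ?d"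
      by (intro has_bochner_integral_product_indicator) auto
    have e1: "(\<lambda>\<omega>. h \<omega> * (B b \<omega> - B a \<omega>) * (I' \<omega> + h' \<omega> * (B b' \<omega> - B a' \<omega>))) =
      (\<lambda>\<omega>. h \<omega> * (B b \<omega> - B a \<omega>) * I' \<omega> + (h \<omega> * (B b \<omega> - B a \<omega>)) * (h' \<omega> * (B b' \<omega> - B a' \<omega>)))"
      by (simp add: distrib_left)
    have e2: "(\<lambda>x. h (fst x) * indicator {a<..b} (snd x) * (S' x + h' (fst x) * indicator {a'<..b'} (snd x)))
      = (\<lambda>x. h (fst x) * indicator {a<..b} (snd x) * S' x +
        (h (fst x) * h' (fst x)) * indicator ({a<..b} \<inter> {a'<..b'}) (snd x))"
      by (simp only: distrib_left indicator_inter_arith mult_ac)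
    show ?case
      unfolding e1 e2
      using has_bochner_integral_add[OF c(1) 1] has_bochner_integral_add[OF c(2) 2] by blast
  qed auto
  then obtain d where d: "has_bochner_integral M (\<lambda>\<omega>. (h \<omega> * (B b \<omega> - B a \<omega>)) * I' \<omega>) d"
    "has_bochner_integral MT (\<lambda>x. (h (fst x) * indicator {a<..b} (snd x)) * S' x) d" by blast
  from elementary_step.IH elementary_step.prems
  obtain c where c: "has_bochner_integral M (\<lambda>\<omega>. I \<omega> * I' \<omega>) c"
    "has_bochner_integral MT (\<lambda>x. S x * S' x) c" by blast
  show ?case
    unfolding distrib_right
    using has_bochner_integral_add[OF c(1) d(1)] has_bochner_integral_add[OF c(2) d(2)] by blast
qed auto

lemma elementary_isometry:
  assumes "elementary S I"
  shows "sq_norm M I = sq_norm MT S"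
proof -
  obtain c where c: "has_bochner_integral M (\<lambda>\<omega>. I \<omega> * I \<omega>) c"
    "has_bochner_integral MT (\<lambda>x. S x * S x) c"
    using elementary_bilinear[OF assms assms] by blast
  show ?thesis
    using nn_integral_eq_integral[of M "\<lambda>\<omega>. I \<omega> * I \<omega>"] nn_integral_eq_integral[of MT "\<lambda>x. S x * S x"] c
    by (simp add: sq_norm_def power2_eq_square has_bochner_integral_iff)
qed

section \<open>Deterministic integrands and the graph of the Wiener integral\<close>

lemma sq_norm_time:
  assumes [measurable]: "\<phi> \<in> borel_measurable borel"
  shows "sq_norm MT (\<lambda>x. \<phi> (snd x)) = sq_norm lborel \<phi>"
  unfolding sq_norm_def
  by (subst lborel.nn_integral_fst[symmetric]) (simp_all add: emeasure_space_1)

text \<open>The pairs \<open>(\<phi>, Y)\<close> form a closed linear graph, on which the Ito isometry holds. The time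
  horizon is encoded in \<open>\<phi>\<close>, by cutting it off with an indicator.\<close>

definition wiener_integral :: "(real \<Rightarrow> real) \<Rightarrow> ('w \<Rightarrow> real) \<Rightarrow> bool" where
  "wiener_integral \<phi> Y \<longleftrightarrow> \<phi> \<in> borel_measurable borel \<and> Y \<in> borel_measurable M \<and>
     (\<exists>S I. (\<forall>k. elementary (S k) (I k)) \<and>
        (\<lambda>k::nat. sq_norm MT (\<lambda>x. S k x - \<phi> (snd x))) \<longlonglongrightarrow> 0 \<and>
        (\<lambda>k. sq_norm M (\<lambda>\<omega>. I k \<omega> - Y \<omega>)) \<longlonglongrightarrow> 0)"

lemma wiener_integral_measurable:
  assumes "wiener_integral \<phi> Y"
  shows "\<phi> \<in> borel_measurable borel" "Y \<in> borel_measurable M"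
  using assms by (simp_all add: wiener_integral_def)

lemma wiener_integralE:
  assumes "wiener_integral \<phi> Y"
  obtains S I where "\<And>k. elementary (S k) (I k)"
    "(\<lambda>k::nat. sq_norm MT (\<lambda>x. S k x - \<phi> (snd x))) \<longlonglongrightarrow> 0"
    "(\<lambda>k. sq_norm M (\<lambda>\<omega>. I k \<omega> - Y \<omega>)) \<longlonglongrightarrow> 0"
  using assms unfolding wiener_integral_def by (elim conjE exE) (rule that, auto)

text \<open>The isometry up to a constant, by passing to elementary approximations. The factor 16 is
  4 times 4, the middle coefficient of \<open>sq_norm_triangle3\<close> used once over
  \<open>M\<close> and once over \<open>MT\<close>.\<close>

lemma wiener_integral_bound:
  assumes Y: "wiener_integral \<phi> Y" and Z: "wiener_integral \<psi> Z"
  shows "sq_norm M (\<lambda>\<omega>. Y \<omega> - Z \<omega>) \<le> 16 * sq_norm lborel (\<lambda>s. \<phi> s - \<psi> s)"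
proof -
  note [measurable] = wiener_integral_measurable[OF Y] wiener_integral_measurable[OF Z]
  obtain S I where S: "\<And>k. elementary (S k) (I k)"
    and Sl: "(\<lambda>k. sq_norm MT (\<lambda>x. S k x - \<phi> (snd x))) \<longlonglongrightarrow> 0"
    and Il: "(\<lambda>k. sq_norm M (\<lambda>\<omega>. I k \<omega> - Y \<omega>)) \<longlonglongrightarrow> 0"
    by (rule wiener_integralE[OF Y]) (rule that)
  obtain S' I' where S': "\<And>k. elementary (S' k) (I' k)"
    and Sl': "(\<lambda>k. sq_norm MT (\<lambda>x. S' k x - \<psi> (snd x))) \<longlonglongrightarrow> 0"
    and Il': "(\<lambda>k. sq_norm M (\<lambda>\<omega>. I' k \<omega> - Z \<omega>)) \<longlonglongrightarrow> 0"
    by (rule wiener_integralE[OF Z]) (rule that)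
  note [measurable] = elementary_measurable[OF S] elementary_measurable[OF S']
  let ?d = "sq_norm lborel (\<lambda>s. \<phi> s - \<psi> s)"
  let ?a = "\<lambda>k. sq_norm M (\<lambda>\<omega>. I k \<omega> - Y \<omega>)" and ?a' = "\<lambda>k. sq_norm M (\<lambda>\<omega>. I' k \<omega> - Z \<omega>)"
  let ?s = "\<lambda>k. sq_norm MT (\<lambda>x. S k x - \<phi> (snd x))" and ?s' = "\<lambda>k. sq_norm MT (\<lambda>x. S' k x - \<psi> (snd x))"
  have "sq_norm M (\<lambda>\<omega>. Y \<omega> - Z \<omega>) \<le>
    2 * ?a k + (4 * (2 * ?s k + (4 * ?d + 4 * ?s' k)) + 4 * ?a' k)" for k
  proof -
    have "sq_norm M (\<lambda>\<omega>. Y \<omega> - Z \<omega>) \<le> 2 * sq_norm M (\<lambda>\<omega>. Y \<omega> - I k \<omega>) +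
      (4 * sq_norm M (\<lambda>\<omega>. I k \<omega> - I' k \<omega>) + 4 * ?a' k)"
      by (rule sq_norm_triangle3) auto
    also have "sq_norm M (\<lambda>\<omega>. I k \<omega> - I' k \<omega>) = sq_norm MT (\<lambda>x. S k x - S' k x)"
      by (rule elementary_isometry[OF elementary_diff[OF S S']])
    also have "\<dots> \<le> 2 * ?s k + (4 * sq_norm MT (\<lambda>x. \<phi> (snd x) - \<psi> (snd x))
        + 4 * sq_norm MT (\<lambda>x. \<psi> (snd x) - S' k x))"
      by (rule sq_norm_triangle3) auto
    also have "sq_norm MT (\<lambda>x. \<phi> (snd x) - \<psi> (snd x)) = ?d"
      by (rule sq_norm_time[of "\<lambda>s. \<phi> s - \<psi> s"]) simp
    also have "sq_norm MT (\<lambda>x. \<psi> (snd x) - S' k x) = ?s' k" by (rule sq_norm_diff_commute)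
    also have "sq_norm M (\<lambda>\<omega>. Y \<omega> - I k \<omega>) = ?a k" by (rule sq_norm_diff_commute)
    finally show ?thesis by (simp add: mult_left_mono add_mono)
  qed
  moreover have "(\<lambda>k. 2 * ?a k + (4 * (2 * ?s k + (4 * ?d + 4 * ?s' k)) + 4 * ?a' k)) \<longlonglongrightarrow>
    2 * 0 + (4 * (2 * 0 + (4 * ?d + 4 * 0)) + 4 * 0)"
    by (intro tendsto_add ennreal_tendsto_cmult tendsto_const Il Il' Sl Sl') auto
  ultimately have "sq_norm M (\<lambda>\<omega>. Y \<omega> - Z \<omega>) \<le> 2 * 0 + (4 * (2 * 0 + (4 * ?d + 4 * 0)) + 4 * 0)"
    by (intro LIMSEQ_le_const) auto
  then show ?thesis by (simp add: mult.assoc[symmetric])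
qed

lemma wiener_integral_unique:
  assumes "wiener_integral \<phi> Y" "wiener_integral \<phi> Z"
  shows "AE \<omega> in M. Y \<omega> = Z \<omega>"
proof -
  have "sq_norm M (\<lambda>\<omega>. Y \<omega> - Z \<omega>) = 0"
    using wiener_integral_bound[OF assms] by (simp add: sq_norm_def)
  from sq_norm_eq_0D[OF _ this] show ?thesis
    using wiener_integral_measurable[OF assms(1)] wiener_integral_measurable[OF assms(2)] by simp
qed

lemma wiener_integral_elementary:
  assumes "elementary S I" "\<phi> \<in> borel_measurable borel"
    and "\<And>\<omega> s. \<omega> \<in> space M \<Longrightarrow> S (\<omega>, s) = \<phi> s"
  shows "wiener_integral \<phi> I"
  unfolding wiener_integral_def
proof (intro conjI exI[of _ "\<lambda>_. S"] exI[of _ "\<lambda>_. I"] allI assms)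
  have "sq_norm MT (\<lambda>x. S x - \<phi> (snd x)) = sq_norm MT (\<lambda>x. 0)"
    by (rule sq_norm_cong) (auto simp: space_pair_measure assms(3))
  then show "(\<lambda>k. sq_norm MT (\<lambda>x. S x - \<phi> (snd x))) \<longlonglongrightarrow> 0" by (simp add: sq_norm_def)
  show "(\<lambda>k. sq_norm M (\<lambda>\<omega>. I \<omega> - I \<omega>)) \<longlonglongrightarrow> 0" by (simp add: sq_norm_def)
qed (use elementary_measurable[OF assms(1)] in simp)

lemma wiener_integral_zero: "wiener_integral (\<lambda>_. 0) (\<lambda>_. 0)"
  by (rule wiener_integral_elementary[OF elementary_zero]) auto

lemma wiener_integral_add:
  assumes Y: "wiener_integral \<phi> Y" and Z: "wiener_integral \<psi> Z"
  shows "wiener_integral (\<lambda>s. \<phi> s + \<psi> s) (\<lambda>\<omega>. Y \<omega> + Z \<omega>)"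
proof -
  note [measurable] = wiener_integral_measurable[OF Y] wiener_integral_measurable[OF Z]
  obtain S I where S: "\<And>k. elementary (S k) (I k)"
    and Sl: "(\<lambda>k. sq_norm MT (\<lambda>x. S k x - \<phi> (snd x))) \<longlonglongrightarrow> 0"
    and Il: "(\<lambda>k. sq_norm M (\<lambda>\<omega>. I k \<omega> - Y \<omega>)) \<longlonglongrightarrow> 0"
    by (rule wiener_integralE[OF Y]) (rule that)
  obtain S' I' where S': "\<And>k. elementary (S' k) (I' k)"
    and Sl': "(\<lambda>k. sq_norm MT (\<lambda>x. S' k x - \<psi> (snd x))) \<longlonglongrightarrow> 0"
    and Il': "(\<lambda>k. sq_norm M (\<lambda>\<omega>. I' k \<omega> - Z \<omega>)) \<longlonglongrightarrow> 0"
    by (rule wiener_integralE[OF Z]) (rule that)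
  note [measurable] = elementary_measurable[OF S] elementary_measurable[OF S']
  have lim: "(\<lambda>k. 2 * f k + 2 * g k) \<longlonglongrightarrow> 0" if "f \<longlonglongrightarrow> 0" "g \<longlonglongrightarrow> 0" for f g :: "nat \<Rightarrow> ennreal"
    using tendsto_add[OF ennreal_tendsto_cmult[OF _ that(1), of 2] ennreal_tendsto_cmult[OF _ that(2), of 2]]
    by simp
  show ?thesis
    unfolding wiener_integral_def
  proof (intro conjI exI[of _ "\<lambda>k x. S k x + S' k x"] exI[of _ "\<lambda>k \<omega>. I k \<omega> + I' k \<omega>"] allI
      elementary_add S S')
    show "(\<lambda>k. sq_norm MT (\<lambda>x. S k x + S' k x - (\<phi> (snd x) + \<psi> (snd x)))) \<longlonglongrightarrow> 0"
    proof (rule ennreal_tendsto_0_le[OF _ lim[OF Sl Sl']])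
      show "sq_norm MT (\<lambda>x. S k x + S' k x - (\<phi> (snd x) + \<psi> (snd x))) \<le>
        2 * sq_norm MT (\<lambda>x. S k x - \<phi> (snd x)) + 2 * sq_norm MT (\<lambda>x. S' k x - \<psi> (snd x))" for k
        using sq_norm_add_le[of "\<lambda>x. S k x - \<phi> (snd x)" MT "\<lambda>x. S' k x - \<psi> (snd x)"]
        by (simp add: algebra_simps)
    qed
    show "(\<lambda>k. sq_norm M (\<lambda>\<omega>. I k \<omega> + I' k \<omega> - (Y \<omega> + Z \<omega>))) \<longlonglongrightarrow> 0"
    proof (rule ennreal_tendsto_0_le[OF _ lim[OF Il Il']])
      show "sq_norm M (\<lambda>\<omega>. I k \<omega> + I' k \<omega> - (Y \<omega> + Z \<omega>)) \<le>
        2 * sq_norm M (\<lambda>\<omega>. I k \<omega> - Y \<omega>) + 2 * sq_norm M (\<lambda>\<omega>. I' k \<omega> - Z \<omega>)" for k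
        using sq_norm_add_le[of "\<lambda>\<omega>. I k \<omega> - Y \<omega>" M "\<lambda>\<omega>. I' k \<omega> - Z \<omega>"]
        by (simp add: algebra_simps)
    qed
  qed auto
qed

lemma wiener_integral_cmult:
  assumes Y: "wiener_integral \<phi> Y"
  shows "wiener_integral (\<lambda>s. c * \<phi> s) (\<lambda>\<omega>. c * Y \<omega>)"
proof -
  note [measurable] = wiener_integral_measurable[OF Y]
  obtain S I where S: "\<And>k. elementary (S k) (I k)"
    and Sl: "(\<lambda>k. sq_norm MT (\<lambda>x. S k x - \<phi> (snd x))) \<longlonglongrightarrow> 0"
    and Il: "(\<lambda>k. sq_norm M (\<lambda>\<omega>. I k \<omega> - Y \<omega>)) \<longlonglongrightarrow> 0"
    by (rule wiener_integralE[OF Y]) (rule that)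
  note [measurable] = elementary_measurable[OF S]
  have "(\<lambda>k. sq_norm MT (\<lambda>x. c * S k x - c * \<phi> (snd x))) \<longlonglongrightarrow> ennreal (c\<^sup>2) * 0"
    unfolding right_diff_distrib[symmetric] by (subst sq_norm_cmult) (measurable, intro ennreal_tendsto_cmult Sl, simp)
  moreover have "(\<lambda>k. sq_norm M (\<lambda>\<omega>. c * I k \<omega> - c * Y \<omega>)) \<longlonglongrightarrow> ennreal (c\<^sup>2) * 0"
    unfolding right_diff_distrib[symmetric] by (subst sq_norm_cmult) (measurable, intro ennreal_tendsto_cmult Il, simp)
  ultimately show ?thesis
    unfolding wiener_integral_def
    by (intro conjI exI[of _ "\<lambda>k x. c * S k x"] exI[of _ "\<lambda>k \<omega>. c * I k \<omega>"])
      (auto intro: elementary_cmult[OF S])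
qed

lemma wiener_integral_diff:
  assumes "wiener_integral \<phi> Y" "wiener_integral \<psi> Z"
  shows "wiener_integral (\<lambda>s. \<phi> s - \<psi> s) (\<lambda>\<omega>. Y \<omega> - Z \<omega>)"
  using wiener_integral_add[OF assms(1) wiener_integral_cmult[OF assms(2), of "-1"]] by simp

lemma wiener_integral_sum:
  assumes "\<And>i. i \<in> A \<Longrightarrow> wiener_integral (\<phi> i) (Y i)"
  shows "wiener_integral (\<lambda>s. \<Sum>i\<in>A. \<phi> i s) (\<lambda>\<omega>. \<Sum>i\<in>A. Y i \<omega>)"
  using assms
  by (induction A rule: infinite_finite_induct)
    (auto intro: wiener_integral_add wiener_integral_zero)

text \<open>Fatou's lemma and the isometry upgrade almost sure convergence to convergence in
  \<open>L\<^sup>2\<close>.\<close>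

lemma wiener_integral_closed:
  assumes Y: "\<And>k. wiener_integral (\<phi> k) (Y k)"
    and \<phi>[measurable]: "\<psi> \<in> borel_measurable borel"
    and lim: "(\<lambda>k. sq_norm lborel (\<lambda>s. \<phi> k s - \<psi> s)) \<longlonglongrightarrow> 0"
    and Z[measurable]: "Z \<in> borel_measurable M"
    and ae: "AE \<omega> in M. (\<lambda>k. Y k \<omega>) \<longlonglongrightarrow> Z \<omega>"
  shows "wiener_integral \<psi> Z"
proof -
  note [measurable] = wiener_integral_measurable[OF Y]
  let ?d = "\<lambda>k. sq_norm lborel (\<lambda>s. \<phi> k s - \<psi> s)"
  \<comment> \<open>Fatou in the second index \<open>l\<close> with \<open>k\<close> fixed. The
    constant is 32 = 16 * 2: the bound for \<open>Y k - Y l\<close>, then the triangle inequality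
    through \<psi>.\<close>
  have YZ: "sq_norm M (\<lambda>\<omega>. Y k \<omega> - Z \<omega>) \<le> 32 * ?d k" for k
  proof -
    have "sq_norm M (\<lambda>\<omega>. Y k \<omega> - Z \<omega>) = (\<integral>\<^sup>+\<omega>. liminf (\<lambda>l. ennreal ((Y k \<omega> - Y l \<omega>)\<^sup>2)) \<partial>M)"
      unfolding sq_norm_def
    proof (rule nn_integral_cong_AE)
      show "AE \<omega> in M. ennreal ((Y k \<omega> - Z \<omega>)\<^sup>2) = liminf (\<lambda>l. ennreal ((Y k \<omega> - Y l \<omega>)\<^sup>2))"
        using ae
      proof eventually_elim
        case (elim \<omega>)
        then have "(\<lambda>l. ennreal ((Y k \<omega> - Y l \<omega>)\<^sup>2)) \<longlonglongrightarrow> ennreal ((Y k \<omega> - Z \<omega>)\<^sup>2)"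
          by (intro tendsto_intros)
        from lim_imp_Liminf[OF _ this] show ?case by simp
      qed
    qed
    also have "\<dots> \<le> liminf (\<lambda>l. sq_norm M (\<lambda>\<omega>. Y k \<omega> - Y l \<omega>))"
      unfolding sq_norm_def by (rule nn_integral_liminf) simp
    also have "\<dots> \<le> liminf (\<lambda>l. 32 * ?d k + 32 * ?d l)"
    proof (rule Liminf_mono, rule always_eventually, rule allI)
      fix l
      have "sq_norm M (\<lambda>\<omega>. Y k \<omega> - Y l \<omega>) \<le> 16 * sq_norm lborel (\<lambda>s. \<phi> k s - \<phi> l s)"
        by (rule wiener_integral_bound[OF Y Y])
      also have "sq_norm lborel (\<lambda>s. \<phi> k s - \<phi> l s) \<le> 2 * ?d k + 2 * sq_norm lborel (\<lambda>s. \<psi> s - \<phi> l s)"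
        by (rule sq_norm_triangle) auto
      also have "sq_norm lborel (\<lambda>s. \<psi> s - \<phi> l s) = ?d l" by (rule sq_norm_diff_commute)
      finally show "sq_norm M (\<lambda>\<omega>. Y k \<omega> - Y l \<omega>) \<le> 32 * ?d k + 32 * ?d l"
        by (simp add: distrib_left mult.assoc[symmetric] mult_left_mono)
    qed
    also have "\<dots> = 32 * ?d k + 32 * 0"
      by (intro lim_imp_Liminf tendsto_add ennreal_tendsto_cmult lim tendsto_const) auto
    finally show ?thesis by simp
  qed
  \<comment> \<open>Diagonal choice: for each \<open>k\<close> one elementary pair within 1/(k+1) of
    both the integrand and the integral.\<close>
  have ex: "\<exists>S I. elementary S I \<and> sq_norm MT (\<lambda>x. S x - \<phi> k (snd x)) < ennreal (1 / real (Suc k)) \<and>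
    sq_norm M (\<lambda>\<omega>. I \<omega> - Y k \<omega>) < ennreal (1 / real (Suc k))" for k
  proof -
    obtain S I where S: "\<And>j. elementary (S j) (I j)"
      and Sl: "(\<lambda>j. sq_norm MT (\<lambda>x. S j x - \<phi> k (snd x))) \<longlonglongrightarrow> 0"
      and Il: "(\<lambda>j. sq_norm M (\<lambda>\<omega>. I j \<omega> - Y k \<omega>)) \<longlonglongrightarrow> 0"
      by (rule wiener_integralE[OF Y[of k]]) (rule that)
    have pos: "0 < ennreal (1 / real (Suc k))" by simp
    from eventually_conj[OF order_tendstoD(2)[OF Sl pos] order_tendstoD(2)[OF Il pos]]
    show ?thesis using S by (auto simp: eventually_sequentially)
  qed
  then obtain S I where S: "\<And>k. elementary (S k) (I k)"
    and Sk: "\<And>k. sq_norm MT (\<lambda>x. S k x - \<phi> k (snd x)) < ennreal (1 / real (Suc k))"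
    and Ik: "\<And>k. sq_norm M (\<lambda>\<omega>. I k \<omega> - Y k \<omega>) < ennreal (1 / real (Suc k))" by metis
  note [measurable] = elementary_measurable[OF S]
  have inv: "(\<lambda>k. ennreal (1 / real (Suc k))) \<longlonglongrightarrow> 0"
    using tendsto_ennrealI[OF LIMSEQ_Suc[OF lim_1_over_n]] by simp
  have lim2: "(\<lambda>k. 2 * f k + 2 * g k) \<longlonglongrightarrow> 0" if "f \<longlonglongrightarrow> 0" "g \<longlonglongrightarrow> 0" for f g :: "nat \<Rightarrow> ennreal"
    using tendsto_add[OF ennreal_tendsto_cmult[OF _ that(1), of 2] ennreal_tendsto_cmult[OF _ that(2), of 2]]
    by simp
  have lim32: "(\<lambda>k. 32 * ?d k) \<longlonglongrightarrow> 0" using ennreal_tendsto_cmult[OF _ lim, of 32] by simp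
  show ?thesis
    unfolding wiener_integral_def
  proof (intro conjI exI[of _ S] exI[of _ I] allI S)
    show "(\<lambda>k. sq_norm MT (\<lambda>x. S k x - \<psi> (snd x))) \<longlonglongrightarrow> 0"
    proof (rule ennreal_tendsto_0_le[OF _ lim2[OF inv lim]])
      fix k
      have "sq_norm MT (\<lambda>x. S k x - \<psi> (snd x)) \<le>
        2 * sq_norm MT (\<lambda>x. S k x - \<phi> k (snd x)) + 2 * sq_norm MT (\<lambda>x. \<phi> k (snd x) - \<psi> (snd x))"
        by (rule sq_norm_triangle) auto
      also have "sq_norm MT (\<lambda>x. \<phi> k (snd x) - \<psi> (snd x)) = ?d k"
        by (rule sq_norm_time[of "\<lambda>s. \<phi> k s - \<psi> s"]) simp
      finally show "sq_norm MT (\<lambda>x. S k x - \<psi> (snd x)) \<le> 2 * (ennreal (1 / real (Suc k))) + 2 * ?d k"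
        by (rule order_trans) (intro add_mono mult_left_mono less_imp_le[OF Sk] order_refl, simp)
    qed
    show "(\<lambda>k. sq_norm M (\<lambda>\<omega>. I k \<omega> - Z \<omega>)) \<longlonglongrightarrow> 0"
    proof (rule ennreal_tendsto_0_le[OF _ lim2[OF inv lim32]])
      fix k
      have "sq_norm M (\<lambda>\<omega>. I k \<omega> - Z \<omega>) \<le>
        2 * sq_norm M (\<lambda>\<omega>. I k \<omega> - Y k \<omega>) + 2 * sq_norm M (\<lambda>\<omega>. Y k \<omega> - Z \<omega>)"
        by (rule sq_norm_triangle) auto
      then show "sq_norm M (\<lambda>\<omega>. I k \<omega> - Z \<omega>) \<le> 2 * (ennreal (1 / real (Suc k))) + 2 * (32 * ?d k)"
        by (rule order_trans) (intro add_mono mult_left_mono less_imp_le[OF Ik] YZ, auto)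
    qed
  qed auto
qed

end


section \<open>Step functions on a uniform grid\<close>

text \<open>Level \<open>k\<close> has k+1 cells, so the denominator never vanishes and level 0 is
  the single cell from 0 to \<open>t\<close>.\<close>

definition grid :: "real \<Rightarrow> nat \<Rightarrow> nat \<Rightarrow> real" where
  "grid t k i = t * real i / real (Suc k)"

lemma grid_0 [simp]: "grid t k 0 = 0"
  by (simp add: grid_def)

lemma grid_last [simp]: "grid t k (Suc k) = t"
  by (simp add: grid_def)

lemma grid_mono: "0 \<le> t \<Longrightarrow> i \<le> j \<Longrightarrow> grid t k i \<le> grid t k j"
  by (simp add: grid_def divide_right_mono mult_left_mono)

lemma grid_nonneg: "0 \<le> t \<Longrightarrow> 0 \<le> grid t k i"
  by (simp add: grid_def)

lemma grid_le: "0 \<le> t \<Longrightarrow> i \<le> Suc k \<Longrightarrow> grid t k i \<le> t"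
  using grid_mono[of t i "Suc k" k] by simp

lemma grid_step: "grid t k (Suc i) - grid t k i = t / real (Suc k)"
  by (simp add: grid_def diff_divide_distrib[symmetric] algebra_simps)

lemma grid_cover:
  assumes "0 < s" "s \<le> t"
  obtains j where "j < Suc k" "s \<in> {grid t k j<..grid t k (Suc j)}"
proof -
  define j where "j = (LEAST j. s \<le> grid t k (Suc j))"
  have ex: "s \<le> grid t k (Suc k)" using assms by simp
  have j: "s \<le> grid t k (Suc j)" unfolding j_def by (rule LeastI[of _ k]) (rule ex)
  have jk: "j \<le> k" unfolding j_def by (rule Least_le) (rule ex)
  have "grid t k j < s"
  proof (cases j)
    case 0
    then show ?thesis using assms by simp
  next
    case (Suc i)
    then have "i < j" by simp
    then have "\<not> s \<le> grid t k (Suc i)" unfolding j_def by (rule not_less_Least)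
    then show ?thesis using Suc by simp
  qed
  with j jk show ?thesis by (intro that[of j]) auto
qed

text \<open>Uniform continuity together with mesh \<open>t / Suc k\<close>. It serves twice: for
  step approximations of integrands and for Stieltjes sums along a path.\<close>

lemma grid_oscillation:
  fixes f :: "real \<Rightarrow> real"
  assumes t: "0 \<le> t" and cont: "continuous_on {0..t} f" and e: "0 < e"
  shows "\<forall>\<^sub>F k in sequentially. \<forall>i<Suc k. \<forall>x\<in>{grid t k i..grid t k (Suc i)}.
    \<forall>y\<in>{grid t k i..grid t k (Suc i)}. \<bar>f x - f y\<bar> \<le> e"
proof -
  have "uniformly_continuous_on {0..t} f"
    by (rule compact_uniformly_continuous[OF cont]) simp
  then obtain d where d: "0 < d" "\<And>x y. x \<in> {0..t} \<Longrightarrow> y \<in> {0..t} \<Longrightarrow> dist y x < d \<Longrightarrow> dist (f y) (f x) < e"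
    using e unfolding uniformly_continuous_on_def by metis
  have "(\<lambda>k. t * (1 / real (Suc k))) \<longlonglongrightarrow> t * 0"
    by (intro tendsto_intros LIMSEQ_Suc[OF lim_1_over_n])
  then have "\<forall>\<^sub>F k in sequentially. t * (1 / real (Suc k)) < d"
    using d(1) by (intro order_tendstoD) auto
  then show ?thesis
  proof eventually_elim
    case (elim k)
    show ?case
    proof (intro allI impI ballI)
      fix i x y assume i: "i < Suc k" and x: "x \<in> {grid t k i..grid t k (Suc i)}"
        and y: "y \<in> {grid t k i..grid t k (Suc i)}"
      have "\<bar>x - y\<bar> < d" using x y grid_step[of t k i] elim by auto
      moreover have "x \<in> {0..t}" "y \<in> {0..t}"
        using x y grid_nonneg[OF t, of k i] grid_le[OF t, of "Suc i" k] i by auto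
      ultimately show "\<bar>f x - f y\<bar> \<le> e" using d(2)[of y x] by (auto simp: dist_real_def)
    qed
  qed
qed

lemma sum_grid_indicator:
  fixes v :: "nat \<Rightarrow> real"
  assumes t: "0 \<le> t" and j: "j < n" and s: "s \<in> {grid t k j<..grid t k (Suc j)}"
  shows "(\<Sum>i<n. v i * indicator {grid t k i<..grid t k (Suc i)} s) = v j"
proof -
  have "v i * indicator {grid t k i<..grid t k (Suc i)} s = (if i = j then v j else 0)" for i
  proof -
    consider "i = j" | "Suc i \<le> j" | "Suc j \<le> i" by linarith
    then show ?thesis
    proof cases
      case 2
      then show ?thesis using s grid_mono[OF t 2, of k] by auto
    next
      case 3
      then show ?thesis using s grid_mono[OF t 3, of k] by auto
    qed (use s in auto)
  qed
  then show ?thesis using j by simp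
qed

text \<open>The bound is asked only on the half-open interval because the left-open grid cells miss
  0; a single point is a null set.\<close>

lemma sq_norm_le_const:
  assumes t: "0 \<le> t" and c: "0 \<le> c"
    and le: "\<And>s. s \<in> {0<..t} \<Longrightarrow> \<bar>f s\<bar> \<le> c" and out: "\<And>s. s \<notin> {0..t} \<Longrightarrow> f s = 0"
  shows "sq_norm lborel f \<le> ennreal (c\<^sup>2 * t)"
proof -
  have "sq_norm lborel f \<le> (\<integral>\<^sup>+s. ennreal (c\<^sup>2) * indicator {0..t} s \<partial>lborel)"
    unfolding sq_norm_def
  proof (rule nn_integral_mono_AE)
    show "AE s in lborel. ennreal ((f s)\<^sup>2) \<le> ennreal (c\<^sup>2) * indicator {0..t} s"
      using AE_lborel_singleton[of "0::real"]
    proof eventually_elim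
      case (elim s)
      show ?case
      proof (cases "s \<in> {0..t}")
        case True
        then have "\<bar>f s\<bar> \<le> c" using elim le[of s] by auto
        then have "(f s)\<^sup>2 \<le> c\<^sup>2" using power_mono[of "\<bar>f s\<bar>" c 2] by simp
        then show ?thesis using True by (simp add: ennreal_leI)
      qed (simp add: out)
    qed
  qed
  also have "\<dots> = ennreal (c\<^sup>2 * t)"
    using t by (simp add: nn_integral_cmult_indicator ennreal_mult')
  finally show ?thesis .
qed

lemma ennreal_tendsto_0I:
  fixes f :: "nat \<Rightarrow> ennreal"
  assumes "\<And>e. 0 < e \<Longrightarrow> \<forall>\<^sub>F k in sequentially. f k \<le> ennreal e"
  shows "f \<longlonglongrightarrow> 0"
proof (rule order_tendstoI)
  fix a :: ennreal assume "0 < a"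
  then obtain b where b: "0 < b" "b < a" using dense by blast
  then obtain e where e: "b = ennreal e" "0 < e" by (cases b) (auto simp: top_unique)
  show "\<forall>\<^sub>F k in sequentially. f k < a"
    using assms[OF e(2)] by eventually_elim (use b e in auto)
qed simp

lemma sq_norm_tendsto_0_uniform:
  fixes f :: "nat \<Rightarrow> real \<Rightarrow> real"
  assumes t: "0 \<le> t" and out: "\<And>k s. s \<notin> {0..t} \<Longrightarrow> f k s = 0"
    and lim: "\<And>e. 0 < e \<Longrightarrow> \<forall>\<^sub>F k in sequentially. \<forall>s\<in>{0<..t}. \<bar>f k s\<bar> \<le> e"
  shows "(\<lambda>k. sq_norm lborel (f k)) \<longlonglongrightarrow> 0"
proof (rule ennreal_tendsto_0I)
  fix e :: real assume e: "0 < e"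
  \<comment> \<open>Chosen such that c^2 t is at most e; the summand 1 covers t = 0.\<close>
  define c where "c = sqrt (e / (t + 1))"
  have c: "0 < c" "c\<^sup>2 * t \<le> e" using e t by (auto simp: c_def field_simps)
  show "\<forall>\<^sub>F k in sequentially. sq_norm lborel (f k) \<le> ennreal e"
    using lim[OF c(1)]
  proof eventually_elim
    case (elim k)
    have "sq_norm lborel (f k) \<le> ennreal (c\<^sup>2 * t)"
      by (rule sq_norm_le_const[OF t less_imp_le[OF c(1)]]) (use elim out in auto)
    also have "\<dots> \<le> ennreal e" using c(2) by (rule ennreal_leI)
    finally show ?case .
  qed
qed

lemma borel_cut:
  fixes \<phi> :: "real \<Rightarrow> real"
  assumes "continuous_on {0..t} \<phi>"
  shows "(\<lambda>s. \<phi> s * indicator {0..t} s) \<in> borel_measurable borel"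
  using borel_measurable_continuous_on_indicator[OF _ assms] by (simp add: mult.commute)

lemma borel_step: "(\<lambda>s. \<Sum>i<n. v i * indicator {p i<..q i} s :: real) \<in> borel_measurable borel"
  for p q :: "nat \<Rightarrow> real"
  by measurable

section \<open>Translation between simple integrands and the graph\<close>

context brownian_setup
begin

lemma simple_integrand_nonneg:
  assumes "simple_integrand M F n p h"
  shows "i \<le> n \<Longrightarrow> 0 \<le> p i"
proof (induction i)
  case (Suc i)
  then show ?case using assms unfolding simple_integrand_def
    by (metis Suc_le_lessD less_imp_le_nat order_trans)
qed (use assms in \<open>simp add: simple_integrand_def\<close>)

text \<open>Cutting the integrand off at \<open>t\<close> is the same as stopping \<open>B\<close>
  at \<open>t\<close>, step by step: a step that begins by time \<open>t\<close> is shortened, a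
  later one disappears from integrand and integral alike.\<close>

lemma elementary_simple:
  assumes si: "simple_integrand M F n p h" and t: "0 \<le> t"
  shows "elementary (\<lambda>x. simple_process n p h (snd x) (fst x) * indicator {0..t} (snd x))
    (simple_integral B t n p h)"
proof -
  have "elementary (\<lambda>x. simple_process m p h (snd x) (fst x) * indicator {0..t} (snd x))
    (simple_integral B t m p h)" if "m \<le> n" for m
    using that
  proof (induction m)
    case 0
    then show ?case using elementary_zero by (simp add: simple_process_def simple_integral_def)
  next
    case (Suc m)
    then have IH: "elementary (\<lambda>x. simple_process m p h (snd x) (fst x) * indicator {0..t} (snd x))
      (simple_integral B t m p h)" and m: "m < n" by auto
    have p0: "0 \<le> p m" using simple_integrand_nonneg[OF si] m by simp
    have pm: "p m \<le> p (Suc m)" and hm: "h m \<in> borel_measurable (F (p m))"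
      and "\<exists>C. \<forall>\<omega>\<in>space M. \<bar>h m \<omega>\<bar> \<le> C"
      using si m unfolding simple_integrand_def by auto
    then obtain C where C: "\<And>\<omega>. \<omega> \<in> space M \<Longrightarrow> \<bar>h m \<omega>\<bar> \<le> C" by blast
    show ?case
    proof (cases "p m \<le> t")
      case True
      have i: "indicator {p m<..p (Suc m)} s * indicator {0..t} s =
        (indicator {p m<..min (p (Suc m)) t} s :: real)" for s
        using p0 by (auto simp: indicator_def)
      have "elementary
        (\<lambda>x. simple_process m p h (snd x) (fst x) * indicator {0..t} (snd x)
          + h m (fst x) * indicator {p m<..min (p (Suc m)) t} (snd x))
        (\<lambda>\<omega>. simple_integral B t m p h \<omega> + h m \<omega> * (B (min (p (Suc m)) t) \<omega> - B (p m) \<omega>))"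
        by (rule elementary_step[OF IH p0 _ hm C]) (use True pm in auto)
      then show ?thesis
        using True unfolding simple_process_def simple_integral_def
        by (simp add: distrib_right i mult.assoc)
    next
      case False
      then have "indicator {p m<..p (Suc m)} s * indicator {0..t} s = (0::real)" for s
        by (auto simp: indicator_def)
      moreover have "min (p m) t = t" "min (p (Suc m)) t = t" using False pm by auto
      ultimately show ?thesis
        using IH unfolding simple_process_def simple_integral_def
        by (simp only: sum.lessThan_Suc distrib_right mult.assoc diff_self mult_zero_right add_0_right)
    qed
  qed
  then show ?thesis by simp
qed

text \<open>Tonelli identifies the iterated integral in \<open>has_ito_integral\<close> with the
  norm on the product space; cutting off by the indicator replaces integration over the time
  set.\<close>

lemma sq_norm_simple:
  assumes si: "simple_integrand M F n p h" and t: "0 \<le> t" and cont: "continuous_on {0..t} \<phi>"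
  shows "sq_norm MT (\<lambda>x. simple_process n p h (snd x) (fst x) * indicator {0..t} (snd x)
      - \<phi> (snd x) * indicator {0..t} (snd x)) =
    (\<integral>\<^sup>+\<omega>. (\<integral>\<^sup>+s\<in>{0..t}. ennreal ((simple_process n p h s \<omega> - \<phi> s)\<^sup>2) \<partial>lborel) \<partial>M)"
proof -
  note [measurable] = elementary_measurable(1)[OF elementary_simple[OF si t]] borel_cut[OF cont]
  have "(\<lambda>x. simple_process n p h (snd x) (fst x) * indicator {0..t} (snd x)
      - \<phi> (snd x) * indicator {0..t} (snd x)) \<in> borel_measurable MT" by measurable
  then have m: "(\<lambda>x. ennreal ((simple_process n p h (snd x) (fst x) * indicator {0..t} (snd x)
      - \<phi> (snd x) * indicator {0..t} (snd x))\<^sup>2)) \<in> borel_measurable MT" by simp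
  show ?thesis
    unfolding sq_norm_def lborel.nn_integral_fst[OF m, symmetric]
    by (intro nn_integral_cong) (simp split: split_indicator)
qed

lemma has_ito_integral_imp_wiener_integral:
  assumes ito: "has_ito_integral M F B t (\<lambda>s _. \<phi> s) Y" and t: "0 \<le> t" and cont: "continuous_on {0..t} \<phi>"
  shows "wiener_integral (\<lambda>s. \<phi> s * indicator {0..t} s) Y"
proof -
  from ito obtain n p h where si: "\<And>k. simple_integrand M F (n k) (p k) (h k)"
    and S: "(\<lambda>k::nat. \<integral>\<^sup>+\<omega>. (\<integral>\<^sup>+s\<in>{0..t}. ennreal ((simple_process (n k) (p k) (h k) s \<omega> - \<phi> s)\<^sup>2) \<partial>lborel) \<partial>M)
      \<longlonglongrightarrow> 0"
    and I: "(\<lambda>k. \<integral>\<^sup>+\<omega>. ennreal ((simple_integral B t (n k) (p k) (h k) \<omega> - Y \<omega>)\<^sup>2) \<partial>M) \<longlonglongrightarrow> 0"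
    and Y: "Y \<in> borel_measurable M"
    unfolding has_ito_integral_def by (elim conjE exE) (rule that, auto)
  show ?thesis
    unfolding wiener_integral_def
  proof (intro conjI exI allI)
    show "elementary (\<lambda>x. simple_process (n k) (p k) (h k) (snd x) (fst x) * indicator {0..t} (snd x))
      (simple_integral B t (n k) (p k) (h k))" for k
      by (rule elementary_simple[OF si t])
    show "(\<lambda>k. sq_norm MT (\<lambda>x. simple_process (n k) (p k) (h k) (snd x) (fst x) * indicator {0..t} (snd x)
        - \<phi> (snd x) * indicator {0..t} (snd x))) \<longlonglongrightarrow> 0"
      unfolding sq_norm_simple[OF si t cont] by (rule S)
    show "(\<lambda>k. sq_norm M (\<lambda>\<omega>. simple_integral B t (n k) (p k) (h k) \<omega> - Y \<omega>)) \<longlonglongrightarrow> 0"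
      unfolding sq_norm_def by (rule I)
  qed (use Y borel_cut[OF cont] in auto)
qed

abbreviation grid_process :: "real \<Rightarrow> nat \<Rightarrow> (real \<Rightarrow> real) \<Rightarrow> real \<Rightarrow> real" where
  "grid_process t k \<phi> s \<equiv> (\<Sum>i<Suc k. \<phi> (grid t k i) * indicator {grid t k i<..grid t k (Suc i)} s)"

abbreviation grid_integral :: "real \<Rightarrow> nat \<Rightarrow> (real \<Rightarrow> real) \<Rightarrow> real \<Rightarrow> 'w \<Rightarrow> real" where
  "grid_integral t k \<phi> u \<equiv> simple_integral B u (Suc k) (grid t k) (\<lambda>i _. \<phi> (grid t k i))"

lemma simple_integrand_grid:
  assumes "0 \<le> t"
  shows "simple_integrand M F (Suc k) (grid t k) (\<lambda>i _. \<phi> (grid t k i))"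
  unfolding simple_integrand_def using grid_mono[OF assms] by auto

lemma wiener_integral_grid:
  assumes t: "0 \<le> t" and u: "0 \<le> u"
  shows "wiener_integral (\<lambda>s. grid_process t k \<phi> s * indicator {0..u} s) (grid_integral t k \<phi> u)"
  by (rule wiener_integral_elementary[OF elementary_simple[OF simple_integrand_grid[OF t] u]])
    (use borel_step in \<open>auto simp: simple_process_def\<close>)

lemma grid_process_approx:
  assumes t: "0 \<le> t" and cont: "continuous_on {0..t} \<phi>" and e: "0 < e"
  shows "\<forall>\<^sub>F k in sequentially. \<forall>s\<in>{0<..t}. \<bar>grid_process t k \<phi> s - \<phi> s\<bar> \<le> e"
  using grid_oscillation[OF t cont e]
proof eventually_elim
  case (elim k)
  show ?case
  proof
    fix s assume "s \<in> {0<..t}"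
    then obtain j where j: "j < Suc k" "s \<in> {grid t k j<..grid t k (Suc j)}"
      using grid_cover[of s t k] by auto
    have "grid_process t k \<phi> s = \<phi> (grid t k j)"
      by (rule sum_grid_indicator[OF t j])
    then show "\<bar>grid_process t k \<phi> s - \<phi> s\<bar> \<le> e"
      using elim j by (auto simp del: sum.lessThan_Suc)
  qed
qed

lemma sq_norm_grid_tendsto:
  assumes t: "0 \<le> t" and cont: "continuous_on {0..t} \<phi>"
  shows "(\<lambda>k. sq_norm lborel (\<lambda>s. grid_process t k \<phi> s * indicator {0..t} s - \<phi> s * indicator {0..t} s))
    \<longlonglongrightarrow> 0"
proof (rule sq_norm_tendsto_0_uniform[OF t])
  fix e :: real assume "0 < e"
  from grid_process_approx[OF t cont this]
  show "\<forall>\<^sub>F k in sequentially. \<forall>s\<in>{0<..t}.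
      \<bar>grid_process t k \<phi> s * indicator {0..t} s - \<phi> s * indicator {0..t} s\<bar> \<le> e"
    by eventually_elim (auto simp del: sum.lessThan_Suc)
qed simp

lemma progressive_deterministic:
  assumes "continuous_on {0..t} \<phi>"
  shows "progressive_upto F t (\<lambda>s _. \<phi> s)"
  unfolding progressive_upto_def
proof
  fix u assume "u \<in> {0..t}"
  then have "continuous_on {0..u} \<phi>" by (intro continuous_on_subset[OF assms]) auto
  then have [measurable]: "\<phi> \<in> borel_measurable (restrict_space borel {0..u})"
    by (rule borel_measurable_continuous_on_restrict)
  show "(\<lambda>(s, \<omega>). \<phi> s) \<in> borel_measurable (restrict_space borel {0..u} \<Otimes>\<^sub>M F u)"
    unfolding case_prod_beta by measurable
qed

text \<open>The elementary processes approximating in the graph need not be partitions, so they are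
  replaced by grid sums of \<phi>. These approximate \<phi> by uniform continuity, and
  \<open>wiener_integral_bound\<close> forces their integrals to converge to
  \<open>Y\<close>.\<close>

lemma wiener_integral_imp_has_ito_integral:
  assumes W: "wiener_integral (\<lambda>s. \<phi> s * indicator {0..t} s) Y" and t: "0 \<le> t"
    and cont: "continuous_on {0..t} \<phi>"
  shows "has_ito_integral M F B t (\<lambda>s _. \<phi> s) Y"
  unfolding has_ito_integral_def
proof (intro conjI exI allI)
  let ?d = "\<lambda>k. sq_norm lborel (\<lambda>s. grid_process t k \<phi> s * indicator {0..t} s - \<phi> s * indicator {0..t} s)"
  note si = simple_integrand_grid[OF t, of _ \<phi>]
  note lim = sq_norm_grid_tendsto[OF t cont]
  show "progressive_upto F t (\<lambda>s _. \<phi> s)" by (rule progressive_deterministic[OF cont])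
  show "Y \<in> borel_measurable M" by (rule wiener_integral_measurable(2)[OF W])
  show "simple_integrand M F (Suc k) (grid t k) (\<lambda>i _. \<phi> (grid t k i))" for k by (rule si)
  have "(\<integral>\<^sup>+\<omega>. (\<integral>\<^sup>+s\<in>{0..t}. ennreal ((simple_process (Suc k) (grid t k)
      (\<lambda>i _. \<phi> (grid t k i)) s \<omega> - \<phi> s)\<^sup>2) \<partial>lborel) \<partial>M) = ?d k" for k
  proof -
    have m: "(\<lambda>s. grid_process t k \<phi> s * indicator {0..t} s - \<phi> s * indicator {0..t} s) \<in> borel_measurable borel"
      by (intro borel_measurable_diff borel_cut[OF cont] borel_measurable_times borel_step) simp
    show ?thesis
      using sq_norm_simple[OF si t cont, of k] sq_norm_time[OF m] by (simp only: simple_process_def)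
  qed
  then show "(\<lambda>k. \<integral>\<^sup>+\<omega>. (\<integral>\<^sup>+s\<in>{0..t}. ennreal ((simple_process (Suc k) (grid t k)
      (\<lambda>i _. \<phi> (grid t k i)) s \<omega> - \<phi> s)\<^sup>2) \<partial>lborel) \<partial>M) \<longlonglongrightarrow> 0"
    using lim by presburger
  have "(\<lambda>k. 16 * ?d k) \<longlonglongrightarrow> 0" using ennreal_tendsto_cmult[OF _ lim, of 16] by simp
  then have "(\<lambda>k. sq_norm M (\<lambda>\<omega>. grid_integral t k \<phi> t \<omega> - Y \<omega>)) \<longlonglongrightarrow> 0"
    by (rule ennreal_tendsto_0_le[rotated]) (rule wiener_integral_bound[OF wiener_integral_grid[OF t t] W])
  then show "(\<lambda>k. \<integral>\<^sup>+\<omega>. ennreal ((grid_integral t k \<phi> t \<omega> - Y \<omega>)\<^sup>2) \<partial>M) \<longlonglongrightarrow> 0"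
    unfolding sq_norm_def .
qed

section \<open>Adaptedness of integrals and indistinguishability\<close>

lemma null_set_in_F:
  assumes "AE \<omega> in M. P \<omega>" "0 \<le> t" "A \<subseteq> {\<omega> \<in> space M. \<not> P \<omega>}"
  shows "A \<in> sets (F t)"
proof -
  obtain N where N: "{\<omega> \<in> space M. \<not> P \<omega>} \<subseteq> N" "N \<in> null_sets M"
    using assms(1) unfolding eventually_ae_filter by auto
  have "A \<in> sets M" using complete[OF _ N(2), of A] N(1) assms(3) by blast
  then have "A \<in> null_sets M" using null_sets_subset[OF N(2)] N(1) assms(3) by blast
  then show ?thesis using null_sets_F[OF assms(2)] by blast
qed

text \<open>Completeness makes every subset of a null set measurable, and the filtration contains
  all null sets from time 0 on, so changing a variable on a null set does not affect
  adaptedness.\<close>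

lemma measurable_F_AE:
  assumes L: "L \<in> borel_measurable (F t)" and t: "0 \<le> t" and ae: "AE \<omega> in M. Y \<omega> = L \<omega>"
  shows "(Y :: 'w \<Rightarrow> real) \<in> borel_measurable (F t)"
proof (rule measurableI)
  fix A :: "real set" assume A: "A \<in> sets borel"
  let ?N = "{\<omega> \<in> space M. Y \<omega> \<noteq> L \<omega>}"
  have N: "?N \<in> sets (F t)" "Y -` A \<inter> ?N \<in> sets (F t)"
    by (rule null_set_in_F[OF ae t], auto)+
  have "Y -` A \<inter> space (F t) = (L -` A \<inter> space (F t) - ?N) \<union> (Y -` A \<inter> ?N)"
    using space_F[OF t] by auto
  also have "\<dots> \<in> sets (F t)" using N measurable_sets[OF L A] by blast
  finally show "Y -` A \<inter> space (F t) \<in> sets (F t)" .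
qed simp

lemma simple_integral_adapted:
  assumes si: "simple_integrand M F n p h" and t: "0 \<le> t"
  shows "simple_integral B t n p h \<in> borel_measurable (F t)"
  unfolding simple_integral_def
proof (rule borel_measurable_sum)
  fix i assume "i \<in> {..<n}"
  then have i: "i < n" by simp
  have p0: "0 \<le> p i" using simple_integrand_nonneg[OF si] i by simp
  have pm: "p i \<le> p (Suc i)" and hm: "h i \<in> borel_measurable (F (p i))"
    using si i unfolding simple_integrand_def by auto
  show "(\<lambda>\<omega>. h i \<omega> * (B (min (p (Suc i)) t) \<omega> - B (min (p i) t) \<omega>)) \<in> borel_measurable (F t)"
  proof (cases "p i \<le> t")
    case True
    show ?thesis
      using True p0 pm t
      by (intro borel_measurable_times borel_measurable_diff measurable_F_mono[OF hm] B_adapted') auto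
  next
    \<comment> \<open>The coefficient may be unknown at time \<open>t\<close>, but both increments
      are stopped at \<open>t\<close> and the term is zero.\<close>
    case False
    then show ?thesis using pm by simp
  qed
qed

text \<open>The defining convergence is in mean square over \<open>M\<close> and says nothing about
  \<open>F t\<close>. An almost surely convergent subsequence exhibits \<open>Y\<close> as the limit
  of adapted variables outside a null set.\<close>

lemma has_ito_integral_adapted:
  assumes ito: "has_ito_integral M F B t H Y" and t: "0 \<le> t"
  shows "Y \<in> borel_measurable (F t)"
proof -
  from ito obtain n p h where si: "\<And>k. simple_integrand M F (n k) (p k) (h k)"
    and I: "(\<lambda>k::nat. \<integral>\<^sup>+\<omega>. ennreal ((simple_integral B t (n k) (p k) (h k) \<omega> - Y \<omega>)\<^sup>2) \<partial>M) \<longlonglongrightarrow> 0"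
    and Y[measurable]: "Y \<in> borel_measurable M"
    unfolding has_ito_integral_def by (elim conjE exE) (rule that, auto)
  define J where "J k = simple_integral B t (n k) (p k) (h k)" for k
  have JF: "J k \<in> borel_measurable (F t)" for k
    unfolding J_def by (rule simple_integral_adapted[OF si t])
  note [measurable] = measurable_F_M[OF JF t]
  have I': "(\<lambda>k. \<integral>\<^sup>+\<omega>. ennreal ((J k \<omega> - Y \<omega>)\<^sup>2) \<partial>M) \<longlonglongrightarrow> 0"
    using I unfolding J_def .
  from order_tendstoD(2)[OF this, of 1] obtain K where
    K: "\<And>k. K \<le> k \<Longrightarrow> (\<integral>\<^sup>+\<omega>. ennreal ((J k \<omega> - Y \<omega>)\<^sup>2) \<partial>M) < 1"
    by (auto simp: eventually_sequentially)
  \<comment> \<open>The shift by \<open>K\<close> discards the terms whose mean square might be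
    infinite.\<close>
  let ?u = "\<lambda>k \<omega>. (J (k + K) \<omega> - Y \<omega>)\<^sup>2"
  have int: "integrable M (?u k)" for k
  proof (rule integrableI_nonneg)
    show "(\<integral>\<^sup>+\<omega>. ennreal (?u k \<omega>) \<partial>M) < \<infinity>"
      using K[of "k + K"] by (simp add: order_less_trans[OF _ ennreal_one_less_top])
  qed auto
  have "(\<lambda>k. ennreal (\<integral>\<omega>. norm (?u k \<omega>) \<partial>M)) \<longlonglongrightarrow> ennreal 0"
    using LIMSEQ_ignore_initial_segment[OF I', of K] nn_integral_eq_integral[OF int] by simp
  then have "(\<lambda>k. \<integral>\<omega>. norm (?u k \<omega>) \<partial>M) \<longlonglongrightarrow> 0"
    by (subst (asm) tendsto_ennreal_iff) (auto intro!: always_eventually)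
  from tendsto_L1_AE_subseq[OF int this] obtain r :: "nat \<Rightarrow> nat"
    where r: "AE \<omega> in M. (\<lambda>k. ?u (r k) \<omega>) \<longlonglongrightarrow> 0" by blast
  have "AE \<omega> in M. Y \<omega> = lim (\<lambda>k. J (r k + K) \<omega>)"
    using r
  proof eventually_elim
    case (elim \<omega>)
    then have "(\<lambda>k. sqrt (?u (r k) \<omega>)) \<longlonglongrightarrow> sqrt 0" by (intro tendsto_intros)
    then have "(\<lambda>k. J (r k + K) \<omega> - Y \<omega>) \<longlonglongrightarrow> 0" by (simp add: tendsto_rabs_zero_iff)
    then have "(\<lambda>k. J (r k + K) \<omega>) \<longlonglongrightarrow> Y \<omega>" by (simp add: LIM_zero_iff)
    then show ?case by (rule limI[symmetric])
  qed
  then show ?thesis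
    by (rule measurable_F_AE[OF borel_measurable_lim_metric[OF JF] t])
qed

text \<open>The exceptional sets of the countably many rational times can be united. Where the paths
  differ at some \<open>t\<close>, continuity keeps them apart just to the right of
  \<open>t\<close>, hence at a rational time.\<close>

lemma indistinguishable_of_AE_eq:
  assumes X: "\<And>\<omega>. \<omega> \<in> space M \<Longrightarrow> continuous_on {0..<T} (\<lambda>t. X t \<omega>)"
    and Y: "\<And>\<omega>. \<omega> \<in> space M \<Longrightarrow> continuous_on {0..<T} (\<lambda>t. Y t \<omega>)"
    and eq: "\<And>t. t \<in> {0..<T} \<Longrightarrow> AE \<omega> in M. X t \<omega> = Y t \<omega>"
  shows "indistinguishable M T X Y"
proof -
  have "AE \<omega> in M. \<forall>t\<in>{0..<T} \<inter> \<rat>. X t \<omega> = Y t \<omega>"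
    by (rule AE_ball_countable') (use eq countable_rat in \<open>auto intro: countable_subset\<close>)
  with AE_space have "AE \<omega> in M. \<forall>t\<in>{0..<T}. X t \<omega> = Y t \<omega>"
  proof eventually_elim
    case (elim \<omega>)
    show ?case
    proof (rule ballI, rule ccontr)
      fix t assume t: "t \<in> {0..<T}" and ne: "X t \<omega> \<noteq> Y t \<omega>"
      have "continuous_on {0..<T} (\<lambda>t. X t \<omega> - Y t \<omega>)"
        using X Y elim(1) by (intro continuous_on_diff) auto
      from this[unfolded continuous_on_iff, rule_format, OF t, of "\<bar>X t \<omega> - Y t \<omega>\<bar>"] ne
      obtain d where d: "0 < d"
        "\<And>s. s \<in> {0..<T} \<Longrightarrow> dist s t < d \<Longrightarrow> dist (X s \<omega> - Y s \<omega>) (X t \<omega> - Y t \<omega>) < \<bar>X t \<omega> - Y t \<omega>\<bar>"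
        by auto
      obtain s where s: "s \<in> \<rat>" "t < s" "s < min T (t + d)"
        using Rats_dense_in_real[of t "min T (t + d)"] t d(1) by auto
      then have "s \<in> {0..<T} \<inter> \<rat>" using t by auto
      with elim(2) have "X s \<omega> = Y s \<omega>" by blast
      with d(2)[of s] s t show False by (auto simp: dist_real_def)
    qed
  qed
  then show ?thesis by (simp add: indistinguishable_def)
qed

end


section \<open>Continuous versions\<close>

lemma integrable_mult_of_squares:
  fixes f g :: "'x \<Rightarrow> real"
  assumes [measurable]: "f \<in> borel_measurable P" "g \<in> borel_measurable P"
    and "integrable P (\<lambda>x. (f x)\<^sup>2)" "integrable P (\<lambda>x. (g x)\<^sup>2)"
  shows "integrable P (\<lambda>x. f x * g x)"
proof (rule Bochner_Integration.integrable_bound[OF Bochner_Integration.integrable_add[OF assms(3,4)]])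
  have "\<bar>a * b\<bar> \<le> a\<^sup>2 + b\<^sup>2" for a b :: real
  proof -
    have "2 * (\<bar>a\<bar> * \<bar>b\<bar>) \<le> a\<^sup>2 + b\<^sup>2"
      using sum_squares_bound[of "\<bar>a\<bar>" "\<bar>b\<bar>"] by (simp add: mult.assoc)
    moreover have "0 \<le> \<bar>a\<bar> * \<bar>b\<bar>" by simp
    ultimately show ?thesis unfolding abs_mult by linarith
  qed
  then show "AE x in P. norm (f x * g x) \<le> norm ((f x)\<^sup>2 + (g x)\<^sup>2)" by simp
qed simp

text \<open>Continuity extends the bound from the dense dyadic points, here approached from the left
  by rounding down. Each level is finite and contained in the next, which suits a maximal inequality
  for finitely many times.\<close>

lemma continuous_on_dyadic_bound:
  fixes f :: "real \<Rightarrow> real"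
  assumes T: "0 < T" and cont: "continuous_on {0..T} f" and t: "t \<in> {0..T}"
    and bound: "\<And>m j. j \<le> 2 ^ m \<Longrightarrow> \<bar>f (T * real j / 2 ^ m)\<bar> \<le> e"
  shows "\<bar>f t\<bar> \<le> e"
proof -
  define j where "j m = nat \<lfloor>t * 2 ^ m / T\<rfloor>" for m :: nat
  define x where "x m = T * real (j m) / 2 ^ m" for m
  have j: "real (j m) \<le> t * 2 ^ m / T" "t * 2 ^ m / T < real (j m) + 1" for m
  proof -
    have "0 \<le> \<lfloor>t * 2 ^ m / T\<rfloor>" using t T by simp
    then have "real (j m) = of_int \<lfloor>t * 2 ^ m / T\<rfloor>" by (simp add: j_def)
    then show "real (j m) \<le> t * 2 ^ m / T" "t * 2 ^ m / T < real (j m) + 1" by linarith+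
  qed
  have x: "x m \<le> t" "t \<le> x m + T * (1/2) ^ m" for m
    using j[of m] T by (simp_all add: x_def field_simps power_one_over)
  have "(\<lambda>m. t - T * (1/2) ^ m) \<longlonglongrightarrow> t - T * 0"
    by (intro tendsto_intros LIMSEQ_power_zero) auto
  then have lim: "x \<longlonglongrightarrow> t"
    by (intro tendsto_sandwich[of "\<lambda>m. t - T * (1/2) ^ m" x sequentially "\<lambda>_. t" t])
      (use x in \<open>auto simp: algebra_simps\<close>)
  have xin: "x m \<in> {0..T}" for m using x(1)[of m] t T by (auto simp: x_def)
  have "(\<lambda>m. f (x m)) \<longlonglongrightarrow> f t"
    by (rule continuous_on_tendsto_compose[OF cont lim t]) (use xin in auto)
  then have "(\<lambda>m. \<bar>f (x m)\<bar>) \<longlonglongrightarrow> \<bar>f t\<bar>" by (rule tendsto_rabs)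
  moreover have "\<bar>f (x m)\<bar> \<le> e" for m
  proof -
    have "real (j m) \<le> 2 ^ m" using xin[of m] T by (simp add: x_def field_simps)
    then have "j m \<le> 2 ^ m" by (metis of_nat_le_iff of_nat_numeral of_nat_power)
    from bound[OF this] show ?thesis by (simp add: x_def)
  qed
  ultimately show ?thesis by (intro LIMSEQ_le_const2) auto
qed

section \<open>Square-integrable martingales and the maximal inequality\<close>

context brownian_setup
begin

text \<open>The martingale property in its dual form: increments are orthogonal to everything square
  integrable known before. This avoids conditional expectations and is evidently linear in
  \<open>D\<close>.\<close>

definition sq_martingale :: "(real \<Rightarrow> 'w \<Rightarrow> real) \<Rightarrow> bool" where
  "sq_martingale D \<longleftrightarrow>
     (\<forall>t\<ge>0. D t \<in> borel_measurable (F t) \<and> integrable M (\<lambda>\<omega>. (D t \<omega>)\<^sup>2)) \<and>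
     (\<forall>s t X. 0 \<le> s \<longrightarrow> s \<le> t \<longrightarrow> X \<in> borel_measurable (F s) \<longrightarrow> integrable M (\<lambda>\<omega>. (X \<omega>)\<^sup>2) \<longrightarrow>
        expectation (\<lambda>\<omega>. X \<omega> * (D t \<omega> - D s \<omega>)) = 0)"

lemma sq_martingaleD:
  assumes "sq_martingale D"
  shows "0 \<le> t \<Longrightarrow> D t \<in> borel_measurable (F t)" "0 \<le> t \<Longrightarrow> integrable M (\<lambda>\<omega>. (D t \<omega>)\<^sup>2)"
    "0 \<le> s \<Longrightarrow> s \<le> t \<Longrightarrow> X \<in> borel_measurable (F s) \<Longrightarrow> integrable M (\<lambda>\<omega>. (X \<omega>)\<^sup>2) \<Longrightarrow>
        expectation (\<lambda>\<omega>. X \<omega> * (D t \<omega> - D s \<omega>)) = 0"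
  using assms unfolding sq_martingale_def by auto

lemma sq_martingale_integrable:
  assumes D: "sq_martingale D" and "0 \<le> s" "0 \<le> t" "X \<in> borel_measurable M" "integrable M (\<lambda>\<omega>. (X \<omega>)\<^sup>2)"
  shows "integrable M (\<lambda>\<omega>. X \<omega> * (D t \<omega> - D s \<omega>))"
  unfolding right_diff_distrib
  by (intro Bochner_Integration.integrable_diff integrable_mult_of_squares assms sq_martingaleD(2)[OF D]
      measurable_F_M[OF sq_martingaleD(1)[OF D]])

text \<open>The building block: a grid integral is a linear combination of differences of stopped
  Wiener processes.\<close>

lemma sq_martingale_stopped:
  assumes b: "0 \<le> b"
  shows "sq_martingale (\<lambda>t. B (min b t))"
  unfolding sq_martingale_def
proof (intro conjI allI impI)
  fix t :: real assume t: "0 \<le> t"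
  show "B (min b t) \<in> borel_measurable (F t)" using b t by (intro B_adapted') auto
  let ?u = "min b t"
  have u: "0 \<le> ?u" using b t by simp
  show "integrable M (\<lambda>\<omega>. (B ?u \<omega>)\<^sup>2)"
  proof (rule integrable_cong_AE_imp[OF increment_moments(3)[OF order_refl u]])
    show "(\<lambda>\<omega>. (B ?u \<omega>)\<^sup>2) \<in> borel_measurable M" using B_measurable[OF u] by simp
    show "AE \<omega> in M. (B ?u \<omega> - B 0 \<omega>)\<^sup>2 = (B ?u \<omega>)\<^sup>2" using B_zero by eventually_elim simp
  qed
next
  fix s t :: real and X :: "'w \<Rightarrow> real" assume s: "0 \<le> s" and t: "s \<le> t" and X: "X \<in> borel_measurable (F s)"
    and X2: "integrable M (\<lambda>\<omega>. (X \<omega>)\<^sup>2)"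
  have Xi: "integrable M X"
    by (rule square_integrable_imp_integrable[OF measurable_F_M[OF X s] X2])
  show "expectation (\<lambda>\<omega>. X \<omega> * (B (min b t) \<omega> - B (min b s) \<omega>)) = 0"
  proof (cases "b \<le> s")
    case False
    then have "s \<le> min b t" "min b s = s" using t by auto
    with increment_orthogonal(2)[OF s _ X Xi, of "min b t"] show ?thesis by simp
  qed (use t in simp)
qed

lemma sq_martingale_add:
  assumes D: "sq_martingale D" and E: "sq_martingale E"
  shows "sq_martingale (\<lambda>t \<omega>. D t \<omega> + E t \<omega>)"
  unfolding sq_martingale_def
proof (intro conjI allI impI)
  fix t :: real assume t: "0 \<le> t"
  note m = sq_martingaleD(1)[OF D t] sq_martingaleD(1)[OF E t]
  show "(\<lambda>\<omega>. D t \<omega> + E t \<omega>) \<in> borel_measurable (F t)" using m by simp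
  have "integrable M (\<lambda>\<omega>. (D t \<omega>)\<^sup>2 + (E t \<omega>)\<^sup>2 + 2 * (D t \<omega> * E t \<omega>))"
    by (intro Bochner_Integration.integrable_add integrable_mult_right integrable_mult_of_squares
      sq_martingaleD(2)[OF D t] sq_martingaleD(2)[OF E t] measurable_F_M[OF m(1) t] measurable_F_M[OF m(2) t])
  then show "integrable M (\<lambda>\<omega>. (D t \<omega> + E t \<omega>)\<^sup>2)" by (simp add: power2_sum mult.assoc)
next
  fix s t :: real and X :: "'w \<Rightarrow> real" assume s: "0 \<le> s" and t: "s \<le> t" and X: "X \<in> borel_measurable (F s)"
    and X2: "integrable M (\<lambda>\<omega>. (X \<omega>)\<^sup>2)"
  have t0: "0 \<le> t" using s t by simp
  note XM = measurable_F_M[OF X s]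
  have "expectation (\<lambda>\<omega>. X \<omega> * (D t \<omega> - D s \<omega>) + X \<omega> * (E t \<omega> - E s \<omega>)) = 0"
    using sq_martingaleD(3)[OF D s t X X2] sq_martingaleD(3)[OF E s t X X2]
      sq_martingale_integrable[OF D s t0 XM X2] sq_martingale_integrable[OF E s t0 XM X2]
    by simp
  then show "expectation (\<lambda>\<omega>. X \<omega> * (D t \<omega> + E t \<omega> - (D s \<omega> + E s \<omega>))) = 0"
    by (simp add: algebra_simps)
qed

lemma sq_martingale_cmult:
  assumes D: "sq_martingale D"
  shows "sq_martingale (\<lambda>t \<omega>. c * D t \<omega>)"
  unfolding sq_martingale_def
proof (intro conjI allI impI)
  fix t :: real assume t: "0 \<le> t"
  show "(\<lambda>\<omega>. c * D t \<omega>) \<in> borel_measurable (F t)" using sq_martingaleD(1)[OF D t] by simp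
  show "integrable M (\<lambda>\<omega>. (c * D t \<omega>)\<^sup>2)"
    using sq_martingaleD(2)[OF D t] by (simp add: power_mult_distrib)
next
  fix s t :: real and X :: "'w \<Rightarrow> real" assume s: "0 \<le> s" and t: "s \<le> t" and X: "X \<in> borel_measurable (F s)"
    and X2: "integrable M (\<lambda>\<omega>. (X \<omega>)\<^sup>2)"
  have "expectation (\<lambda>\<omega>. c * (X \<omega> * (D t \<omega> - D s \<omega>))) = 0"
    using sq_martingaleD(3)[OF D s t X X2] by simp
  then show "expectation (\<lambda>\<omega>. X \<omega> * (c * D t \<omega> - c * D s \<omega>)) = 0"
    by (simp add: algebra_simps)
qed

lemma sq_martingale_diff:
  "sq_martingale D \<Longrightarrow> sq_martingale E \<Longrightarrow> sq_martingale (\<lambda>t \<omega>. D t \<omega> - E t \<omega>)"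
  using sq_martingale_add[OF _ sq_martingale_cmult[of E "-1"], of D] by simp

lemma sq_martingale_zero: "sq_martingale (\<lambda>_ _. 0)"
  by (simp add: sq_martingale_def)

lemma sq_martingale_sum:
  "(\<And>i. i \<in> A \<Longrightarrow> sq_martingale (D i)) \<Longrightarrow> sq_martingale (\<lambda>t \<omega>. \<Sum>i\<in>A. D i t \<omega>)"
  by (induction A rule: infinite_finite_induct) (simp_all add: sq_martingale_zero sq_martingale_add)

lemma sq_martingale_grid: "0 \<le> T \<Longrightarrow> sq_martingale (grid_integral T k \<phi>)"
  unfolding simple_integral_def
  by (intro sq_martingale_sum sq_martingale_cmult sq_martingale_diff sq_martingale_stopped grid_nonneg)

text \<open>First-passage decomposition: \<open>A j\<close> is the event that the level is first
  exceeded at index \<open>j\<close>. On it the square of \<open>D T\<close> dominates that of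
  \<open>D (t j)\<close> plus a cross term, since the difference is the square of
  \<open>D T - D (t j)\<close>; the cross term has mean zero because \<open>A j\<close> is known at
  time \<open>t j\<close>.\<close>

lemma kolmogorov_inequality:
  fixes t :: "nat \<Rightarrow> real"
  assumes D: "sq_martingale D" and t: "\<And>i j. i \<le> j \<Longrightarrow> t i \<le> t j" "0 \<le> t 0" "t n \<le> T" and e: "0 < e"
  shows "{\<omega> \<in> space M. \<exists>j\<le>n. e < \<bar>D (t j) \<omega>\<bar>} \<in> events"
    "e\<^sup>2 * prob {\<omega> \<in> space M. \<exists>j\<le>n. e < \<bar>D (t j) \<omega>\<bar>} \<le> expectation (\<lambda>\<omega>. (D T \<omega>)\<^sup>2)"
proof -
  define A where "A j = {\<omega> \<in> space M. e < \<bar>D (t j) \<omega>\<bar> \<and> (\<forall>i<j. \<not> e < \<bar>D (t i) \<omega>\<bar>)}" for j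
  have t0: "0 \<le> t j" for j using t(1)[of 0 j] t(2) by simp
  have tT: "t j \<le> T" if "j \<le> n" for j using t(1)[OF that] t(3) by simp
  have T0: "0 \<le> T" using t0[of n] t(3) by simp
  have Dm: "D (t i) \<in> borel_measurable (F (t j))" if "i \<le> j" for i j
    by (rule measurable_F_mono[OF sq_martingaleD(1)[OF D] _ t(1)[OF that]]) (rule t0)+
  have AF: "A j \<in> sets (F (t j))" for j
  proof -
    have "A j = {\<omega> \<in> space (F (t j)). e < \<bar>D (t j) \<omega>\<bar>} -
      (\<Union>i\<in>{..<j}. {\<omega> \<in> space (F (t j)). e < \<bar>D (t i) \<omega>\<bar>})"
      unfolding A_def space_F[OF t0] by auto
    also have "\<dots> \<in> sets (F (t j))"
      by (intro sets.Diff sets.finite_UN borel_measurable_less borel_measurable_const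
        borel_measurable_abs Dm) auto
    finally show ?thesis .
  qed
  have AM: "A j \<in> events" for j using AF[of j] subalg[OF t0[of j]] unfolding subalgebra_def by blast
  have disj: "disjoint_family_on A {..n}"
    unfolding disjoint_family_on_def A_def by (auto, metis linorder_neqE_nat)
  have UA: "{\<omega> \<in> space M. \<exists>j\<le>n. e < \<bar>D (t j) \<omega>\<bar>} = (\<Union>j\<in>{..n}. A j)"
  proof (intro set_eqI iffI)
    fix \<omega> assume "\<omega> \<in> {\<omega> \<in> space M. \<exists>j\<le>n. e < \<bar>D (t j) \<omega>\<bar>}"
    then obtain j where j: "\<omega> \<in> space M" "j \<le> n" "e < \<bar>D (t j) \<omega>\<bar>" by blast
    define l where "l = (LEAST j. e < \<bar>D (t j) \<omega>\<bar>)"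
    have "e < \<bar>D (t l) \<omega>\<bar>" unfolding l_def by (rule LeastI) (rule j(3))
    moreover have "l \<le> j" unfolding l_def by (rule Least_le) (rule j(3))
    moreover have "\<not> e < \<bar>D (t i) \<omega>\<bar>" if "i < l" for i
      using not_less_Least that unfolding l_def .
    ultimately show "\<omega> \<in> (\<Union>j\<in>{..n}. A j)" using j by (auto simp: A_def)
  qed (auto simp: A_def)
  show "{\<omega> \<in> space M. \<exists>j\<le>n. e < \<bar>D (t j) \<omega>\<bar>} \<in> events"
    unfolding UA using AM by blast
  have sqT: "integrable M (\<lambda>\<omega>. (D T \<omega>)\<^sup>2)" by (rule sq_martingaleD(2)[OF D T0])
  have intA: "integrable M (\<lambda>\<omega>. indicator (A j) \<omega> * (D T \<omega>)\<^sup>2)" for j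
    using integrable_mult_indicator[OF AM sqT] by simp
  have part: "e\<^sup>2 * prob (A j) \<le> expectation (\<lambda>\<omega>. indicator (A j) \<omega> * (D T \<omega>)\<^sup>2)" if j: "j \<le> n" for j
  proof -
    \<comment> \<open>The variable against which the martingale property is tested; it is measurable
      at time \<open>t j\<close>, which is why \<open>AF\<close> concerns the filtration rather than
      \<open>M\<close>.\<close>
    let ?X = "\<lambda>\<omega>. indicator (A j) \<omega> * D (t j) \<omega>"
    note sj = sq_martingaleD(2)[OF D t0[of j]]
    have XF: "?X \<in> borel_measurable (F (t j))"
      using AF Dm[OF order_refl] by (intro borel_measurable_times borel_measurable_indicator)
    have X2: "(\<lambda>\<omega>. (?X \<omega>)\<^sup>2) = (\<lambda>\<omega>. indicator (A j) \<omega> * (D (t j) \<omega>)\<^sup>2)"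
      by (auto simp: fun_eq_iff indicator_def)
    have X2i: "integrable M (\<lambda>\<omega>. (?X \<omega>)\<^sup>2)"
      unfolding X2 using integrable_mult_indicator[OF AM sj] by simp
    note cross = sq_martingale_integrable[OF D t0 T0 measurable_F_M[OF XF t0] X2i]
    have "e\<^sup>2 * prob (A j) = expectation (\<lambda>\<omega>. e\<^sup>2 * indicator (A j) \<omega>)" using AM by simp
    also have "\<dots> \<le> expectation (\<lambda>\<omega>. (?X \<omega>)\<^sup>2)"
    proof (rule integral_mono)
      show "integrable M (\<lambda>\<omega>. e\<^sup>2 * indicator (A j) \<omega>)"
        using AM by (intro integrable_mult_right) (simp add: emeasure_eq_measure)
      show "integrable M (\<lambda>\<omega>. (?X \<omega>)\<^sup>2)" by (rule X2i)
      show "e\<^sup>2 * indicator (A j) \<omega> \<le> (?X \<omega>)\<^sup>2" for \<omega>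
        using e power_mono[of e "\<bar>D (t j) \<omega>\<bar>" 2] by (auto simp: indicator_def A_def)
    qed
    also have "\<dots> = expectation (\<lambda>\<omega>. (?X \<omega>)\<^sup>2 + 2 * (?X \<omega> * (D T \<omega> - D (t j) \<omega>)))"
      using sq_martingaleD(3)[OF D t0 tT[OF j] XF X2i] X2i cross by simp
    also have "\<dots> \<le> expectation (\<lambda>\<omega>. indicator (A j) \<omega> * (D T \<omega>)\<^sup>2)"
    proof (rule integral_mono[OF _ intA])
      show "integrable M (\<lambda>\<omega>. (?X \<omega>)\<^sup>2 + 2 * (?X \<omega> * (D T \<omega> - D (t j) \<omega>)))"
        by (intro Bochner_Integration.integrable_add integrable_mult_right X2i cross)
      show "(?X \<omega>)\<^sup>2 + 2 * (?X \<omega> * (D T \<omega> - D (t j) \<omega>)) \<le> indicator (A j) \<omega> * (D T \<omega>)\<^sup>2" for \<omega>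
      proof -
        have "0 \<le> (D T \<omega> - D (t j) \<omega>)\<^sup>2" by simp
        then show ?thesis by (auto simp: indicator_def power2_eq_square algebra_simps)
      qed
    qed
    finally show ?thesis .
  qed
  have "e\<^sup>2 * prob (\<Union>j\<in>{..n}. A j) = (\<Sum>j\<le>n. e\<^sup>2 * prob (A j))"
    using finite_measure_finite_Union[OF _ _ disj] AM by (simp add: sum_distrib_left image_subset_iff)
  also have "\<dots> \<le> (\<Sum>j\<le>n. expectation (\<lambda>\<omega>. indicator (A j) \<omega> * (D T \<omega>)\<^sup>2))"
    using part by (intro sum_mono) auto
  also have "\<dots> = expectation (\<lambda>\<omega>. \<Sum>j\<le>n. indicator (A j) \<omega> * (D T \<omega>)\<^sup>2)"
    by (rule Bochner_Integration.integral_sum[symmetric]) (rule intA)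
  also have "\<dots> \<le> expectation (\<lambda>\<omega>. (D T \<omega>)\<^sup>2)"
  proof (rule integral_mono[OF _ sqT])
    show "integrable M (\<lambda>\<omega>. \<Sum>j\<le>n. indicator (A j) \<omega> * (D T \<omega>)\<^sup>2)"
      by (intro Bochner_Integration.integrable_sum intA)
    fix \<omega>
    have "(\<Sum>j\<le>n. indicator (A j) \<omega>) = (indicator (\<Union>j\<in>{..n}. A j) \<omega> :: real)"
      by (rule indicator_UN_disjoint[symmetric]) (use disj in auto)
    then show "(\<Sum>j\<le>n. indicator (A j) \<omega> * (D T \<omega>)\<^sup>2) \<le> (D T \<omega>)\<^sup>2"
      by (simp add: sum_distrib_right[symmetric] indicator_def)
  qed
  finally show "e\<^sup>2 * prob {\<omega> \<in> space M. \<exists>j\<le>n. e < \<bar>D (t j) \<omega>\<bar>} \<le> expectation (\<lambda>\<omega>. (D T \<omega>)\<^sup>2)"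
    unfolding UA .
qed

text \<open>The dyadic exceedance events increase with the level, so their union obeys the same
  bound. Continuity is required path by path because it holds only almost surely, and the event must
  not depend on it.\<close>

lemma maximal_inequality:
  assumes D: "sq_martingale D" and T: "0 < T" and e: "0 < e"
  shows "\<exists>A. A \<in> events \<and> e\<^sup>2 * prob A \<le> expectation (\<lambda>\<omega>. (D T \<omega>)\<^sup>2) \<and>
    (\<forall>\<omega>\<in>space M - A. continuous_on {0..T} (\<lambda>t. D t \<omega>) \<longrightarrow> (\<forall>t\<in>{0..T}. \<bar>D t \<omega>\<bar> \<le> e))"
proof -
  define A where "A m = {\<omega> \<in> space M. \<exists>j\<le>2 ^ m. e < \<bar>D (T * real j / 2 ^ m) \<omega>\<bar>}" for m :: nat
  have *: "A m \<in> events \<and> e\<^sup>2 * prob (A m) \<le> expectation (\<lambda>\<omega>. (D T \<omega>)\<^sup>2)" for m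
  proof -
    let ?t = "\<lambda>j. T * real j / 2 ^ m"
    have 1: "?t i \<le> ?t j" if "i \<le> j" for i j
      using T that by (simp add: divide_right_mono)
    have 2: "0 \<le> ?t 0" and 3: "?t (2 ^ m) \<le> T" by simp_all
    note kolmogorov_inequality[where t = ?t and n = "2 ^ m", OF D 1 2 3 e]
    then show ?thesis unfolding A_def by (rule conjI)
  qed
  have inc: "incseq A"
  proof (rule incseq_SucI)
    fix m show "A m \<subseteq> A (Suc m)"
    proof
      fix \<omega> assume "\<omega> \<in> A m"
      then obtain j where j: "\<omega> \<in> space M" "j \<le> 2 ^ m" "e < \<bar>D (T * real j / 2 ^ m) \<omega>\<bar>"
        unfolding A_def by blast
      have eq: "T * real j / 2 ^ m = T * real (2 * j) / 2 ^ Suc m"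
        unfolding of_nat_mult power_Suc by simp
      have "2 * j \<le> 2 ^ Suc m" using j(2) by simp
      then show "\<omega> \<in> A (Suc m)" using j(1) j(3)[unfolded eq] unfolding A_def by blast
    qed
  qed
  show ?thesis
  proof (intro exI[of _ "\<Union>m. A m"] conjI ballI impI)
    show "(\<Union>m. A m) \<in> events" using * by blast
    have "(\<lambda>m. prob (A m)) \<longlonglongrightarrow> prob (\<Union>m. A m)"
      by (rule finite_Lim_measure_incseq[OF _ inc]) (use * in auto)
    then have "(\<lambda>m. e\<^sup>2 * prob (A m)) \<longlonglongrightarrow> e\<^sup>2 * prob (\<Union>m. A m)" by (rule tendsto_mult_left)
    then show "e\<^sup>2 * prob (\<Union>m. A m) \<le> expectation (\<lambda>\<omega>. (D T \<omega>)\<^sup>2)"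
      by (rule LIMSEQ_le_const2) (use * in auto)
    fix \<omega> t assume \<omega>: "\<omega> \<in> space M - (\<Union>m. A m)" and c: "continuous_on {0..T} (\<lambda>t. D t \<omega>)"
      and t: "t \<in> {0..T}"
    show "\<bar>D t \<omega>\<bar> \<le> e"
      by (rule continuous_on_dyadic_bound[OF T c t]) (use \<omega> in \<open>auto simp: A_def not_less\<close>)
  qed
qed

section \<open>A continuous version of the Wiener integral\<close>

lemma sq_norm_eq_expectation:
  "integrable M (\<lambda>\<omega>. (X \<omega>)\<^sup>2) \<Longrightarrow> sq_norm M X = ennreal (expectation (\<lambda>\<omega>. (X \<omega>)\<^sup>2))"
  unfolding sq_norm_def by (rule nn_integral_eq_integral) auto

lemma grid_integral_continuous:
  assumes c: "continuous_on {0..} (\<lambda>t. B t \<omega>)" and T: "0 \<le> T"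
  shows "continuous_on {0..T} (\<lambda>t. grid_integral T k \<phi> t \<omega>)"
proof -
  have "continuous_on {0..T} (\<lambda>t. B (min b t) \<omega>)" if "0 \<le> b" for b
    by (rule continuous_on_compose2[OF c]) (use that in \<open>auto intro!: continuous_intros\<close>)
  then show ?thesis
    unfolding simple_integral_def
    by (intro continuous_on_sum continuous_on_mult continuous_on_const continuous_on_diff)
      (auto intro!: grid_nonneg T)
qed

theorem continuous_wiener_integral_exists:
  assumes T: "0 < T" and cont: "continuous_on {0..T} \<phi>"
  obtains J where "\<And>\<omega>. \<omega> \<in> space M \<Longrightarrow> continuous_on {0..T} (\<lambda>t. J t \<omega>)"
    "\<And>t. t \<in> {0..T} \<Longrightarrow> wiener_integral (\<lambda>s. \<phi> s * indicator {0..t} s) (J t)"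
    "\<And>\<omega>. J 0 \<omega> = 0"
proof -
  have T0: "0 \<le> T" using T by simp
  \<comment> \<open>The rate 4^(-n) leaves room: variances of order 16^(-n) against the squared
    threshold 4^(-n), with threshold 2^(-n), give probabilities of order 4^(-n), and both thresholds
    and probabilities are summable.\<close>
  have "\<forall>n. \<exists>k. \<forall>s\<in>{0<..T}. \<bar>grid_process T k \<phi> s - \<phi> s\<bar> \<le> (1/4) ^ n"
    using eventually_happens[OF grid_process_approx[OF T0 cont]] by (simp del: sum.lessThan_Suc)
  from choice[OF this] obtain r where "\<forall>n. \<forall>s\<in>{0<..T}. \<bar>grid_process T (r n) \<phi> s - \<phi> s\<bar> \<le> (1/4) ^ n" ..
  then have r: "\<bar>grid_process T (r n) \<phi> s - \<phi> s\<bar> \<le> (1/4) ^ n" if "s \<in> {0<..T}" for n s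
    using that by simp
  define G where "G n = grid_integral T (r n) \<phi>" for n
  define D where "D n t \<omega> = G (Suc n) t \<omega> - G n t \<omega>" for n t \<omega>
  have GW: "wiener_integral (\<lambda>s. grid_process T (r n) \<phi> s * indicator {0..t} s) (G n t)" if "0 \<le> t" for n t
    unfolding G_def by (rule wiener_integral_grid[OF T0 that])
  have DM: "sq_martingale (D n)" for n
    unfolding D_def G_def by (intro sq_martingale_diff sq_martingale_grid T0)
  have p16: "(1/16) ^ n = ((1/4 :: real) ^ n)\<^sup>2" for n
    by (simp add: power2_eq_square power_mult_distrib[symmetric])
  have p4: "(1/4) ^ n = ((1/2 :: real) ^ n)\<^sup>2" for n
    by (simp add: power2_eq_square power_mult_distrib[symmetric])
  \<comment> \<open>Here 64 is 16 from \<open>wiener_integral_bound\<close> times the square of the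
    2 in the distance 2 * 4^(-n) of consecutive approximations.\<close>
  have var: "expectation (\<lambda>\<omega>. (D n T \<omega>)\<^sup>2) \<le> 64 * T * (1/16) ^ n" for n
  proof -
    have "sq_norm M (D n T) \<le> 16 * sq_norm lborel (\<lambda>s. grid_process T (r (Suc n)) \<phi> s * indicator {0..T} s
        - grid_process T (r n) \<phi> s * indicator {0..T} s)"
      unfolding D_def by (rule wiener_integral_bound[OF GW GW]) (rule T0)+
    also have "\<dots> \<le> 16 * ennreal ((2 * (1/4) ^ n)\<^sup>2 * T)"
    proof (intro mult_left_mono sq_norm_le_const[OF T0])
      fix s assume s: "s \<in> {0<..T}"
      have "(1/4) ^ Suc n \<le> (1/4 :: real) ^ n" by simp
      then have "\<bar>grid_process T (r (Suc n)) \<phi> s - grid_process T (r n) \<phi> s\<bar> \<le> 2 * (1/4) ^ n"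
        using r[OF s, of n] r[OF s, of "Suc n"] by linarith
      then show "\<bar>grid_process T (r (Suc n)) \<phi> s * indicator {0..T} s
        - grid_process T (r n) \<phi> s * indicator {0..T} s\<bar> \<le> 2 * (1/4) ^ n"
        using s by (simp del: sum.lessThan_Suc)
    qed auto
    also have "\<dots> = ennreal (16 * ((2 * (1/4) ^ n)\<^sup>2 * T))"
      using T by (subst ennreal_mult) auto
    also have "16 * ((2 * (1/4) ^ n)\<^sup>2 * T) = 64 * T * (1/16) ^ n"
      unfolding p16 power_mult_distrib by simp
    finally show ?thesis
      unfolding sq_norm_eq_expectation[OF sq_martingaleD(2)[OF DM T0]]
      using T by (subst (asm) ennreal_le_iff) auto
  qed
  have "\<forall>n. \<exists>A. A \<in> events \<and> ((1/2) ^ n)\<^sup>2 * prob A \<le> expectation (\<lambda>\<omega>. (D n T \<omega>)\<^sup>2) \<and>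
    (\<forall>\<omega>\<in>space M - A. continuous_on {0..T} (\<lambda>t. D n t \<omega>) \<longrightarrow> (\<forall>t\<in>{0..T}. \<bar>D n t \<omega>\<bar> \<le> (1/2) ^ n))"
  proof
    fix n
    have "0 < (1/2 :: real) ^ n" by simp
    then show "\<exists>A. A \<in> events \<and> ((1/2) ^ n)\<^sup>2 * prob A \<le> expectation (\<lambda>\<omega>. (D n T \<omega>)\<^sup>2) \<and>
      (\<forall>\<omega>\<in>space M - A. continuous_on {0..T} (\<lambda>t. D n t \<omega>) \<longrightarrow> (\<forall>t\<in>{0..T}. \<bar>D n t \<omega>\<bar> \<le> (1/2) ^ n))"
      by (rule maximal_inequality[OF DM T])
  qed
  from choice[OF this] obtain A where "\<forall>n. A n \<in> events \<and>
    ((1/2) ^ n)\<^sup>2 * prob (A n) \<le> expectation (\<lambda>\<omega>. (D n T \<omega>)\<^sup>2) \<and>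
    (\<forall>\<omega>\<in>space M - A n. continuous_on {0..T} (\<lambda>t. D n t \<omega>) \<longrightarrow> (\<forall>t\<in>{0..T}. \<bar>D n t \<omega>\<bar> \<le> (1/2) ^ n))" ..
  then have A: "A n \<in> events"
    and pA: "((1/2) ^ n)\<^sup>2 * prob (A n) \<le> expectation (\<lambda>\<omega>. (D n T \<omega>)\<^sup>2)"
    and DA: "\<omega> \<in> space M - A n \<Longrightarrow> continuous_on {0..T} (\<lambda>t. D n t \<omega>) \<Longrightarrow> t \<in> {0..T}
      \<Longrightarrow> \<bar>D n t \<omega>\<bar> \<le> (1/2) ^ n" for n \<omega> t by simp_all
  have "prob (A n) \<le> 64 * T * (1/4) ^ n" for n
  proof -
    have "((1/2) ^ n)\<^sup>2 * prob (A n) \<le> 64 * T * (1/16) ^ n" by (rule order_trans[OF pA var])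
    then have "(1/4) ^ n * prob (A n) \<le> (1/4) ^ n * (64 * T * (1/4) ^ n)"
      unfolding p4[symmetric] p16 by (simp only: power2_eq_square mult_ac)
    then show ?thesis by (rule mult_left_le_imp_le) simp
  qed
  then have "summable (\<lambda>n. prob (A n))"
    by (intro summable_comparison_test'[OF summable_mult[OF summable_geometric[of "1/4::real"], of "64 * T"]]) auto
  then have "AE \<omega> in M. \<forall>\<^sub>F n in sequentially. \<omega> \<in> space M - A n"
    by (intro borel_cantelli_AE1 A) (auto simp: emeasure_eq_measure)
  then have "AE \<omega> in M. (\<forall>\<^sub>F n in sequentially. \<omega> \<in> space M - A n) \<and> continuous_on {0..} (\<lambda>t. B t \<omega>)"
    using B_continuous by eventually_elim simp
  then obtain N where N: "N \<in> null_sets M"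
    and good: "\<And>\<omega>. \<omega> \<in> space M - N \<Longrightarrow> (\<forall>\<^sub>F n in sequentially. \<omega> \<in> space M - A n) \<and>
      continuous_on {0..} (\<lambda>t. B t \<omega>)"
    unfolding eventually_ae_filter by blast
  \<comment> \<open>The value 0 on the exceptional null set makes every path continuous, as
    \<open>ito_integral_process\<close> demands.\<close>
  define J where "J t \<omega> = (if \<omega> \<in> space M - N then lim (\<lambda>n. G n t \<omega>) else 0)" for t \<omega>
  have Gc: "continuous_on {0..T} (\<lambda>t. G n t \<omega>)" if "\<omega> \<in> space M - N" for n \<omega>
    unfolding G_def by (rule grid_integral_continuous[OF conjunct2[OF good[OF that]] T0])
  have unif: "uniform_limit {0..T} (\<lambda>n t. G n t \<omega>) (\<lambda>t. J t \<omega>) sequentially" if \<omega>: "\<omega> \<in> space M - N" for \<omega>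
  proof -
    have "\<forall>\<^sub>F n in sequentially. \<omega> \<in> space M - A n" by (rule conjunct1[OF good[OF \<omega>]])
    \<comment> \<open>The index from which this holds depends on the path, so the eventual form of
      the Weierstrass test is used.\<close>
    then have "\<forall>\<^sub>F n in sequentially. \<forall>t\<in>{0..T}. norm (D n t \<omega>) \<le> (1/2) ^ n"
    proof eventually_elim
      case (elim n)
      have "continuous_on {0..T} (\<lambda>t. D n t \<omega>)"
        unfolding D_def by (intro continuous_on_diff Gc \<omega>)
      then show ?case using DA[OF elim] by simp
    qed
    then have "uniform_limit {0..T} (\<lambda>n t. \<Sum>i<n. D i t \<omega>) (\<lambda>t. \<Sum>i. D i t \<omega>) sequentially"
      by (rule Weierstrass_m_test_ev) (simp add: summable_geometric)
    then have "uniform_limit {0..T} (\<lambda>n t. G 0 t \<omega> + (\<Sum>i<n. D i t \<omega>)) (\<lambda>t. G 0 t \<omega> + (\<Sum>i. D i t \<omega>)) sequentially"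
      by (intro uniform_limit_add uniform_limit_const)
    moreover have "G 0 t \<omega> + (\<Sum>i<n. D i t \<omega>) = G n t \<omega>" for n t
      unfolding D_def by (subst sum_lessThan_telescope) simp
    ultimately have u: "uniform_limit {0..T} (\<lambda>n t. G n t \<omega>) (\<lambda>t. G 0 t \<omega> + (\<Sum>i. D i t \<omega>)) sequentially"
      by simp
    have "G 0 t \<omega> + (\<Sum>i. D i t \<omega>) = J t \<omega>" if "t \<in> {0..T}" for t
      using limI[OF tendsto_uniform_limitI[OF u that]] \<omega> by (simp add: J_def)
    with u show ?thesis by (subst (asm) uniform_limit_cong'[where g = "\<lambda>n t. G n t \<omega>" and i = "\<lambda>t. J t \<omega>"]) auto
  qed
  show ?thesis
  proof (rule that[of J])
    fix \<omega> assume "\<omega> \<in> space M"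
    show "continuous_on {0..T} (\<lambda>t. J t \<omega>)"
    proof (cases "\<omega> \<in> N")
      case False
      with \<open>\<omega> \<in> space M\<close> have \<omega>: "\<omega> \<in> space M - N" by simp
      show ?thesis
        by (rule uniform_limit_theorem[OF _ unif[OF \<omega>]]) (use Gc[OF \<omega>] in auto)
    qed (simp add: J_def)
  next
    fix t assume t: "t \<in> {0..T}"
    then have t0: "0 \<le> t" by simp
    show "wiener_integral (\<lambda>s. \<phi> s * indicator {0..t} s) (J t)"
    \<comment> \<open>The pathwise limit is identified as the integral by the closed graph: the
      cut-off step functions converge uniformly, the integrals almost surely.\<close>
    proof (rule wiener_integral_closed[OF GW[OF t0]])
      have "continuous_on {0..t} \<phi>" by (rule continuous_on_subset[OF cont]) (use t in auto)
      then show "(\<lambda>s. \<phi> s * indicator {0..t} s) \<in> borel_measurable borel" by (rule borel_cut)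
      show "(\<lambda>n. sq_norm lborel (\<lambda>s. grid_process T (r n) \<phi> s * indicator {0..t} s
        - \<phi> s * indicator {0..t} s)) \<longlonglongrightarrow> 0"
      proof (rule sq_norm_tendsto_0_uniform[OF T0])
        fix e :: real assume e: "0 < e"
        have "(\<lambda>n. (1/4 :: real) ^ n) \<longlonglongrightarrow> 0" by (rule LIMSEQ_power_zero) simp
        from order_tendstoD(2)[OF this e]
        show "\<forall>\<^sub>F n in sequentially. \<forall>s\<in>{0<..T}. \<bar>grid_process T (r n) \<phi> s * indicator {0..t} s
          - \<phi> s * indicator {0..t} s\<bar> \<le> e"
        proof eventually_elim
          case (elim n)
          show ?case
          proof
            fix s assume "s \<in> {0<..T}"
            from r[OF this, of n] elim e show "\<bar>grid_process T (r n) \<phi> s * indicator {0..t} s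
              - \<phi> s * indicator {0..t} s\<bar> \<le> e" by (simp add: indicator_def del: sum.lessThan_Suc)
          qed
        qed
      qed (use t in \<open>auto simp: indicator_def\<close>)
      have [measurable]: "space M - N \<in> events" "G n t \<in> borel_measurable M" for n
        using N wiener_integral_measurable(2)[OF GW[OF t0]] by auto
      show "J t \<in> borel_measurable M" unfolding J_def by measurable
      have "AE \<omega> in M. \<omega> \<notin> N" by (rule AE_not_in[OF N])
      with AE_space show "AE \<omega> in M. (\<lambda>n. G n t \<omega>) \<longlonglongrightarrow> J t \<omega>"
        by eventually_elim (rule tendsto_uniform_limitI[OF unif t], simp)
    qed
  next
    fix \<omega>
    have "min (grid T k i) 0 = 0" for k i using grid_nonneg[OF T0, of k i] by simp
    then have "G n 0 \<omega> = 0" for n by (simp add: G_def simple_integral_def del: sum.lessThan_Suc)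
    then show "J 0 \<omega> = 0" by (simp add: J_def)
  qed
qed

end


section \<open>Integration by parts\<close>

lemma integral_sum_grid:
  fixes f :: "real \<Rightarrow> real"
  assumes t: "0 \<le> t" and cont: "continuous_on {0..t} f" and n: "n \<le> Suc k"
  shows "(\<Sum>i<n. integral {grid t k i..grid t k (Suc i)} f) = integral {0..grid t k n} f"
  using n
proof (induction n)
  case (Suc n)
  have "f integrable_on {0..grid t k (Suc n)}"
    by (rule integrable_continuous_real, rule continuous_on_subset[OF cont])
      (use grid_le[OF t Suc.prems] in auto)
  then have "integral {0..grid t k n} f + integral {grid t k n..grid t k (Suc n)} f = integral {0..grid t k (Suc n)} f"
    by (intro Henstock_Kurzweil_Integration.integral_combine grid_nonneg grid_mono t) auto
  with Suc show ?case by simp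
qed simp

text \<open>Summation by parts moves the increments from \<open>f\<close>, a mere continuous path,
  to the differentiable weight; values of \<open>f\<close> at right end points then appear, and the
  resulting sums are Riemann-Stieltjes sums for a continuously differentiable integrator.\<close>

lemma stieltjes_sums_by_parts:
  fixes f \<kappa> \<kappa>' :: "real \<Rightarrow> real"
  assumes t: "0 \<le> t" and f: "continuous_on {0..t} f" and \<kappa>': "continuous_on {0..t} \<kappa>'"
    and der: "\<And>s. s \<in> {0..t} \<Longrightarrow> (\<kappa> has_real_derivative \<kappa>' s) (at s within {0..t})"
  shows "(\<lambda>k. \<Sum>i<Suc k. \<kappa> (grid t k i) * (f (grid t k (Suc i)) - f (grid t k i)))
    \<longlonglongrightarrow> \<kappa> t * f t - \<kappa> 0 * f 0 - integral {0..t} (\<lambda>s. \<kappa>' s * f s)"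
proof -
  have "bounded (\<kappa>' ` {0..t})"
    by (rule compact_imp_bounded[OF compact_continuous_image[OF \<kappa>']]) simp
  then obtain C where C: "0 < C" "\<And>s. s \<in> {0..t} \<Longrightarrow> \<bar>\<kappa>' s\<bar> \<le> C"
    unfolding bounded_pos by auto
  let ?p = "grid t"
  have prod: "continuous_on {0..t} (\<lambda>s. \<kappa>' s * f s)" by (intro continuous_on_mult f \<kappa>')
  have err: "\<bar>(\<Sum>i<Suc k. f (?p k (Suc i)) * (\<kappa> (?p k (Suc i)) - \<kappa> (?p k i)))
      - integral {0..t} (\<lambda>s. \<kappa>' s * f s)\<bar> \<le> C * e * t"
    if osc: "\<forall>i<Suc k. \<forall>x\<in>{?p k i..?p k (Suc i)}. \<forall>y\<in>{?p k i..?p k (Suc i)}. \<bar>f x - f y\<bar> \<le> e" for k e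
  proof -
    have piece: "\<bar>f (?p k (Suc i)) * (\<kappa> (?p k (Suc i)) - \<kappa> (?p k i))
        - integral {?p k i..?p k (Suc i)} (\<lambda>s. \<kappa>' s * f s)\<bar> \<le> C * e * (?p k (Suc i) - ?p k i)"
      if i: "i < Suc k" for i
    proof -
      let ?I = "{?p k i..?p k (Suc i)}" and ?v = "f (?p k (Suc i))"
      have le: "?p k i \<le> ?p k (Suc i)" by (rule grid_mono[OF t]) simp
      have sub: "?I \<subseteq> {0..t}" using grid_nonneg[OF t, of k i] grid_le[OF t, of "Suc i" k] i by auto
      have "(\<kappa>' has_integral (\<kappa> (?p k (Suc i)) - \<kappa> (?p k i))) ?I"
        by (intro fundamental_theorem_of_calculus[OF le]
          has_real_derivative_iff_has_vector_derivative[THEN iffD1] DERIV_subset[OF der sub] subsetD[OF sub])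
      then have h1: "((\<lambda>s. ?v * \<kappa>' s) has_integral ?v * (\<kappa> (?p k (Suc i)) - \<kappa> (?p k i))) ?I"
        by (rule has_integral_mult_right)
      have h2: "((\<lambda>s. \<kappa>' s * f s) has_integral integral ?I (\<lambda>s. \<kappa>' s * f s)) ?I"
        by (rule integrable_integral, rule integrable_continuous_real, rule continuous_on_subset[OF prod sub])
      \<comment> \<open>On one cell the error is the integral of \<kappa>' times the deviation of
        \<open>f\<close> from its right end value, hence at most \<open>C * e\<close> times the
        length.\<close>
      have eq: "integral ?I (\<lambda>s. ?v * \<kappa>' s - \<kappa>' s * f s) =
          ?v * (\<kappa> (?p k (Suc i)) - \<kappa> (?p k i)) - integral ?I (\<lambda>s. \<kappa>' s * f s)"
        by (rule integral_unique[OF has_integral_diff[OF h1 h2]])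
      have "norm (integral ?I (\<lambda>s. ?v * \<kappa>' s - \<kappa>' s * f s)) \<le> (C * e) * (?p k (Suc i) - ?p k i)"
      proof (rule integral_bound[OF le])
        show "continuous_on ?I (\<lambda>s. ?v * \<kappa>' s - \<kappa>' s * f s)"
          by (intro continuous_intros continuous_on_subset[OF \<kappa>' sub] continuous_on_subset[OF prod sub])
        fix s assume s: "s \<in> ?I"
        have "?v * \<kappa>' s - \<kappa>' s * f s = \<kappa>' s * (?v - f s)" by (simp add: algebra_simps)
        moreover have "\<bar>?v - f s\<bar> \<le> e" using osc i s le by simp
        moreover have "\<bar>\<kappa>' s\<bar> \<le> C" using C(2) s sub by blast
        ultimately show "norm (?v * \<kappa>' s - \<kappa>' s * f s) \<le> C * e"
          using C(1) by (auto simp: abs_mult intro!: mult_mono)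
      qed
      then show ?thesis unfolding eq by simp
    qed
    have "(\<Sum>i<Suc k. integral {?p k i..?p k (Suc i)} (\<lambda>s. \<kappa>' s * f s)) = integral {0..t} (\<lambda>s. \<kappa>' s * f s)"
      using integral_sum_grid[OF t prod, of "Suc k" k] unfolding grid_last by simp
    then have "\<bar>(\<Sum>i<Suc k. f (?p k (Suc i)) * (\<kappa> (?p k (Suc i)) - \<kappa> (?p k i)))
        - integral {0..t} (\<lambda>s. \<kappa>' s * f s)\<bar> =
      \<bar>\<Sum>i<Suc k. f (?p k (Suc i)) * (\<kappa> (?p k (Suc i)) - \<kappa> (?p k i))
        - integral {?p k i..?p k (Suc i)} (\<lambda>s. \<kappa>' s * f s)\<bar>"
      unfolding sum_subtractf by (simp only:)
    also have "\<dots> \<le> (\<Sum>i<Suc k. C * e * (?p k (Suc i) - ?p k i))"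
      by (rule order_trans[OF sum_abs sum_mono]) (use piece in auto)
    also have "\<dots> = C * e * t"
      unfolding sum_distrib_left[symmetric] sum_lessThan_telescope by simp
    finally show ?thesis .
  qed
  have lim: "(\<lambda>k. \<Sum>i<Suc k. f (?p k (Suc i)) * (\<kappa> (?p k (Suc i)) - \<kappa> (?p k i)))
    \<longlonglongrightarrow> integral {0..t} (\<lambda>s. \<kappa>' s * f s)"
  proof (rule tendstoI)
    fix e :: real assume e: "0 < e"
    \<comment> \<open>The summand 1 makes the final estimate strict and covers t = 0.\<close>
    define d where "d = e / (C * (t + 1))"
    have "C \<noteq> 0" "t + 1 \<noteq> 0" "0 < C * (t + 1)" using C t by simp_all
    then have d: "0 < d" "C * d * (t + 1) = e" using e by (simp_all add: d_def)
    have "C * d * t < e" using d(2) mult_pos_pos[OF C(1) d(1)] by (simp add: distrib_left)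
    show "\<forall>\<^sub>F k in sequentially. dist (\<Sum>i<Suc k. f (?p k (Suc i)) * (\<kappa> (?p k (Suc i)) - \<kappa> (?p k i)))
      (integral {0..t} (\<lambda>s. \<kappa>' s * f s)) < e"
      using grid_oscillation[OF t f d(1)]
    proof eventually_elim
      case (elim k)
      show ?case unfolding dist_real_def by (rule le_less_trans[OF err[OF elim]]) fact
    qed
  qed
  have "(\<Sum>i<Suc k. \<kappa> (?p k i) * (f (?p k (Suc i)) - f (?p k i))) =
    \<kappa> t * f t - \<kappa> 0 * f 0 - (\<Sum>i<Suc k. f (?p k (Suc i)) * (\<kappa> (?p k (Suc i)) - \<kappa> (?p k i)))" for k
  proof -
    have "(\<Sum>i<Suc k. \<kappa> (?p k i) * (f (?p k (Suc i)) - f (?p k i))) =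
      (\<Sum>i<Suc k. (\<kappa> (?p k (Suc i)) * f (?p k (Suc i)) - \<kappa> (?p k i) * f (?p k i))
        - f (?p k (Suc i)) * (\<kappa> (?p k (Suc i)) - \<kappa> (?p k i)))"
      by (rule sum.cong) (simp_all add: algebra_simps)
    also have "\<dots> = (\<kappa> (?p k (Suc k)) * f (?p k (Suc k)) - \<kappa> (?p k 0) * f (?p k 0))
        - (\<Sum>i<Suc k. f (?p k (Suc i)) * (\<kappa> (?p k (Suc i)) - \<kappa> (?p k i)))"
      unfolding sum_subtractf[of _ _ "{..<Suc k}"] 
      using sum_lessThan_telescope[of "\<lambda>i. \<kappa> (?p k i) * f (?p k i)" "Suc k"]
      by (simp only: sum_subtractf)
    finally show ?thesis by (simp only: grid_0 grid_last)
  qed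
  then show ?thesis using tendsto_diff[OF tendsto_const lim, of "\<kappa> t * f t - \<kappa> 0 * f 0"] by presburger
qed

context brownian_setup
begin

text \<open>The weighted increments of \<open>J\<close> are seen in two ways. As integrals, their
  integrands tend to the product of \<kappa> and \<phi>; as sums along a path, they tend to the
  right-hand side. The closed graph joins the two limits.\<close>

theorem wiener_integral_by_parts:
  assumes t: "0 \<le> t" and \<phi>: "continuous_on {0..t} \<phi>" and \<kappa>': "continuous_on {0..t} \<kappa>'"
    and der: "\<And>s. s \<in> {0..t} \<Longrightarrow> (\<kappa> has_real_derivative \<kappa>' s) (at s within {0..t})"
    and J: "\<And>s. s \<in> {0..t} \<Longrightarrow> wiener_integral (\<lambda>u. \<phi> u * indicator {0..s} u) (J s)"
    and Jc: "\<And>\<omega>. \<omega> \<in> space M \<Longrightarrow> continuous_on {0..t} (\<lambda>s. J s \<omega>)"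
    and J0: "\<And>\<omega>. \<omega> \<in> space M \<Longrightarrow> J 0 \<omega> = 0"
  shows "wiener_integral (\<lambda>s. \<kappa> s * \<phi> s * indicator {0..t} s)
    (\<lambda>\<omega>. \<kappa> t * J t \<omega> - integral {0..t} (\<lambda>s. \<kappa>' s * J s \<omega>))"
proof -
  let ?p = "grid t"
  have \<kappa>: "continuous_on {0..t} \<kappa>" by (rule DERIV_continuous_on[OF der])
  \<comment> \<open>A difference of two cut-offs restricts \<phi> to one cell, so linearity of the
    graph gives \<open>W\<close>; only \<kappa> is discretised, \<phi> is kept exactly.\<close>
  define \<psi> where "\<psi> k s = (\<Sum>i<Suc k. \<kappa> (?p k i) * (\<phi> s * indicator {0..?p k (Suc i)} s - \<phi> s * indicator {0..?p k i} s))"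
    for k s
  define Y where "Y k \<omega> = (\<Sum>i<Suc k. \<kappa> (?p k i) * (J (?p k (Suc i)) \<omega> - J (?p k i) \<omega>))" for k \<omega>
  have W: "wiener_integral (\<psi> k) (Y k)" for k
    unfolding \<psi>_def Y_def
    by (intro wiener_integral_sum wiener_integral_cmult wiener_integral_diff J)
      (use grid_nonneg[OF t] grid_le[OF t] in auto)
  have \<psi>: "\<psi> k s = \<phi> s * grid_process t k \<kappa> s" for k s
    unfolding \<psi>_def sum_distrib_left
  proof (rule sum.cong)
    fix i
    have "?p k i \<le> ?p k (Suc i)" by (rule grid_mono[OF t]) simp
    then have "(indicator {0..?p k (Suc i)} s - indicator {0..?p k i} s :: real) = indicator {?p k i<..?p k (Suc i)} s"
      using grid_nonneg[OF t, of k i] by (auto simp: indicator_def)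
    then show "\<kappa> (?p k i) * (\<phi> s * indicator {0..?p k (Suc i)} s - \<phi> s * indicator {0..?p k i} s) =
      \<phi> s * (\<kappa> (?p k i) * indicator {?p k i<..?p k (Suc i)} s)"
      by (simp only: right_diff_distrib[symmetric] mult.left_commute)
  qed simp
  have "bounded (\<phi> ` {0..t})"
    by (rule compact_imp_bounded[OF compact_continuous_image[OF \<phi>]]) simp
  then obtain C where C: "0 < C" "\<And>s. s \<in> {0..t} \<Longrightarrow> \<bar>\<phi> s\<bar> \<le> C"
    unfolding bounded_pos by auto
  have Ylim: "(\<lambda>k. Y k \<omega>) \<longlonglongrightarrow> \<kappa> t * J t \<omega> - integral {0..t} (\<lambda>s. \<kappa>' s * J s \<omega>)"
    if "\<omega> \<in> space M" for \<omega>
    using stieltjes_sums_by_parts[OF t Jc[OF that] \<kappa>' der] J0[OF that] unfolding Y_def by simp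
  show ?thesis
  proof (rule wiener_integral_closed[OF W])
    show "(\<lambda>s. \<kappa> s * \<phi> s * indicator {0..t} s) \<in> borel_measurable borel"
      by (intro borel_cut continuous_on_mult \<kappa> \<phi>)
    show "(\<lambda>k. sq_norm lborel (\<lambda>s. \<psi> k s - \<kappa> s * \<phi> s * indicator {0..t} s)) \<longlonglongrightarrow> 0"
    proof (rule sq_norm_tendsto_0_uniform[OF t])
      fix k s assume s: "s \<notin> {0..t}"
      have "indicator {?p k i<..?p k (Suc i)} s = (0::real)" if "i < Suc k" for i
        using s grid_nonneg[OF t, of k i] grid_le[OF t, of "Suc i" k] that by (auto simp: indicator_def)
      then have "grid_process t k \<kappa> s = 0" by (intro sum.neutral) auto
      then show "\<psi> k s - \<kappa> s * \<phi> s * indicator {0..t} s = 0" using s by (simp add: \<psi> del: sum.lessThan_Suc)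
    next
      fix e :: real assume "0 < e"
      then have "0 < e / C" using C by simp
      from grid_process_approx[OF t \<kappa> this]
      show "\<forall>\<^sub>F k in sequentially. \<forall>s\<in>{0<..t}. \<bar>\<psi> k s - \<kappa> s * \<phi> s * indicator {0..t} s\<bar> \<le> e"
      proof eventually_elim
        case (elim k)
        show ?case
        proof
          fix s assume s: "s \<in> {0<..t}"
          have "\<psi> k s - \<kappa> s * \<phi> s * indicator {0..t} s = \<phi> s * (grid_process t k \<kappa> s - \<kappa> s)"
            using s by (simp add: \<psi> right_diff_distrib del: sum.lessThan_Suc)
          moreover have "\<bar>\<phi> s\<bar> * \<bar>grid_process t k \<kappa> s - \<kappa> s\<bar> \<le> C * (e / C)"
            by (rule mult_mono) (use C elim s in auto)
          ultimately show "\<bar>\<psi> k s - \<kappa> s * \<phi> s * indicator {0..t} s\<bar> \<le> e"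
            using C(1) by (simp only: abs_mult nonzero_mult_div_cancel_left times_divide_eq_right)
        qed
      qed
    qed
    show "(\<lambda>\<omega>. \<kappa> t * J t \<omega> - integral {0..t} (\<lambda>s. \<kappa>' s * J s \<omega>)) \<in> borel_measurable M"
      by (rule borel_measurable_LIMSEQ_real[OF Ylim wiener_integral_measurable(2)[OF W]])
    show "AE \<omega> in M. (\<lambda>k. Y k \<omega>) \<longlonglongrightarrow> \<kappa> t * J t \<omega> - integral {0..t} (\<lambda>s. \<kappa>' s * J s \<omega>)"
      by (rule AE_I2[OF Ylim])
  qed
qed

end


section \<open>The deterministic linear equation\<close>

text \<open>With \<open>A t = \<integral>\<^sub>0\<^sup>t e\<^bsup>-2q\<^esup> \<sigma>\<^sup>2\<close>, where \<open>q\<close> stands for the integrated drift, the covariance factorises as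
  \<open>\<gamma>(s, t) = e\<^bsup>2q(t)\<^esup> (A t - A s)\<close>. The function \<open>scale\<close> solves the homogeneous bridge equation.\<close>

locale bridge_coefficients =
  fixes q \<sigma> r :: "real \<Rightarrow> real" and T b :: real
  assumes q: "continuous_on {0..} q" and \<sigma>: "continuous_on {0..} \<sigma>" and r: "continuous_on {0..} r"
    and T: "0 < T" and \<sigma>_nz: "\<And>t. 0 \<le> t \<Longrightarrow> \<sigma> t \<noteq> 0"
begin

abbreviation "Q \<equiv> qbar q"

definition A' :: "real \<Rightarrow> real" where "A' t = exp (- 2 * Q t) * (\<sigma> t)\<^sup>2"
definition A :: "real \<Rightarrow> real" where "A t = integral {0..t} A'"
definition R' :: "real \<Rightarrow> real" where "R' t = exp (- Q t) * r t"
definition R :: "real \<Rightarrow> real" where "R t = integral {0..t} R'"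
text \<open>The end value in the coordinate e^(-Q(t)) x - R(t), in which the drift of the
  unconditioned equation disappears: x = b at time \<open>T\<close> corresponds to
  \<open>K\<close>.\<close>

definition K :: real where "K = b * exp (- Q T) - R T"
definition scale :: "real \<Rightarrow> real" where "scale t = exp (Q t) * (A T - A t)"
text \<open>The logarithmic derivative of \<open>scale\<close>, and also the coefficient of x in the
  bridge drift.\<close>

definition rate :: "real \<Rightarrow> real" where "rate t = q t - A' t / (A T - A t)"
text \<open>In the coordinate e^(-Q(t)) x - R(t) this is linear interpolation from \<open>a\<close>
  to \<open>K\<close>, with \<open>A\<close> as clock.\<close>

definition mean :: "real \<Rightarrow> real \<Rightarrow> real" where
  "mean a t = exp (Q t) * (R t + A t / A T * K + (1 - A t / A T) * a)"

lemma Q_deriv: "0 \<le> s \<Longrightarrow> s \<le> t \<Longrightarrow> (Q has_real_derivative q s) (at s within {0..t})"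
  unfolding qbar_def[abs_def]
  by (rule integral_has_real_derivative, rule continuous_on_subset[OF q]) auto

lemma Q_continuous: "continuous_on {0..t} Q"
  by (rule DERIV_continuous_on[OF Q_deriv]) auto

lemma A'_continuous: "continuous_on {0..t} A'"
  unfolding A'_def[abs_def]
  by (intro continuous_intros Q_continuous continuous_on_subset[OF \<sigma>]) auto

lemma R'_continuous: "continuous_on {0..t} R'"
  unfolding R'_def[abs_def]
  by (intro continuous_intros Q_continuous continuous_on_subset[OF r]) auto

lemma A_deriv: "0 \<le> s \<Longrightarrow> s \<le> t \<Longrightarrow> (A has_real_derivative A' s) (at s within {0..t})"
  unfolding A_def[abs_def] by (rule integral_has_real_derivative[OF A'_continuous]) auto

lemma R_deriv: "0 \<le> s \<Longrightarrow> s \<le> t \<Longrightarrow> (R has_real_derivative R' s) (at s within {0..t})"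
  unfolding R_def[abs_def] by (rule integral_has_real_derivative[OF R'_continuous]) auto

lemma A_continuous: "continuous_on {0..t} A"
  by (rule DERIV_continuous_on[OF A_deriv]) auto

lemma at_0 [simp]: "Q 0 = 0" "A 0 = 0" "R 0 = 0"
  by (simp_all add: qbar_def A_def R_def)

lemma integral_A': "0 \<le> s \<Longrightarrow> s \<le> t \<Longrightarrow> integral {s..t} A' = A t - A s"
  unfolding A_def
  using Henstock_Kurzweil_Integration.integral_combine[of 0 s t A']
    integrable_continuous_real[OF A'_continuous[of t]] by simp

lemma integral_R': "0 \<le> s \<Longrightarrow> s \<le> t \<Longrightarrow> integral {s..t} R' = R t - R s"
  unfolding R_def
  using Henstock_Kurzweil_Integration.integral_combine[of 0 s t R']
    integrable_continuous_real[OF R'_continuous[of t]] by simp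

lemma gam_eq: "0 \<le> s \<Longrightarrow> s \<le> t \<Longrightarrow> gam q \<sigma> s t = exp (2 * Q t) * (A t - A s)"
proof -
  assume st: "0 \<le> s" "s \<le> t"
  have "(\<lambda>u. exp (2 * (Q t - Q u)) * (\<sigma> u)\<^sup>2) = (\<lambda>u. exp (2 * Q t) * A' u)"
    by (simp add: A'_def fun_eq_iff right_diff_distrib exp_diff exp_minus field_simps)
  then show ?thesis unfolding gam_def using integral_A'[OF st] by simp
qed

lemma integral_r: "0 \<le> s \<Longrightarrow> s \<le> t \<Longrightarrow> integral {s..t} (\<lambda>u. exp (Q t - Q u) * r u) = exp (Q t) * (R t - R s)"
proof -
  assume st: "0 \<le> s" "s \<le> t"
  have "(\<lambda>u. exp (Q t - Q u) * r u) = (\<lambda>u. exp (Q t) * R' u)"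
    by (simp add: R'_def fun_eq_iff exp_diff exp_minus field_simps)
  then show ?thesis using integral_R'[OF st] by simp
qed

text \<open>Since \<sigma> does not vanish, \<open>A'\<close> has a positive minimum on the compact
  interval. This keeps all denominators \<open>A T - A t\<close> positive before
  \<open>T\<close>.\<close>

lemma A_less: "0 \<le> s \<Longrightarrow> s < t \<Longrightarrow> A s < A t"
proof -
  assume st: "0 \<le> s" "s < t"
  have "\<exists>x\<in>{s..t}. \<forall>y\<in>{s..t}. A' x \<le> A' y"
    using st by (intro continuous_attains_inf continuous_on_subset[OF A'_continuous[of t]]) auto
  then obtain x where x: "x \<in> {s..t}" "\<And>y. y \<in> {s..t} \<Longrightarrow> A' x \<le> A' y" by blast
  have "0 < A' x" using \<sigma>_nz[of x] x(1) st by (simp add: A'_def)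
  then have "0 < A' x * (t - s)" using st by simp
  also have "\<dots> = integral {s..t} (\<lambda>_. A' x)" using st by simp
  also have "\<dots> \<le> integral {s..t} A'"
    by (rule integral_le)
      (use st x(2) in \<open>auto intro!: integrable_continuous_real continuous_on_subset[OF A'_continuous[of t]]\<close>)
  also have "\<dots> = A t - A s" using integral_A'[of s t] st by simp
  finally show ?thesis by simp
qed

section \<open>Kernel, mean and drift of the bridge in terms of A, R and scale\<close>

lemma A_T_pos: "0 < A T"
  using A_less[of 0 T] T by simp

lemma scale_pos: "0 \<le> t \<Longrightarrow> t < T \<Longrightarrow> 0 < scale t"
  using A_less[of t T] by (simp add: scale_def)

text \<open>The factors e^(2 Q(T)) of the two covariances cancel, and the dependence on the upper
  limit separates. The grouping on the right lets \<open>scale t\<close> be taken out of the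
  integral as a constant.\<close>

lemma kernel_eq:
  assumes "0 \<le> s" "s \<le> t" "t < T"
  shows "gam q \<sigma> t T / gam q \<sigma> s T * exp (Q t - Q s) * x = scale t * (1 / scale s * x)"
  using assms A_less[of s T] by (simp add: gam_eq scale_def exp_diff field_simps)

lemma bridge_mean_eq:
  assumes "0 \<le> t" "t < T"
  shows "bridge_mean q \<sigma> r T a b 0 t = mean a t"
proof -
  have e: "exp (2 * Q t) = exp (Q t) * exp (Q t)" "exp (2 * Q T) = exp (Q T) * exp (Q T)"
    by (simp_all add: exp_add[symmetric])
  show ?thesis
    unfolding bridge_mean_def flow_mean_def mean_def K_def
    using assms A_T_pos integral_r[of t T] integral_r[of 0 t]
    by (simp add: gam_eq e exp_diff exp_minus) (simp add: field_simps)
qed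

lemma bridge_drift_eq:
  assumes "0 \<le> t" "t < T"
  shows "bridge_drift q \<sigma> r T b t x = rate t * x + (r t + exp (Q t) * A' t / (A T - A t) * (K + R t))"
proof -
  have D: "A T - A t \<noteq> 0" using A_less[of t T] assms by simp
  \<comment> \<open>With \<open>X\<close> and \<open>Y\<close> for the exponentials at
    \<open>t\<close> and \<open>T\<close>, what remains is an identity of rational
    functions.\<close>
  have alg: "(v - (Y / X)\<^sup>2 / (Y\<^sup>2 * D) * S) * x + (w + Y / X / (Y\<^sup>2 * D) * (b - Y * (u - p)) * S) =
    (v - (1 / X\<^sup>2 * S) / D) * x + (w + X * (1 / X\<^sup>2 * S) / D * (b * (1 / Y) - u + p))"
    if "X \<noteq> 0" "Y \<noteq> 0" "D \<noteq> 0" for X Y D S v w u p :: real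
    using that by (simp add: field_simps power2_eq_square)
  have e: "exp (2 * (Q T - Q t)) = (exp (Q T) / exp (Q t))\<^sup>2" "exp (2 * Q T) = (exp (Q T))\<^sup>2"
    "exp (- 2 * Q t) = 1 / (exp (Q t))\<^sup>2" "exp (- Q T) = 1 / exp (Q T)" "exp (Q T - Q t) = exp (Q T) / exp (Q t)"
    by (simp_all add: exp_diff exp_minus exp_double power_divide inverse_eq_divide)
  have g: "gam q \<sigma> t T = exp (2 * Q T) * (A T - A t)" using assms by (simp add: gam_eq)
  have i: "integral {t..T} (\<lambda>u. exp (Q T - Q u) * r u) = exp (Q T) * (R T - R t)"
    using assms by (simp add: integral_r)
  show ?thesis
    unfolding bridge_drift_def rate_def A'_def K_def i g unfolding e by (rule alg[OF _ _ D]) simp_all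
qed

lemma mean_0: "mean a 0 = a"
  by (simp add: mean_def)

text \<open>The derivative is the right-hand side of \<open>bridge_drift_eq\<close> at x =
  \<open>mean a s\<close>: the mean solves the bridge equation without noise.\<close>

lemma mean_deriv:
  assumes "0 \<le> s" "s \<le> t" "t < T"
  shows "(mean a has_real_derivative rate s * mean a s + (r s + exp (Q s) * A' s / (A T - A s) * (K + R s)))
    (at s within {0..t})"
proof -
  have nz: "A T - A s \<noteq> 0" using A_less[of s T] assms by simp
  have "(mean a has_real_derivative
      exp (Q s) * q s * (R s + A s / A T * K + (1 - A s / A T) * a)
      + exp (Q s) * (R' s + A' s / A T * K - A' s / A T * a)) (at s within {0..t})"
    unfolding mean_def[abs_def] using A_T_pos
    by (auto intro!: derivative_eq_intros Q_deriv A_deriv R_deriv assms simp: field_simps)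
  moreover have "exp (Q s) * R' s = r s" by (simp add: R'_def exp_minus)
  then have *: "exp (Q s) * (R' s + A' s / A T * K - A' s / A T * a) =
      r s + exp (Q s) * A' s / A T * (K - a)"
    by (simp add: algebra_simps diff_divide_distrib)
  have "exp (Q s) * q s * (R s + A s / A T * K + (1 - A s / A T) * a)
      + exp (Q s) * (R' s + A' s / A T * K - A' s / A T * a) =
    rate s * mean a s + (r s + exp (Q s) * A' s / (A T - A s) * (K + R s))"
  proof -
    \<comment> \<open>Here \<open>D\<close> stands for \<open>A T - A s\<close> and \<open>L\<close>
      for \<open>A T\<close>; writing \<open>A s / A T\<close> as 1 - D/L leaves \<open>D\<close> as
      the only trace of \<open>A s\<close>.\<close>
    have alg: "X * v * (p + (1 - D / L) * K + (1 - (1 - D / L)) * a) + (w + X * y / L * (K - a)) =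
      (v - y / D) * (X * (p + (1 - D / L) * K + (1 - (1 - D / L)) * a)) + (w + X * y / D * (K + p))"
      if "D \<noteq> 0" "L \<noteq> 0" for X v p D L w y :: real
      using that by (simp add: field_simps)
    have "A s / A T = 1 - (A T - A s) / A T" using A_T_pos by (simp add: field_simps)
    with * show ?thesis unfolding rate_def mean_def using alg[OF nz, of "A T"] A_T_pos by simp
  qed
  ultimately show ?thesis by simp
qed

lemma scale_deriv:
  assumes "0 \<le> s" "s \<le> t" "t < T"
  shows "(scale has_real_derivative rate s * scale s) (at s within {0..t})"
proof -
  have nz: "A T - A s \<noteq> 0" using A_less[of s T] assms by simp
  have "(scale has_real_derivative exp (Q s) * q s * (A T - A s) + exp (Q s) * (- A' s)) (at s within {0..t})"
    unfolding scale_def[abs_def]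
    by (auto intro!: derivative_eq_intros Q_deriv A_deriv assms)
  moreover have "exp (Q s) * q s * (A T - A s) + exp (Q s) * (- A' s) = rate s * scale s"
    unfolding rate_def scale_def using nz by (simp add: field_simps)
  ultimately show ?thesis by simp
qed

lemma inverse_scale_deriv:
  assumes "0 \<le> s" "s \<le> t" "t < T"
  shows "((\<lambda>s. 1 / scale s) has_real_derivative - rate s / scale s) (at s within {0..t})"
  using scale_pos[of s] assms
  by (auto intro!: derivative_eq_intros scale_deriv simp: field_simps)

lemma rate_continuous: "t < T \<Longrightarrow> continuous_on {0..t} rate"
  unfolding rate_def[abs_def]
  by (intro continuous_intros A'_continuous A_continuous continuous_on_subset[OF q])
    (use A_less[of _ T] in force)+

lemma scale_continuous: "t < T \<Longrightarrow> continuous_on {0..t} scale"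
  by (rule DERIV_continuous_on[OF scale_deriv]) auto

lemma inverse_scale'_continuous: "t < T \<Longrightarrow> continuous_on {0..t} (\<lambda>s. - rate s / scale s)"
  by (intro continuous_intros rate_continuous scale_continuous) (use scale_pos in force)+

lemma drift_continuous:
  assumes "t < T" "continuous_on {0..t} x"
  shows "continuous_on {0..t} (\<lambda>s. bridge_drift q \<sigma> r T b s (x s))"
proof -
  have "continuous_on {0..t} (\<lambda>s. rate s * x s + (r s + exp (Q s) * A' s / (A T - A s) * (K + R s)))"
    using assms A_less[of _ T]
    by (intro continuous_intros rate_continuous A'_continuous A_continuous Q_continuous
        continuous_on_subset[OF r] DERIV_continuous_on[OF R_deriv]) force+
  then show ?thesis
    by (rule continuous_on_eq) (use assms in \<open>auto simp: bridge_drift_eq\<close>)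
qed

text \<open>The Stieltjes integral of 1/\<open>scale\<close> against f, for f vanishing at 0, after
  integration by parts; so it makes sense for every continuous path.\<close>

definition forced :: "(real \<Rightarrow> real) \<Rightarrow> real \<Rightarrow> real" where
  "forced f t = 1 / scale t * f t - integral {0..t} (\<lambda>s. - rate s / scale s * f s)"

text \<open>The path f need not be differentiable, but in u - f it survives only under an integral:
  \<open>scale\<close> times \<open>forced f\<close> is f minus \<open>scale\<close> times
  \<open>P\<close>. So \<open>V\<close> = u - f can be differentiated and its derivative integrated
  back.\<close>

lemma variation_of_constants:
  assumes f: "continuous_on {0..<T} f" "f 0 = 0" and t: "t \<in> {0..<T}"
    and u: "\<And>s. s \<in> {0..<T} \<Longrightarrow> u s = mean a s + scale s * forced f s"
  shows "u t = a + integral {0..t} (\<lambda>s. bridge_drift q \<sigma> r T b s (u s)) + f t"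
proof -
  let ?k = "\<lambda>s. - rate s / scale s"
  define P where "P s = integral {0..s} (\<lambda>s. ?k s * f s)" for s
  define V where "V s = mean a s - scale s * P s" for s
  have t0: "0 \<le> t" "t < T" using t by auto
  have kf: "continuous_on {0..t} (\<lambda>s. ?k s * f s)"
    by (intro continuous_on_mult inverse_scale'_continuous t0 continuous_on_subset[OF f(1)]) (use t in auto)
  have uV: "u s = V s + f s" if "s \<in> {0..t}" for s
  proof -
    have "forced f s = 1 / scale s * f s - P s" by (simp only: forced_def P_def)
    then show ?thesis using u[of s] scale_pos[of s] that t0 by (simp add: V_def right_diff_distrib)
  qed
  have "((\<lambda>s. bridge_drift q \<sigma> r T b s (u s)) has_integral V t - V 0) {0..t}"
  proof (rule fundamental_theorem_of_calculus[OF t0(1)])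
    fix s assume s: "s \<in> {0..t}"
    then have s': "0 \<le> s" "s \<le> t" "s < T" using t0 by auto
    have P': "(P has_real_derivative ?k s * f s) (at s within {0..t})"
      unfolding P_def[abs_def] by (rule integral_has_real_derivative[OF kf s])
    have "(V has_real_derivative rate s * mean a s + (r s + exp (Q s) * A' s / (A T - A s) * (K + R s))
       - (rate s * scale s * P s + (?k s * f s) * scale s)) (at s within {0..t})"
      unfolding V_def[abs_def]
      by (intro DERIV_diff DERIV_mult mean_deriv scale_deriv s' t0 P')
    \<comment> \<open>The derivative of \<open>P\<close> contributes \<open>rate s * f s\<close>,
      just what changes \<open>rate\<close> times \<open>V\<close> into \<open>rate\<close> times
      \<open>u\<close>.\<close>
    moreover have "rate s * mean a s + (r s + exp (Q s) * A' s / (A T - A s) * (K + R s))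
       - (rate s * scale s * P s + (?k s * f s) * scale s) = bridge_drift q \<sigma> r T b s (u s)"
      using scale_pos[OF s'(1,3)] unfolding bridge_drift_eq[OF s'(1,3)] uV[OF s] V_def
      by (simp add: algebra_simps)
    ultimately show "(V has_vector_derivative bridge_drift q \<sigma> r T b s (u s)) (at s within {0..t})"
      by (simp add: has_real_derivative_iff_has_vector_derivative)
  qed
  moreover have "V 0 = a" by (simp add: V_def P_def mean_0)
  ultimately show ?thesis using uV[of t] t0 by (simp add: integral_unique)
qed

text \<open>The integral equation itself makes the continuous function \<open>D\<close>
  differentiable; multiplication by the reciprocal of \<open>scale\<close> then leaves a constant,
  which vanishes at 0.\<close>

lemma homogeneous_unique:
  assumes D: "continuous_on {0..<T} D"
    and eq: "\<And>t. t \<in> {0..<T} \<Longrightarrow> D t = integral {0..t} (\<lambda>s. rate s * D s)" and t: "t \<in> {0..<T}"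
  shows "D t = 0"
proof -
  have t0: "0 \<le> t" "t < T" using t by auto
  have "\<exists>c. \<forall>s\<in>{0..t}. 1 / scale s * D s = c"
  proof (rule has_field_derivative_zero_constant)
    fix s assume s: "s \<in> {0..t}"
    then have s': "0 \<le> s" "s \<le> t" "s < T" using t0 by auto
    have "continuous_on {0..t} (\<lambda>s. rate s * D s)"
      by (intro continuous_on_mult rate_continuous t0 continuous_on_subset[OF D]) (use t in auto)
    then have "((\<lambda>t. integral {0..t} (\<lambda>s. rate s * D s)) has_real_derivative rate s * D s) (at s within {0..t})"
      by (rule integral_has_real_derivative[OF _ s])
    then have "(D has_real_derivative rate s * D s) (at s within {0..t})"
      by (rule has_field_derivative_transform_within[OF _ zero_less_one s]) (use eq t0 in auto)
    from DERIV_mult[OF inverse_scale_deriv[OF s'(1,2) t0(2)] this]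
    show "((\<lambda>s. 1 / scale s * D s) has_field_derivative 0) (at s within {0..t})"
      by (simp add: algebra_simps)
  qed simp
  then obtain c where c: "\<And>s. s \<in> {0..t} \<Longrightarrow> 1 / scale s * D s = c" by blast
  have "D 0 = 0" using eq[of 0] T by simp
  then have "c = 0" using c[of 0] t0 by simp
  then show ?thesis using c[of t] t0 scale_pos[of t] by simp
qed

end


section \<open>The bridge\<close>

text \<open>Continuity is local, and the midpoint of x and \<open>T\<close> bounds a neighbourhood
  of x that stays away from the singularity at \<open>T\<close>.\<close>

lemma continuous_on_IcoI:
  fixes f :: "real \<Rightarrow> real"
  assumes "\<And>t. 0 \<le> t \<Longrightarrow> t < T \<Longrightarrow> continuous_on {0..t} f"
  shows "continuous_on {0..<T} f"
  unfolding continuous_on_eq_continuous_within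
proof
  fix x assume x: "x \<in> {0..<T}"
  define t where "t = (x + T) / 2"
  have t: "0 \<le> t" "t < T" "x < t" using x by (auto simp: t_def)
  have "continuous (at x within {0..t}) f"
    using assms[OF t(1,2)] x t(3) by (simp add: continuous_on_eq_continuous_within)
  moreover have "at x within {0..t} = at x within {0..<T}"
    by (rule at_within_nhd[of x "{..<t}"]) (use t in auto)
  ultimately show "continuous (at x within {0..<T}) f" by simp
qed

context bridge_coefficients
begin

lemma mean_continuous: "t < T \<Longrightarrow> continuous_on {0..t} (mean a)"
  by (rule DERIV_continuous_on[OF mean_deriv]) auto

lemma forced_continuous:
  assumes t: "t < T" and f: "continuous_on {0..t} f"
  shows "continuous_on {0..t} (forced f)"
proof -
  have kf: "continuous_on {0..t} (\<lambda>s. - rate s / scale s * f s)"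
    by (intro continuous_on_mult inverse_scale'_continuous t f)
  have "continuous_on {0..t} (\<lambda>s. integral {0..s} (\<lambda>s. - rate s / scale s * f s))"
    by (rule DERIV_continuous_on[OF integral_has_real_derivative[OF kf]])
  then show ?thesis
    unfolding forced_def[abs_def]
    by (intro continuous_intros f scale_continuous t) (use scale_pos t in force)+
qed

end

locale brownian_bridge = brownian_setup M F B + bridge_coefficients q \<sigma> r T b
  for M :: "'w measure" and F B and q \<sigma> r T b
begin

abbreviation "drift \<equiv> bridge_drift q \<sigma> r T b"

section \<open>Uniqueness for the stochastic equation\<close>

lemma ito_integral_process_unique:
  assumes J: "ito_integral_process M F B T (\<lambda>s _. \<sigma> s) J" and J': "ito_integral_process M F B T (\<lambda>s _. \<sigma> s) J'"
  shows "indistinguishable M T J J'"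
proof (rule indistinguishable_of_AE_eq)
  fix t assume t: "t \<in> {0..<T}"
  then have t0: "0 \<le> t" by simp
  have c: "continuous_on {0..t} \<sigma>" by (rule continuous_on_subset[OF \<sigma>]) auto
  have "has_ito_integral M F B t (\<lambda>s _. \<sigma> s) (J t)" "has_ito_integral M F B t (\<lambda>s _. \<sigma> s) (J' t)"
    using J J' t unfolding ito_integral_process_def by auto
  from this[THEN has_ito_integral_imp_wiener_integral[OF _ t0 c]]
  show "AE \<omega> in M. J t \<omega> = J' t \<omega>" by (rule wiener_integral_unique)
qed (use J J' in \<open>auto simp: ito_integral_process_def\<close>)

theorem strong_solutions_indistinguishable:
  assumes X: "strong_solution M F B T drift \<sigma> \<xi> X" and Y: "strong_solution M F B T drift \<sigma> \<xi> Y"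
  shows "indistinguishable M T X Y"
proof -
  obtain J where J: "ito_integral_process M F B T (\<lambda>s _. \<sigma> s) J"
    and XJ: "AE \<omega> in M. \<forall>t\<in>{0..<T}. X t \<omega> = X 0 \<omega> + integral {0..t} (\<lambda>s. drift s (X s \<omega>)) + J t \<omega>"
    using X unfolding strong_solution_def by (elim conjE exE) (rule that)
  obtain J' where J': "ito_integral_process M F B T (\<lambda>s _. \<sigma> s) J'"
    and YJ: "AE \<omega> in M. \<forall>t\<in>{0..<T}. Y t \<omega> = Y 0 \<omega> + integral {0..t} (\<lambda>s. drift s (Y s \<omega>)) + J' t \<omega>"
    using Y unfolding strong_solution_def by (elim conjE exE) (rule that)
  have Xc: "\<And>\<omega>. \<omega> \<in> space M \<Longrightarrow> continuous_on {0..<T} (\<lambda>t. X t \<omega>)" and X0: "AE \<omega> in M. X 0 \<omega> = \<xi> \<omega>"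
    and Yc: "\<And>\<omega>. \<omega> \<in> space M \<Longrightarrow> continuous_on {0..<T} (\<lambda>t. Y t \<omega>)" and Y0: "AE \<omega> in M. Y 0 \<omega> = \<xi> \<omega>"
    using X Y unfolding strong_solution_def by auto
  have JJ: "AE \<omega> in M. \<forall>t\<in>{0..<T}. J t \<omega> = J' t \<omega>"
    using ito_integral_process_unique[OF J J'] unfolding indistinguishable_def .
  have "AE \<omega> in M. \<forall>t\<in>{0..<T}. X t \<omega> = Y t \<omega>"
    using AE_space XJ YJ X0 Y0 JJ
  proof eventually_elim
    case (elim \<omega>)
    \<comment> \<open>The drift is affine in x; its inhomogeneous part, the initial value and the
      driving integral all cancel in the difference.\<close>
    have "X t \<omega> - Y t \<omega> = 0" if "t \<in> {0..<T}" for t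
    proof (rule homogeneous_unique[OF _ _ that])
      show "continuous_on {0..<T} (\<lambda>t. X t \<omega> - Y t \<omega>)"
        by (intro continuous_on_diff Xc Yc elim)
      fix t assume t: "t \<in> {0..<T}"
      have sub: "{0..t} \<subseteq> {0..<T}" using t by auto
      have int: "(\<lambda>s. drift s (X s \<omega>)) integrable_on {0..t}" "(\<lambda>s. drift s (Y s \<omega>)) integrable_on {0..t}"
        by (rule integrable_continuous_real, rule drift_continuous, use t in simp,
            rule continuous_on_subset[OF _ sub], rule Xc Yc, rule elim)+
      have "X t \<omega> - Y t \<omega> = integral {0..t} (\<lambda>s. drift s (X s \<omega>)) - integral {0..t} (\<lambda>s. drift s (Y s \<omega>))"
        using elim t by simp
      also have "\<dots> = integral {0..t} (\<lambda>s. drift s (X s \<omega>) - drift s (Y s \<omega>))"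
        by (rule Henstock_Kurzweil_Integration.integral_diff[OF int, symmetric])
      also have "\<dots> = integral {0..t} (\<lambda>s. rate s * (X s \<omega> - Y s \<omega>))"
        using t by (intro Henstock_Kurzweil_Integration.integral_cong)
          (simp add: bridge_drift_eq right_diff_distrib)
      finally show "X t \<omega> - Y t \<omega> = integral {0..t} (\<lambda>s. rate s * (X s \<omega> - Y s \<omega>))" .
    qed
    then show ?case by simp
  qed
  then show ?thesis unfolding indistinguishable_def .
qed

section \<open>Construction of the bridge and transfer of the equation\<close>

abbreviation kernel :: "real \<Rightarrow> real \<Rightarrow> real" where
  "kernel t s \<equiv> gam q \<sigma> t T / gam q \<sigma> s T * exp (Q t - Q s) * \<sigma> s"

lemma kernel_continuous:
  assumes "0 \<le> t" "t < T"
  shows "continuous_on {0..t} (kernel t)"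
proof -
  have "continuous_on {0..t} (\<lambda>s. scale t * (1 / scale s * \<sigma> s))"
    by (intro continuous_intros scale_continuous continuous_on_subset[OF \<sigma>]) (use assms scale_pos in force)+
  then show ?thesis
    by (rule continuous_on_eq) (rule kernel_eq[symmetric], use assms in auto)
qed

theorem bridge_exists:
  obtains J U where "ito_integral_process M F B T (\<lambda>s _. \<sigma> s) J" "bridge_process M F B q \<sigma> r T a b U"
    "\<And>\<omega>. J 0 \<omega> = 0"
    "\<And>\<omega> t. \<omega> \<in> space M \<Longrightarrow> t \<in> {0..<T} \<Longrightarrow> U t \<omega> = a + integral {0..t} (\<lambda>s. drift s (U s \<omega>)) + J t \<omega>"
proof -
  obtain J where Jc: "\<And>\<omega>. \<omega> \<in> space M \<Longrightarrow> continuous_on {0..T} (\<lambda>t. J t \<omega>)"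
    and JW: "\<And>t. t \<in> {0..T} \<Longrightarrow> wiener_integral (\<lambda>s. \<sigma> s * indicator {0..t} s) (J t)"
    and J0: "\<And>\<omega>. J 0 \<omega> = 0"
    using continuous_wiener_integral_exists[OF T continuous_on_subset[OF \<sigma>]] by auto
  \<comment> \<open>Defined path by path, so that the equation holds for every sample point; that
    \<open>U\<close> also satisfies the stochastic formula is then a statement about the
    graph.\<close>
  define U where "U t \<omega> = mean a t + scale t * forced (\<lambda>s. J s \<omega>) t" for t \<omega>
  have Jt: "continuous_on {0..t} (\<lambda>s. J s \<omega>)" if "t < T" "\<omega> \<in> space M" for t \<omega>
    by (rule continuous_on_subset[OF Jc]) (use that in auto)
  have \<sigma>t: "continuous_on {0..t} \<sigma>" for t by (rule continuous_on_subset[OF \<sigma>]) auto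
  show ?thesis
  proof (rule that[of J U])
    show "ito_integral_process M F B T (\<lambda>s _. \<sigma> s) J"
      unfolding ito_integral_process_def
    proof (intro conjI ballI)
      show "continuous_on {0..<T} (\<lambda>t. J t \<omega>)" if "\<omega> \<in> space M" for \<omega>
        by (rule continuous_on_subset[OF Jc[OF that]]) auto
      show "has_ito_integral M F B t (\<lambda>s _. \<sigma> s) (J t)" if "t \<in> {0..<T}" for t
        by (rule wiener_integral_imp_has_ito_integral[OF JW _ \<sigma>t]) (use that in auto)
    qed
    show "bridge_process M F B q \<sigma> r T a b U"
      unfolding bridge_process_def
    proof (intro conjI ballI)
      show "continuous_on {0..<T} (\<lambda>t. U t \<omega>)" if "\<omega> \<in> space M" for \<omega>
        unfolding U_def
        by (intro continuous_on_IcoI continuous_on_add continuous_on_mult mean_continuous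
            scale_continuous forced_continuous Jt that)
      fix t assume "t \<in> {0..<T}"
      then have t: "0 \<le> t" "t < T" by auto
      \<comment> \<open>Integration by parts with weight 1/\<open>scale\<close>, whose derivative is
        the function inside \<open>forced\<close>; multiplying by \<open>scale t\<close> produces
        the bridge kernel.\<close>
      have "wiener_integral (\<lambda>s. 1 / scale s * \<sigma> s * indicator {0..t} s) (\<lambda>\<omega>. forced (\<lambda>s. J s \<omega>) t)"
        unfolding forced_def
      proof (rule wiener_integral_by_parts[OF t(1) \<sigma>t inverse_scale'_continuous[OF t(2)]])
        show "((\<lambda>s. 1 / scale s) has_real_derivative - rate s / scale s) (at s within {0..t})"
          if "s \<in> {0..t}" for s
          by (rule inverse_scale_deriv) (use that t in auto)
        show "wiener_integral (\<lambda>u. \<sigma> u * indicator {0..s} u) (J s)" if "s \<in> {0..t}" for s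
          by (rule JW) (use that t in auto)
      qed (rule Jt[OF t(2)] J0, assumption?)+
      from wiener_integral_cmult[OF this, of "scale t"]
      have "wiener_integral (\<lambda>s. scale t * (1 / scale s * \<sigma> s * indicator {0..t} s))
        (\<lambda>\<omega>. U t \<omega> - bridge_mean q \<sigma> r T a b 0 t)"
        by (simp add: U_def bridge_mean_eq[OF t])
      moreover have "(\<lambda>s. scale t * (1 / scale s * \<sigma> s * indicator {0..t} s)) =
        (\<lambda>s. kernel t s * indicator {0..t} s)"
      proof
        fix s
        show "scale t * (1 / scale s * \<sigma> s * indicator {0..t} s) = kernel t s * indicator {0..t} s"
        proof (cases "s \<in> {0..t}")
          case True
          then have "kernel t s = scale t * (1 / scale s * \<sigma> s)" using t by (intro kernel_eq) auto
          then show ?thesis by (simp only: mult.assoc)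
        qed simp
      qed
      ultimately have "wiener_integral (\<lambda>s. kernel t s * indicator {0..t} s)
        (\<lambda>\<omega>. U t \<omega> - bridge_mean q \<sigma> r T a b 0 t)" by simp
      then show "has_ito_integral M F B t (\<lambda>s _. kernel t s) (\<lambda>\<omega>. U t \<omega> - bridge_mean q \<sigma> r T a b 0 t)"
        by (rule wiener_integral_imp_has_ito_integral[OF _ t(1) kernel_continuous[OF t]])
    qed
    show "J 0 \<omega> = 0" for \<omega> by (rule J0)
    fix \<omega> t assume \<omega>: "\<omega> \<in> space M" and t: "t \<in> {0..<T}"
    show "U t \<omega> = a + integral {0..t} (\<lambda>s. drift s (U s \<omega>)) + J t \<omega>"
      by (rule variation_of_constants[OF _ J0 t U_def])
        (rule continuous_on_subset[OF Jc[OF \<omega>]], auto)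
  qed
qed

text \<open>At each time \<open>V\<close> and the constructed \<open>U\<close> are versions of the
  same integral plus the same mean; continuity makes them indistinguishable, so the pathwise
  equation passes from \<open>U\<close> to \<open>V\<close>.\<close>

theorem bridge_process_strong_solution:
  assumes V: "bridge_process M F B q \<sigma> r T a b V"
  shows "strong_solution M F B T drift \<sigma> (\<lambda>_. a) V"
proof -
  obtain J U where J: "ito_integral_process M F B T (\<lambda>s _. \<sigma> s) J" and U: "bridge_process M F B q \<sigma> r T a b U"
    and J0: "\<And>\<omega>. J 0 \<omega> = 0"
    and UJ: "\<And>\<omega> t. \<omega> \<in> space M \<Longrightarrow> t \<in> {0..<T} \<Longrightarrow>
      U t \<omega> = a + integral {0..t} (\<lambda>s. drift s (U s \<omega>)) + J t \<omega>"
    by (rule bridge_exists[of a]) (rule that)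
  have Vc: "\<And>\<omega>. \<omega> \<in> space M \<Longrightarrow> continuous_on {0..<T} (\<lambda>t. V t \<omega>)"
    and Uc: "\<And>\<omega>. \<omega> \<in> space M \<Longrightarrow> continuous_on {0..<T} (\<lambda>t. U t \<omega>)"
    and VI: "\<And>t. t \<in> {0..<T} \<Longrightarrow> has_ito_integral M F B t (\<lambda>s _. kernel t s) (\<lambda>\<omega>. V t \<omega> - bridge_mean q \<sigma> r T a b 0 t)"
    and UI: "\<And>t. t \<in> {0..<T} \<Longrightarrow> has_ito_integral M F B t (\<lambda>s _. kernel t s) (\<lambda>\<omega>. U t \<omega> - bridge_mean q \<sigma> r T a b 0 t)"
    using U V unfolding bridge_process_def by simp_all
  have "indistinguishable M T V U"
  proof (rule indistinguishable_of_AE_eq[OF Vc Uc])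
    fix t assume t: "t \<in> {0..<T}"
    then have t': "0 \<le> t" "t < T" by auto
    from wiener_integral_unique[OF
        has_ito_integral_imp_wiener_integral[OF VI[OF t] t'(1) kernel_continuous[OF t']]
        has_ito_integral_imp_wiener_integral[OF UI[OF t] t'(1) kernel_continuous[OF t']]]
    show "AE \<omega> in M. V t \<omega> = U t \<omega>" by eventually_elim simp
  qed
  then have VU: "AE \<omega> in M. \<forall>t\<in>{0..<T}. V t \<omega> = U t \<omega>" unfolding indistinguishable_def .
  have U0: "U 0 \<omega> = a" if "\<omega> \<in> space M" for \<omega>
    using UJ[OF that, of 0] T J0[of \<omega>] by simp
  show ?thesis
    unfolding strong_solution_def
  proof (intro conjI ballI exI[of _ J])
    fix t assume t: "t \<in> {0..<T}"
    then have t0: "0 \<le> t" by simp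
    \<comment> \<open>Adaptedness is not part of \<open>bridge_process\<close>; it is recovered from
      the stochastic integral.\<close>
    have "(\<lambda>\<omega>. (V t \<omega> - bridge_mean q \<sigma> r T a b 0 t) + bridge_mean q \<sigma> r T a b 0 t) \<in> borel_measurable (F t)"
      by (intro borel_measurable_add borel_measurable_const has_ito_integral_adapted[OF VI[OF t] t0])
    then show "V t \<in> borel_measurable (F t)" by simp
  next
    show "AE \<omega> in M. V 0 \<omega> = a"
      using AE_space VU by eventually_elim (use T U0 in simp)
    show "AE \<omega> in M. \<forall>t\<in>{0..<T}. (\<lambda>s. drift s (V s \<omega>)) absolutely_integrable_on {0..t} \<and>
        (\<lambda>s. (\<sigma> s)\<^sup>2) integrable_on {0..t}"
    proof (rule AE_I2, intro ballI conjI)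
      fix \<omega> t assume \<omega>: "\<omega> \<in> space M" and t: "t \<in> {0..<T}"
      show "(\<lambda>s. drift s (V s \<omega>)) absolutely_integrable_on {0..t}"
        by (rule absolutely_integrable_continuous_real, rule drift_continuous)
          (use t in \<open>auto intro!: continuous_on_subset[OF Vc[OF \<omega>]]\<close>)
      show "(\<lambda>s. (\<sigma> s)\<^sup>2) integrable_on {0..t}"
        by (intro integrable_continuous_real continuous_intros continuous_on_subset[OF \<sigma>]) auto
    qed
    show "AE \<omega> in M. \<forall>t\<in>{0..<T}. V t \<omega> = V 0 \<omega> + integral {0..t} (\<lambda>s. drift s (V s \<omega>)) + J t \<omega>"
      using AE_space VU
    proof eventually_elim
      case (elim \<omega>)
      show ?case
      proof
        fix t assume t: "t \<in> {0..<T}"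
        have "integral {0..t} (\<lambda>s. drift s (V s \<omega>)) = integral {0..t} (\<lambda>s. drift s (U s \<omega>))"
          using elim(2) t by (intro Henstock_Kurzweil_Integration.integral_cong) simp
        then show "V t \<omega> = V 0 \<omega> + integral {0..t} (\<lambda>s. drift s (V s \<omega>)) + J t \<omega>"
          using elim UJ[OF elim(1) t] U0[OF elim(1)] t T by simp
      qed
    qed
  qed (use Vc J in auto)
qed

end

theorem theorem3p2:
  fixes M :: "'a measure" and F :: "real \<Rightarrow> 'a measure" and B :: "real \<Rightarrow> 'a \<Rightarrow> real"
    and q \<sigma> r :: "real \<Rightarrow> real" and a b T :: real
  assumes "continuous_on {0..} q" and "continuous_on {0..} \<sigma>" and "continuous_on {0..} r"
    and "F = (\<lambda>t. augmentation M (history M B t))"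
    and "usual_conditions M F"
    and "wiener_process M F B"
    and "T > 0"
    and "\<forall>t\<ge>0. \<sigma> t \<noteq> 0"
  shows "(\<exists>U. bridge_process M F B q \<sigma> r T a b U) \<and>
    (\<forall>U. bridge_process M F B q \<sigma> r T a b U \<longrightarrow>
       strong_solution M F B T (bridge_drift q \<sigma> r T b) \<sigma> (\<lambda>_. a) U \<and>
       (\<forall>X. strong_solution M F B T (bridge_drift q \<sigma> r T b) \<sigma> (\<lambda>_. a) X \<longrightarrow>
          indistinguishable M T X U)) \<and>
    strong_uniqueness TYPE('b) T (bridge_drift q \<sigma> r T b) \<sigma>"
proof -
  have coeffs: "bridge_coefficients q \<sigma> r T"
    using assms by unfold_locales auto
  interpret brownian_bridge M F B q \<sigma> r T b
    using coeffs assms(5,6) by (simp add: brownian_bridge_def brownian_setup_def)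
  have "strong_uniqueness TYPE('b) T (bridge_drift q \<sigma> r T b) \<sigma>"
    unfolding strong_uniqueness_def
  proof (intro allI impI)
    fix M :: "'b measure" and F B \<xi> X Y
    assume "usual_conditions M F" "wiener_process M F B"
      and XY: "strong_solution M F B T (bridge_drift q \<sigma> r T b) \<sigma> \<xi> X"
        "strong_solution M F B T (bridge_drift q \<sigma> r T b) \<sigma> \<xi> Y"
    \<comment> \<open>The set-up on the sample space type \<open>'b\<close> is a new one, so the
      locale is instantiated a second time with the same coefficients.\<close>
    then interpret other: brownian_bridge M F B q \<sigma> r T b
      using coeffs by (simp add: brownian_bridge_def brownian_setup_def)
    show "indistinguishable M T X Y" by (rule other.strong_solutions_indistinguishable[OF XY])
  qed
  moreover have "\<exists>U. bridge_process M F B q \<sigma> r T a b U"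
    by (rule bridge_exists[of a]) (rule exI)
  ultimately show ?thesis
    using strong_solutions_indistinguishable[OF _ bridge_process_strong_solution]
    by (intro conjI allI impI bridge_process_strong_solution)
qed

end
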